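(* For $d>1$ let $T$ be a random $\mathrm{Poisson}(d)$ tree, and consider the hard-core model with fugacity $0<\lambda<\infty$ on $T$. "Almost surely" below means with conditional probability $1$ given that $T$ is infinite. 1. If $1<d<d_0=1.179\ldots$, then for every $0<\lambda<\infty$, almost surely WSM holds. 2. If $$\lambda<\begin{cases}\dfrac{4d^2}{(d^2-1)^2} & \text{when } d<\sqrt{2+\sqrt5},\\[2mm] \dfrac{3+\sqrt{1+4d^2}}{2d^2-4} & \text{otherwise,}\end{cases}$$ then almost surely SSM holds. 3. There is a function $\eta_1(d)$ with $\eta_1(d)\to 0$ as $d\to\infty$ such that almost surely WSM holds whenever $0<\lambda<\dfrac{e-\eta_1(d)}{d}$. 4. There is a function $\eta_2(d)$ with $\eta_2(d)\to 0$ as $d\to\infty$ such that, for all sufficiently large $d$, with $\lambda=\dfrac{e+\eta_2(d)}{d}$, almost surely WSM does not hold.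
   Context: The constant $d_0=1.179\ldots$ is the unique solution $d>1$ of $\frac{1}{2}\left(1+e^{-d e^{-d}}\right)=\frac1d$. Poisson tree: for $d>0$, $\mathrm{Poisson}(d)$ denotes the random rooted tree in which every vertex independently has a random number of children with distribution $\Pr(X=i)=e^{-d}d^i/i!$, $i\ge 0$ (the Galton–Watson tree with Poisson offspring of mean $d$). Hard-core model with finite fugacity $\lambda$ on a graph $G$ (locally finite): configurations are independent sets of $G$ (each vertex is "occupied" or "unoccupied", no two adjacent vertices are occupied). For a finite vertex set $\Psi$, let $\partial\Psi=\{v\in\Psi : v \text{ has a neighbor not in } \Psi\}$. For a boundary condition $\sigma$ on $\partial\Psi$ (an assignment of occupied/unoccupied with no two adjacent occupied vertices), $\mu_\Psi^\sigma$ is the probability distribution on independent sets $S$ of the subgraph induced by $\Psi$ that agree with $\sigma$ on $\partial\Psi$, with probability proportional to $\lambda^{|S|}$. Weak spatial mixing (WSM): for every finite vertex set $\Lambda$, and every sequence of triples $(\Psi_n,\sigma_n,\tau_n)$ with $\Psi_n\supset\Lambda$ finite and $\sigma_n,\tau_n$ boundary conditions on $\partial\Psi_n$, if $\mathrm{dist}(\Lambda,\partial\Psi_n)\to\infty$ then $\|\mu_{\Psi_n}^{\sigma_n}-\mu_{\Psi_n}^{\tau_n}\|_\Lambda\to 0$, where $\|\cdot\|_\Lambda$ is the total variation distance between the marginals on $\Lambda$ (distance to the empty set is $+\infty$). WSM is equivalent to uniqueness of the Gibbs measure. Strong spatial mixing (SSM): the analogous property in which only the set of vertices on which the two boundary conditions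 disagree is required to be at distance tending to infinity from $\Lambda$ (nearer vertices may be frozen identically in both). For independent sets this is taken in the equivalent form: SSM holds on $G$ if and only if WSM holds for the hard-core model (with the same fugacity) on every subgraph of $G$. *)

theory Defs
  imports "HOL-Probability.Probability"
begin

record 'v graph =
  verts :: "'v set"
  edges :: "'v set set"

definition simple_graph :: "'v graph \<Rightarrow> bool" where
  "simple_graph G \<longleftrightarrow>
     (\<forall>e\<in>edges G. \<exists>u v. u \<in> verts G \<and> v \<in> verts G \<and> u \<noteq> v \<and> e = {u, v})"

definition adjacent :: "'v graph \<Rightarrow> 'v \<Rightarrow> 'v \<Rightarrow> bool" where
  "adjacent G u v \<longleftrightarrow> {u, v} \<in> edges G"

definition locally_finite_graph :: "'v graph \<Rightarrow> bool" where
  "locally_finite_graph G \<longleftrightarrow> (\<forall>v\<in>verts G. finite {u. adjacent G v u})"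

text \<open>Subgraphs need be neither induced nor spanning nor connected.\<close>

definition subgraph_of :: "'v graph \<Rightarrow> 'v graph \<Rightarrow> bool" where
  "subgraph_of H G \<longleftrightarrow> simple_graph H \<and> verts H \<subseteq> verts G \<and> edges H \<subseteq> edges G"

text \<open>Distances are infinite between different components and to the empty set: in both
  cases the infimum ranges over the empty set.\<close>

definition vertex_dist :: "'v graph \<Rightarrow> 'v \<Rightarrow> 'v \<Rightarrow> enat" where
  "vertex_dist G u v = (INF n \<in> {n. (u, v) \<in> {(x, y). adjacent G x y} ^^ n}. enat n)"

definition set_dist :: "'v graph \<Rightarrow> 'v set \<Rightarrow> 'v set \<Rightarrow> enat" where
  "set_dist G A B = (INF u\<in>A. INF v\<in>B. vertex_dist G u v)"

definition independent_in :: "'v graph \<Rightarrow> 'v set \<Rightarrow> bool" where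
  "independent_in G S \<longleftrightarrow> S \<subseteq> verts G \<and> (\<forall>u\<in>S. \<forall>v\<in>S. \<not> adjacent G u v)"

definition inner_boundary :: "'v graph \<Rightarrow> 'v set \<Rightarrow> 'v set" where
  "inner_boundary G \<Psi> = {v \<in> \<Psi>. \<exists>u \<in> verts G - \<Psi>. adjacent G v u}"

text \<open>A boundary condition, like a configuration, is represented by its set of occupied
  vertices.  The fugacity is written \<open>\<theta>\<close>.\<close>

definition boundary_condition :: "'v graph \<Rightarrow> 'v set \<Rightarrow> 'v set \<Rightarrow> bool" where
  "boundary_condition G \<Psi> \<sigma> \<longleftrightarrow> \<sigma> \<subseteq> inner_boundary G \<Psi> \<and> independent_in G \<sigma>"

definition hardcore_configs :: "'v graph \<Rightarrow> 'v set \<Rightarrow> 'v set \<Rightarrow> 'v set set" where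
  "hardcore_configs G \<Psi> \<sigma> =
     {S. S \<subseteq> \<Psi> \<and> independent_in G S \<and> S \<inter> inner_boundary G \<Psi> = \<sigma>}"

definition hardcore :: "real \<Rightarrow> 'v graph \<Rightarrow> 'v set \<Rightarrow> 'v set \<Rightarrow> 'v set pmf" where
  "hardcore \<theta> G \<Psi> \<sigma> = embed_pmf (\<lambda>S.
     if S \<in> hardcore_configs G \<Psi> \<sigma>
     then \<theta> ^ card S / (\<Sum>S'\<in>hardcore_configs G \<Psi> \<sigma>. \<theta> ^ card S') else 0)"

lemma pmf_hardcore:
  assumes "finite \<Psi>" "\<Psi> \<subseteq> verts G" "boundary_condition G \<Psi> \<sigma>" "\<theta> > 0"
  shows "pmf (hardcore \<theta> G \<Psi> \<sigma>) S =
    (if S \<in> hardcore_configs G \<Psi> \<sigma>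
     then \<theta> ^ card S / (\<Sum>S'\<in>hardcore_configs G \<Psi> \<sigma>. \<theta> ^ card S') else 0)"
proof -
  let ?C = "hardcore_configs G \<Psi> \<sigma>"
  let ?Z = "\<Sum>S'\<in>?C. \<theta> ^ card S'"
  let ?f = "\<lambda>S. if S \<in> ?C then \<theta> ^ card S / ?Z else 0"
  have fin: "finite ?C"
    using assms(1) by (auto simp: hardcore_configs_def intro: finite_subset[of _ "Pow \<Psi>"])
  have "\<sigma> \<in> ?C"
    using assms(3) by (auto simp: hardcore_configs_def boundary_condition_def inner_boundary_def)
  then have Z: "?Z > 0"
    using assms(4) fin by (intro sum_pos) auto
  have nonneg: "?f S \<ge> 0" for S
    using Z assms(4) by auto
  have "(\<integral>\<^sup>+ S. ennreal (?f S) \<partial>count_space UNIV) = (\<Sum>S\<in>?C. ennreal (?f S))"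
    using fin by (intro nn_integral_count_space'[of ?C]) auto
  also have "\<dots> = ennreal (\<Sum>S\<in>?C. \<theta> ^ card S / ?Z)"
    using Z assms(4) by (subst sum_ennreal) (auto simp: less_imp_le)
  also have "\<dots> = 1"
    using Z by (simp flip: sum_divide_distrib)
  finally show ?thesis
    unfolding hardcore_def using nonneg by (subst pmf_embed_pmf) auto
qed

definition tv_dist :: "'a pmf \<Rightarrow> 'a pmf \<Rightarrow> real" where
  "tv_dist p q = (SUP A. \<bar>measure_pmf.prob p A - measure_pmf.prob q A\<bar>)"

definition tv_dist_on :: "'v set \<Rightarrow> 'v set pmf \<Rightarrow> 'v set pmf \<Rightarrow> real" where
  "tv_dist_on \<Lambda> p q = tv_dist (map_pmf (\<lambda>S. S \<inter> \<Lambda>) p) (map_pmf (\<lambda>S. S \<inter> \<Lambda>) q)"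

definition WSM :: "real \<Rightarrow> 'v graph \<Rightarrow> bool" where
  "WSM \<theta> G \<longleftrightarrow>
     (\<forall>\<Lambda> (\<Psi> :: nat \<Rightarrow> 'v set) \<sigma> \<tau>.
        finite \<Lambda> \<longrightarrow>
        (\<forall>n. finite (\<Psi> n) \<and> \<Lambda> \<subseteq> \<Psi> n \<and> \<Psi> n \<subseteq> verts G \<and>
             boundary_condition G (\<Psi> n) (\<sigma> n) \<and> boundary_condition G (\<Psi> n) (\<tau> n)) \<longrightarrow>
        (\<lambda>n. set_dist G \<Lambda> (inner_boundary G (\<Psi> n))) \<longlonglongrightarrow> \<infinity> \<longrightarrow>
        (\<lambda>n. tv_dist_on \<Lambda> (hardcore \<theta> G (\<Psi> n) (\<sigma> n)) (hardcore \<theta> G (\<Psi> n) (\<tau> n)))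
          \<longlonglongrightarrow> 0)"

text \<open>Freezing vertices identically in both boundary conditions amounts to passing to a
  subgraph, so strong spatial mixing is weak spatial mixing on all subgraphs.\<close>

definition SSM :: "real \<Rightarrow> 'v graph \<Rightarrow> bool" where
  "SSM \<theta> G \<longleftrightarrow> (\<forall>H. subgraph_of H G \<longrightarrow> WSM \<theta> H)"

text \<open>Potential individuals are labelled by finite words over the natural numbers
  (Ulam-Harris labels), the root being the empty word; the children of \<open>v\<close> are \<open>v @ [i]\<close> for
  \<open>i\<close> below the offspring number of \<open>v\<close>.\<close>

inductive_set gw_verts :: "(nat list \<Rightarrow> nat) \<Rightarrow> nat list set" for \<xi> where
  root: "[] \<in> gw_verts \<xi>"
| child: "v \<in> gw_verts \<xi> \<Longrightarrow> i < \<xi> v \<Longrightarrow> v @ [i] \<in> gw_verts \<xi>"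

definition gw_tree :: "(nat list \<Rightarrow> nat) \<Rightarrow> nat list graph" where
  "gw_tree \<xi> = \<lparr>verts = gw_verts \<xi>,
                edges = {{v, v @ [i]} | v i. v \<in> gw_verts \<xi> \<and> i < \<xi> v}\<rparr>"

lemma simple_graph_gw_tree: "simple_graph (gw_tree \<xi>)"
  unfolding simple_graph_def
proof
  fix e assume "e \<in> edges (gw_tree \<xi>)"
  then obtain v i where vi: "e = {v, v @ [i]}" "v \<in> gw_verts \<xi>" "i < \<xi> v"
    by (auto simp: gw_tree_def)
  then have "v @ [i] \<in> gw_verts \<xi>"
    by (intro gw_verts.child)
  with vi show "\<exists>u v. u \<in> verts (gw_tree \<xi>) \<and> v \<in> verts (gw_tree \<xi>) \<and> u \<noteq> v \<and> e = {u, v}"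
    by (intro exI[of _ v] exI[of _ "v @ [i]"]) (simp add: gw_tree_def)
qed

lemma locally_finite_gw_tree: "locally_finite_graph (gw_tree \<xi>)"
  unfolding locally_finite_graph_def
proof
  fix v assume "v \<in> verts (gw_tree \<xi>)"
  have "{u. adjacent (gw_tree \<xi>) v u} \<subseteq> insert (butlast v) ((\<lambda>i. v @ [i]) ` {..<\<xi> v})"
    by (auto simp: adjacent_def gw_tree_def doubleton_eq_iff)
  then show "finite {u. adjacent (gw_tree \<xi>) v u}"
    by (rule finite_subset) auto
qed

definition offspring :: "real \<Rightarrow> (nat list \<Rightarrow> nat) measure" where
  "offspring d = (\<Pi>\<^sub>M v\<in>UNIV. measure_pmf (poisson_pmf d))"

definition tree_infinite :: "(nat list \<Rightarrow> nat) set" where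
  "tree_infinite = {\<xi>. infinite (verts (gw_tree \<xi>))}"

definition offspring_inf :: "real \<Rightarrow> (nat list \<Rightarrow> nat) measure" where
  "offspring_inf d = uniform_measure (offspring d) tree_infinite"

lemma prob_space_offspring: "prob_space (offspring d)"
  unfolding offspring_def
  by (intro prob_space_PiM measure_pmf.prob_space_axioms)

lemma gw_verts_snoc: "v @ [i] \<in> gw_verts \<xi> \<longleftrightarrow> v \<in> gw_verts \<xi> \<and> i < \<xi> v"
  by (auto elim: gw_verts.cases intro: gw_verts.child)

lemma tree_infinite_measurable: "tree_infinite \<in> sets (offspring d)"
proof -
  have sp: "space (offspring d) = UNIV"
    by (simp add: offspring_def space_PiM PiE_def)
  have comp: "(\<lambda>\<xi>. \<xi> v) \<in> measurable (offspring d) (count_space UNIV)" for v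
    unfolding offspring_def
    using measurable_component_singleton[of v UNIV "\<lambda>_. measure_pmf (poisson_pmf d)"] by simp
  have mem: "{\<xi>. v \<in> gw_verts \<xi>} \<in> sets (offspring d)" for v
  proof (induction v rule: rev_induct)
    case Nil
    then show ?case
      using sets.top[of "offspring d"] by (simp add: sp gw_verts.root)
  next
    case (snoc i v)
    have "(\<lambda>\<xi>. \<xi> v) -` {i<..} \<inter> space (offspring d) \<in> sets (offspring d)"
      using comp by (rule measurable_sets) auto
    then have "{\<xi>. v \<in> gw_verts \<xi>} \<inter> ((\<lambda>\<xi>. \<xi> v) -` {i<..}) \<in> sets (offspring d)"
      using snoc by (auto simp: sp)
    moreover have "{\<xi>. v @ [i] \<in> gw_verts \<xi>} = {\<xi>. v \<in> gw_verts \<xi>} \<inter> ((\<lambda>\<xi>. \<xi> v) -` {i<..})"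
      by (auto simp: gw_verts_snoc)
    ultimately show ?case by simp
  qed
  have sub: "{\<xi>. gw_verts \<xi> \<subseteq> F} = (\<Inter>v\<in>-F. - {\<xi>. v \<in> gw_verts \<xi>})" for F
    by auto
  have cnt: "{\<xi>. gw_verts \<xi> \<subseteq> F} \<in> sets (offspring d)" if "finite F" for F
  proof -
    have "- F \<noteq> {}"
      using that infinite_UNIV_listI finite_compl[of F] by force
    moreover have "- {\<xi>. v \<in> gw_verts \<xi>} \<in> sets (offspring d)" for v
      using sets.compl_sets[OF mem[of v]] by (simp add: sp Compl_eq_Diff_UNIV)
    ultimately show ?thesis
      unfolding sub by (intro sets.countable_INT') auto
  qed
  have "(\<Union>F\<in>Collect finite. {\<xi>. gw_verts \<xi> \<subseteq> F}) \<in> sets (offspring d)"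
    using cnt by (intro sets.countable_UN' countable_Collect_finite) auto
  moreover have "tree_infinite = - (\<Union>F\<in>Collect finite. {\<xi>. gw_verts \<xi> \<subseteq> F})"
    by (auto simp: tree_infinite_def gw_tree_def dest: finite_subset)
  ultimately show ?thesis
    using sets.compl_sets[of "\<Union>F\<in>Collect finite. {\<xi>. gw_verts \<xi> \<subseteq> F}" "offspring d"]
    by (simp only: sp Compl_eq_Diff_UNIV)
qed

text \<open>Conditioning on a null event would be meaningless; for \<open>d > 1\<close> the event
  \<open>tree_infinite\<close> has positive probability, and then the predicate says that \<open>P\<close> has
  conditional probability 1 given that the tree is infinite.\<close>

definition almost_surely_given_infinite :: "real \<Rightarrow> (nat list graph \<Rightarrow> bool) \<Rightarrow> bool" where
  "almost_surely_given_infinite d P \<longleftrightarrow> (AE \<xi> in offspring_inf d. P (gw_tree \<xi>))"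

definition d0 :: real where
  "d0 = (THE d. d > 1 \<and> (1 + exp (- (d * exp (- d)))) / 2 = 1 / d)"

lemma exp_neg_ge_Taylor:
  assumes "x \<ge> 0" "even n"
  shows "(\<Sum>m<n. (-x) ^ m / fact m) \<le> exp (-x :: real)"
proof -
  obtain t where "exp (-x) = (\<Sum>m<n. (-x) ^ m / fact m) + exp t / fact n * (-x) ^ n"
    using Maclaurin_exp_le[of "-x" n] by blast
  moreover have "exp t / fact n * (-x) ^ n \<ge> 0"
    using assms by (intro mult_nonneg_nonneg) auto
  ultimately show ?thesis by linarith
qed

lemma exp_neg_le_Taylor:
  assumes "x \<ge> 0" "odd n"
  shows "exp (-x :: real) \<le> (\<Sum>m<n. (-x) ^ m / fact m)"
proof -
  obtain t where "exp (-x) = (\<Sum>m<n. (-x) ^ m / fact m) + exp t / fact n * (-x) ^ n"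
    using Maclaurin_exp_le[of "-x" n] by blast
  moreover have "exp t / fact n * (-x) ^ n \<le> 0"
    using assms by (intro mult_nonneg_nonpos) auto
  ultimately show ?thesis by linarith
qed

lemma d0_equation_bounds:
  "(1 + exp (- ((1179/1000) * exp (- (1179/1000))))) / 2 < 1 / (1179/1000::real)"
  "(1 + exp (- ((118/100) * exp (- (118/100))))) / 2 > 1 / (118/100::real)"
proof -
  have "exp (- (1179/1000)) \<ge> (3075/10000 :: real)"
    using exp_neg_ge_Taylor[of "(1179/1000)" 8] by (simp add: lessThan_nat_numeral fact_numeral power_divide)
  then have "exp (- ((1179/1000) * exp (- (1179/1000)))) \<le> exp (- ((3625/10000) :: real))"
    by simp
  also have "\<dots> \<le> 6961/10000"
    using exp_neg_le_Taylor[of "(3625/10000)" 5] by (simp add: lessThan_nat_numeral fact_numeral power_divide)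
  finally show "(1 + exp (- ((1179/1000) * exp (- (1179/1000))))) / 2 < 1 / (1179/1000::real)"
    by simp
  have "exp (- (118/100)) \<le> (3074/10000 :: real)"
    using exp_neg_le_Taylor[of "(118/100)" 9] by (simp add: lessThan_nat_numeral fact_numeral power_divide)
  then have "exp (- (3628/10000 :: real)) \<le> exp (- ((118/100) * exp (- (118/100))))"
    by simp
  moreover have "6954/10000 \<le> exp (- (3628/10000 :: real))"
    using exp_neg_ge_Taylor[of "(3628/10000)" 6]
    by (simp add: lessThan_nat_numeral fact_numeral power_divide)
  ultimately have "6954/10000 \<le> exp (- ((118/100) * exp (- (118/100 :: real))))"
    by (rule order_trans[rotated])
  then show "(1 + exp (- ((118/100) * exp (- (118/100))))) / 2 > 1 / (118/100::real)"
    by simp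
qed

lemma d0_lhs_mono:
  assumes "1 \<le> x" "x < (y::real)"
  shows "(1 + exp (- (x * exp (- x)))) / 2 \<le> (1 + exp (- (y * exp (- y)))) / 2"
proof -
  have "y * exp (- y) \<le> x * exp (- x)"
  proof (rule DERIV_nonpos_imp_nonincreasing[of x y "\<lambda>t. t * exp (- t)"])
    fix t assume "x \<le> t" "t \<le> y"
    then show "\<exists>D. ((\<lambda>t. t * exp (- t)) has_real_derivative D) (at t) \<and> D \<le> 0"
      using assms
      by (intro exI[of _ "(1 - t) * exp (- t)"])
         (auto intro!: derivative_eq_intros simp: algebra_simps mult_nonpos_nonneg)
  qed (use assms in auto)
  then show ?thesis by simp
qed

lemma d0_unique:
  assumes "d > 1" "(1 + exp (- (d * exp (- d)))) / 2 = 1 / d"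
    and "d' > 1" "(1 + exp (- (d' * exp (- d')))) / 2 = 1 / (d'::real)"
  shows "d = d'"
proof -
  have False if "1 < x" "x < y" "(1 + exp (- (x * exp (- x)))) / 2 = 1 / x"
    "(1 + exp (- (y * exp (- y)))) / 2 = 1 / y" for x y :: real
  proof -
    have "1 / x \<le> 1 / y"
      using d0_lhs_mono[of x y] that by simp
    then show False using that by (simp add: field_simps)
  qed
  from this[of d d'] this[of d' d] assms show ?thesis
    by (cases d d' rule: linorder_cases) auto
qed

lemma d0_bounds_exist:
  "\<exists>d::real. 1179/1000 \<le> d \<and> d < 118/100 \<and> (1 + exp (- (d * exp (- d)))) / 2 = 1 / d"
proof -
  let ?f = "\<lambda>d::real. (1 + exp (- (d * exp (- d)))) / 2 - 1 / d"
  have "\<exists>d\<ge>1179/1000. d \<le> 118/100 \<and> ?f d = 0"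
    using d0_equation_bounds by (intro IVT') (auto intro!: continuous_intros)
  then obtain d where d: "1179/1000 \<le> d" "d \<le> 118/100" "?f d = 0" by blast
  moreover have "d \<noteq> 118/100"
  proof
    assume "d = 118/100"
    then show False using d(3) d0_equation_bounds(2) by (metis eq_iff_diff_eq_0 less_irrefl)
  qed
  ultimately show ?thesis by (intro exI[of _ d]) auto
qed

lemma d0_ex1: "\<exists>!d::real. d > 1 \<and> (1 + exp (- (d * exp (- d)))) / 2 = 1 / d"
proof -
  obtain d :: real where d: "1179/1000 \<le> d" "(1 + exp (- (d * exp (- d)))) / 2 = 1 / d"
    using d0_bounds_exist by blast
  then have "d > 1" by simp
  show ?thesis
  proof (rule ex1I)
    show "d > 1 \<and> (1 + exp (- (d * exp (- d)))) / 2 = 1 / d"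
      using \<open>d > 1\<close> d(2) by (rule conjI)
  next
    fix d' :: real
    assume "d' > 1 \<and> (1 + exp (- (d' * exp (- d')))) / 2 = 1 / d'"
    then show "d' = d"
      using \<open>d > 1\<close> d(2) by (elim conjE) (rule d0_unique)
  qed
qed

lemma d0_bounds: "1.179 \<le> d0" "d0 < 1.18"
proof -
  obtain d :: real where d: "1179/1000 \<le> d" "d < 118/100"
    "(1 + exp (- (d * exp (- d)))) / 2 = 1 / d"
    using d0_bounds_exist by blast
  then have "d > 1" by simp
  with d(3) have "d0 = d"
    unfolding d0_def by (intro the1_equality d0_ex1 conjI)
  with d show "1.179 \<le> d0" "d0 < 1.18" by simp_all
qed

end

theory Submission
  imports Defs
begin

text \<open>
  Let \<open>R\<^sub>v\<close> be the odds that \<open>v\<close> is occupied in the subtree below \<open>v\<close>; then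
  \<open>R\<^sub>v = \<theta> \<Prod>\<^sub>c 1 / (1 + R\<^sub>c)\<close> over the children \<open>c\<close>, and the law of the configuration on a finite
  ancestor-closed block is an explicit function of the odds at the children of the block.  WSM thus
  reduces to the decay of the influence of the odds at depth \<open>n\<close> on those at the top.  Interpolating
  between two sets of odds at depth \<open>n\<close>, the derivatives \<open>D\<^sub>v\<close> of \<open>ln (1 + R\<^sub>v)\<close> satisfy
  \<open>D\<^sub>v \<le> p\<^sub>v \<Sum>\<^sub>c D\<^sub>c\<close> with \<open>p\<^sub>v = R\<^sub>v / (1 + R\<^sub>v)\<close>.

  (1) If \<open>v\<close> has a leaf child then \<open>p\<^sub>v \<le> 1/2\<close>.  The expected sum over the paths of length \<open>n\<close> of these
  bounds is at most \<open>(d (1 + exp (- d e\<^sup>-\<^sup>d)) / 2)\<^sup>n\<close>, which is summable for \<open>d < d\<^sub>0\<close>.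
  (2) For a child \<open>c\<close> of \<open>v\<close>, \<open>p\<^sub>v p\<^sub>c\<close> is at most some \<open>K < 1 / d\<^sup>2\<close>, whereas the number of vertices at depth
  \<open>n\<close> is almost surely \<open>o (a\<^sup>n)\<close> for every \<open>a > d\<close>.
  (3) By the Cauchy-Schwarz inequality
  \<open>D\<^sub>v\<^sup>2 / p\<^sub>v \<le> (p\<^sub>v \<Sum>\<^sub>c p\<^sub>c) \<Sum>\<^sub>c D\<^sub>c\<^sup>2 / p\<^sub>c \<le> (\<theta> / e) \<Sum>\<^sub>c D\<^sub>c\<^sup>2 / p\<^sub>c\<close>, so \<open>\<eta>\<^sub>1 = 0\<close> works.
  (4) Let \<open>F\<^sub>n\<close> be the odds at the root when those at depth \<open>n\<close> are all \<open>\<theta>\<close>.  By the Poisson generating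
  functional \<open>E F\<^sub>n\<^sub>+\<^sub>1 = \<theta> exp (- d E (F\<^sub>n / (1 + F\<^sub>n)))\<close>, so \<open>d E F\<^sub>n\<close> nearly follows the map \<open>x \<mapsto> d \<theta> e\<^sup>-\<^sup>x\<close>,
  which has an attracting two-cycle when \<open>d \<theta> > e\<close>.  Hence with positive probability the even and odd
  limits of \<open>F\<^sub>n\<close> differ.  The probability that they agree solves \<open>r = exp (d (r - 1))\<close>, as does the
  probability that they agree and the tree is finite; this equation has only one solution below \<open>1\<close>.
\<close>

section \<open>Contraction of the ratio recursion\<close>

text \<open>The values \<open>a\<close> are inserted at depth \<open>n\<close> and stand for any
  influence from below. The child function is left abstract, so that the bounds apply to a tree and
  to each of its subgraphs alike.\<close>

fun ratio_iter :: "real \<Rightarrow> ('v \<Rightarrow> 'v set) \<Rightarrow> ('v \<Rightarrow> real) \<Rightarrow> nat \<Rightarrow> 'v \<Rightarrow> real" where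
  "ratio_iter \<theta> ch a 0 v = a v"
| "ratio_iter \<theta> ch a (Suc n) v = \<theta> * (\<Prod>c\<in>ch v. 1 / (1 + ratio_iter \<theta> ch a n c))"

definition occ_iter :: "real \<Rightarrow> ('v \<Rightarrow> 'v set) \<Rightarrow> ('v \<Rightarrow> real) \<Rightarrow> nat \<Rightarrow> 'v \<Rightarrow> real" where
  "occ_iter \<theta> ch a n v = ratio_iter \<theta> ch a n v / (1 + ratio_iter \<theta> ch a n v)"

text \<open>Sum over the downward paths of \<open>n\<close> steps from \<open>v\<close> of the
  product of the weights of all vertices but the last. Unit weights count the vertices
  \<open>n\<close> generations below.\<close>

fun path_sum :: "('v \<Rightarrow> 'v set) \<Rightarrow> ('v \<Rightarrow> real) \<Rightarrow> nat \<Rightarrow> 'v \<Rightarrow> real" where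
  "path_sum ch w 0 v = 1"
| "path_sum ch w (Suc n) v = w v * (\<Sum>c\<in>ch v. path_sum ch w n c)"

section \<open>Elementary bounds for the recursion\<close>

lemma path_sum_nonneg:
  assumes "\<And>v. 0 \<le> w v"
  shows "0 \<le> path_sum ch w n v"
  by (induction n arbitrary: v) (auto intro!: mult_nonneg_nonneg sum_nonneg assms)

lemma prod_inverse_one_plus_le:
  fixes f :: "'v \<Rightarrow> real"
  assumes "\<And>c. c \<in> A \<Longrightarrow> 0 \<le> f c"
  shows "(\<Prod>c\<in>A. 1 / (1 + f c)) \<le> 1"
proof (intro prod_le_1 conjI)
  fix c assume "c \<in> A"
  with assms have "0 \<le> f c" by blast
  then show "0 \<le> 1 / (1 + f c)" "1 / (1 + f c) \<le> 1"
    by (simp_all add: divide_le_eq_1)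
qed

lemma prod_inverse_one_plus_le_single:
  fixes f :: "'v \<Rightarrow> real"
  assumes "finite A" "\<And>c. c \<in> A \<Longrightarrow> 0 \<le> f c" "b \<in> A"
  shows "(\<Prod>c\<in>A. 1 / (1 + f c)) \<le> 1 / (1 + f b)"
proof -
  have "(\<Prod>c\<in>A. 1 / (1 + f c)) = 1 / (1 + f b) * (\<Prod>c\<in>A - {b}. 1 / (1 + f c))"
    using assms by (intro prod.remove)
  also have "\<dots> \<le> 1 / (1 + f b) * 1"
    using assms by (intro mult_left_mono prod_inverse_one_plus_le) auto
  finally show ?thesis by simp
qed

lemma ratio_iter_bounds:
  assumes "\<And>v. 0 \<le> a v" "0 \<le> \<theta>"
  shows "0 \<le> ratio_iter \<theta> ch a n v" "ratio_iter \<theta> ch a (Suc n) v \<le> \<theta>"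
proof -
  show nonneg: "0 \<le> ratio_iter \<theta> ch a n v" for n v
    by (induction n arbitrary: v) (auto intro!: assms mult_nonneg_nonneg prod_nonneg)
  show "ratio_iter \<theta> ch a (Suc n) v \<le> \<theta>"
    using prod_inverse_one_plus_le[of "ch v" "ratio_iter \<theta> ch a n"] nonneg assms(2)
    by (simp add: mult_left_le)
qed

lemma ratio_iter_le:
  assumes "\<And>v. 0 \<le> a v" "\<And>v. a v \<le> \<theta>" "0 \<le> \<theta>"
  shows "ratio_iter \<theta> ch a n v \<le> \<theta>"
proof (cases n)
  case (Suc m)
  with ratio_iter_bounds(2)[of a \<theta> ch m v] assms show ?thesis by blast
qed (use assms in simp)

lemma occ_iter_bounds:
  assumes "\<And>v. 0 \<le> a v" "\<And>v. a v \<le> \<theta>" "0 \<le> \<theta>"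
  shows "0 \<le> occ_iter \<theta> ch a n v" "occ_iter \<theta> ch a n v \<le> 1" "occ_iter \<theta> ch a n v \<le> \<theta>"
proof -
  have *: "0 \<le> ratio_iter \<theta> ch a n v" "ratio_iter \<theta> ch a n v \<le> \<theta>"
    by (intro ratio_iter_bounds ratio_iter_le assms)+
  then show "0 \<le> occ_iter \<theta> ch a n v" "occ_iter \<theta> ch a n v \<le> 1"
    by (auto simp: occ_iter_def divide_simps)
  have "ratio_iter \<theta> ch a n v / (1 + ratio_iter \<theta> ch a n v) \<le> ratio_iter \<theta> ch a n v / 1"
    using * by (intro divide_left_mono) auto
  with * show "occ_iter \<theta> ch a n v \<le> \<theta>"
    by (simp add: occ_iter_def)
qed

text \<open>The square-root parametrisation makes \<open>D\<^sup>2 / p\<close> bounded on the cut, even where a ratio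
  vanishes.\<close>

lemma ratio_iter_interpolation:
  fixes a b :: "'v \<Rightarrow> real"
  assumes ab: "\<And>v. 0 \<le> a v" "\<And>v. a v \<le> \<theta>" "\<And>v. 0 \<le> b v" "\<And>v. b v \<le> \<theta>" and \<theta>: "0 < \<theta>"
    and fin: "\<And>v. finite (ch v)"
  obtains c D where "\<And>u. 0 \<le> c u" "\<And>u. c u \<le> \<theta>" "\<And>m u. 0 \<le> D m u"
    "\<And>u. (D 0 u)\<^sup>2 \<le> occ_iter \<theta> ch c 0 u * (4 * \<theta>)"
    "\<And>m u. D (Suc m) u \<le> occ_iter \<theta> ch c (Suc m) u * (\<Sum>w\<in>ch u. D m w)"
    "\<bar>ln (1 + ratio_iter \<theta> ch b n v) - ln (1 + ratio_iter \<theta> ch a n v)\<bar> \<le> D n v"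
proof -
  \<comment> \<open>\<open>cut t\<close> moves from \<open>a\<close> at \<open>t = 0\<close> to
    \<open>b\<close> at \<open>t = 1\<close>, linearly in the square roots, so that its derivative
    at \<open>u\<close> vanishes wherever \<open>cut t u\<close> does.\<close>
  define r where "r t u = (1 - t) * sqrt (a u) + t * sqrt (b u)" for t u
  define cut where "cut t u = (r t u)\<^sup>2" for t u
  define Y where "Y m u t = ln (1 + ratio_iter \<theta> ch (cut t) m u)" for m u t
  \<comment> \<open>The derivatives of \<open>Y\<close> in \<open>t\<close>, written down by
    recursion on the depth. The minus sign reflects that larger odds at the children lower the odds
    at the parent.\<close>
  define dY where "dY = rec_nat (\<lambda>u t. 2 * r t u * (sqrt (b u) - sqrt (a u)) / (1 + cut t u))
     (\<lambda>m d u t. - occ_iter \<theta> ch (cut t) (Suc m) u * (\<Sum>w\<in>ch u. d w t))"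
  have dY0: "dY 0 u t = 2 * r t u * (sqrt (b u) - sqrt (a u)) / (1 + cut t u)" for u t
    by (simp add: dY_def)
  have dYS: "dY (Suc m) u t = - occ_iter \<theta> ch (cut t) (Suc m) u * (\<Sum>w\<in>ch u. dY m w t)" for m u t
    by (simp add: dY_def)
  have nonneg: "0 \<le> ratio_iter \<theta> ch (cut t) m u" for t m u
    using \<theta> by (intro ratio_iter_bounds) (auto simp: cut_def)
  have ratio_Suc: "ratio_iter \<theta> ch (cut t) (Suc m) u = \<theta> * exp (- (\<Sum>w\<in>ch u. Y m w t))" for t m u
    using nonneg fin
    by (simp add: Y_def exp_sum exp_minus sum_negf[symmetric] inverse_eq_divide add_nonneg_pos
        less_le_trans[OF zero_less_one])
  have deriv: "(Y m u has_real_derivative dY m u t) (at t)" for m u t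
  proof (induction m arbitrary: u)
    case 0
    have "1 + cut t u > 0"
      by (simp add: cut_def add_pos_nonneg)
    moreover have "((\<lambda>t. r t u) has_real_derivative (sqrt (b u) - sqrt (a u))) (at t)"
      unfolding r_def by (auto intro!: derivative_eq_intros simp: algebra_simps)
    ultimately have "((\<lambda>t. ln (1 + (r t u)\<^sup>2)) has_real_derivative dY 0 u t) (at t)"
      unfolding dY0 cut_def by (auto intro!: derivative_eq_intros)
    then show ?case
      by (simp add: Y_def[abs_def] cut_def)
  next
    case (Suc m)
    have eq: "Y (Suc m) u = (\<lambda>t. ln (1 + \<theta> * exp (- (\<Sum>w\<in>ch u. Y m w t))))"
      by (intro ext) (simp only: Y_def[of "Suc m"] ratio_Suc)
    have "((\<lambda>t. \<Sum>w\<in>ch u. Y m w t) has_real_derivative (\<Sum>w\<in>ch u. dY m w t)) (at t)"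
      by (intro DERIV_sum Suc)
    moreover have "((\<lambda>t. ln (1 + \<theta> * exp (- s t))) has_real_derivative
        - (\<theta> * exp (- s t) / (1 + \<theta> * exp (- s t))) * s') (at t)"
      if "(s has_real_derivative s') (at t)" for s s'
    proof -
      have "1 + \<theta> * exp (- s t) > 0"
        using \<theta> by (simp add: add_pos_pos)
      with that show ?thesis
        by (auto intro!: derivative_eq_intros)
    qed
    ultimately show ?case
      unfolding eq dYS occ_iter_def ratio_Suc by blast
  qed
  \<comment> \<open>The mean value theorem is applied only at depth \<open>n\<close> and vertex
    \<open>v\<close>. The point \<open>t\<close> found there fixes one boundary
    \<open>cut t\<close>, and the recursive bounds then hold along it at every depth and
    vertex.\<close>
  have "\<exists>t>0. t < 1 \<and> Y n v 1 - Y n v 0 = (1 - 0) * dY n v t"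
    by (rule MVT2) (auto intro: deriv)
  then obtain t where t: "0 < t" "t < 1" "Y n v 1 - Y n v 0 = dY n v t"
    by auto
  have "cut 1 = b" "cut 0 = a"
    using ab by (auto simp: cut_def r_def)
  then have le: "\<bar>ln (1 + ratio_iter \<theta> ch b n v) - ln (1 + ratio_iter \<theta> ch a n v)\<bar> \<le> \<bar>dY n v t\<bar>"
    using t by (simp add: Y_def)
  have r: "0 \<le> r t u" "r t u \<le> sqrt \<theta>" for u
  proof -
    show "0 \<le> r t u"
      using t ab by (simp add: r_def)
    have "r t u \<le> (1 - t) * sqrt \<theta> + t * sqrt \<theta>"
      using t ab unfolding r_def by (intro add_mono mult_left_mono real_sqrt_le_mono) auto
    then show "r t u \<le> sqrt \<theta>"
      by (simp add: algebra_simps)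
  qed
  have cut_le: "cut t u \<le> \<theta>" for u
    using power_mono[OF r(2) r(1), of u 2] \<theta> by (simp add: cut_def)
  have cut_ge: "0 \<le> cut t u" for u
    by (simp add: cut_def)
  \<comment> \<open>The factor \<open>(r t u)\<^sup>2\<close> of the squared derivative cancels the
    numerator of \<open>occ_iter\<close>, so their quotient stays bounded also for small
    odds.\<close>
  have base: "\<bar>dY 0 u t\<bar>\<^sup>2 \<le> occ_iter \<theta> ch (cut t) 0 u * (4 * \<theta>)" for u
  proof -
    have "sqrt (a u) \<le> sqrt \<theta>" "sqrt (b u) \<le> sqrt \<theta>" "0 \<le> sqrt (a u)" "0 \<le> sqrt (b u)"
      using ab by auto
    then have "\<bar>sqrt (b u) - sqrt (a u)\<bar> \<le> sqrt \<theta>"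
      by linarith
    then have "(sqrt (b u) - sqrt (a u))\<^sup>2 \<le> \<theta>"
      using power_mono[of "\<bar>sqrt (b u) - sqrt (a u)\<bar>" "sqrt \<theta>" 2] \<theta> by simp
    moreover have "1 \<le> 1 + cut t u"
      by (simp add: cut_ge)
    ultimately have "(sqrt (b u) - sqrt (a u))\<^sup>2 \<le> \<theta> * (1 + cut t u)"
      using mult_left_mono[of 1 "1 + cut t u" \<theta>] \<theta> by linarith
    then have "4 * cut t u * (sqrt (b u) - sqrt (a u))\<^sup>2 \<le> 4 * cut t u * (\<theta> * (1 + cut t u))"
      by (intro mult_left_mono) (auto simp: cut_ge)
    then have "4 * cut t u * (sqrt (b u) - sqrt (a u))\<^sup>2 / (1 + cut t u)\<^sup>2 \<le>
      4 * cut t u * (\<theta> * (1 + cut t u)) / (1 + cut t u)\<^sup>2"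
      by (intro divide_right_mono) auto
    also have "\<dots> = occ_iter \<theta> ch (cut t) 0 u * (4 * \<theta>)"
      using cut_ge[of u] by (simp add: occ_iter_def power2_eq_square)
    finally show ?thesis
      by (simp add: dY0 power_divide power_mult_distrib cut_def)
  qed
  have step: "\<bar>dY (Suc m) u t\<bar> \<le> occ_iter \<theta> ch (cut t) (Suc m) u * (\<Sum>w\<in>ch u. \<bar>dY m w t\<bar>)" for m u
  proof -
    have "0 \<le> occ_iter \<theta> ch (cut t) (Suc m) u"
      using cut_ge cut_le \<theta> by (intro occ_iter_bounds) auto
    then show ?thesis
      by (auto simp: dYS abs_mult intro!: mult_left_mono)
  qed
  show thesis
    by (rule that[of "cut t" "\<lambda>m u. \<bar>dY m u t\<bar>"]) (use cut_ge cut_le base step le in auto)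
qed

text \<open>A vertex with a childless child has occupation probability at most one half.\<close>

lemma ratio_iter_decay_leaf:
  fixes a b :: "'v \<Rightarrow> real"
  assumes ab: "\<And>v. 0 \<le> a v" "\<And>v. a v \<le> \<theta>" "\<And>v. 0 \<le> b v" "\<And>v. b v \<le> \<theta>" and \<theta>: "0 < \<theta>"
    and fin: "\<And>v. finite (ch v)"
    and w: "\<And>v. 1 / 2 \<le> w v" "\<And>v. 1 \<le> w v \<or> (\<exists>c\<in>ch v. ch c = {})"
  shows "\<bar>ln (1 + ratio_iter \<theta> ch b (Suc n) v) - ln (1 + ratio_iter \<theta> ch a (Suc n) v)\<bar> \<le>
    4 * \<theta> * path_sum ch w (Suc n) v"
proof -
  obtain c D where c: "\<And>u. 0 \<le> c u" "\<And>u. c u \<le> \<theta>" and D: "\<And>m u. 0 \<le> D m u"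
    "\<And>u. (D 0 u)\<^sup>2 \<le> occ_iter \<theta> ch c 0 u * (4 * \<theta>)"
    "\<And>m u. D (Suc m) u \<le> occ_iter \<theta> ch c (Suc m) u * (\<Sum>w\<in>ch u. D m w)"
    "\<bar>ln (1 + ratio_iter \<theta> ch b (Suc n) v) - ln (1 + ratio_iter \<theta> ch a (Suc n) v)\<bar> \<le> D (Suc n) v"
    by (rule ratio_iter_interpolation[of a \<theta> b ch "Suc n" v]) (use ab \<theta> fin in auto)
  have w0: "0 \<le> w v" for v
    using w(1)[of v] by simp
  have D0: "D 0 u \<le> 2 * \<theta>" for u
  proof -
    have "(D 0 u)\<^sup>2 \<le> occ_iter \<theta> ch c 0 u * (4 * \<theta>)"
      by (rule D)
    also have "\<dots> \<le> \<theta> * (4 * \<theta>)"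
      using \<theta> by (intro mult_right_mono occ_iter_bounds(3) c) auto
    also have "\<dots> = (2 * \<theta>)\<^sup>2"
      by algebra
    finally have "(D 0 u)\<^sup>2 \<le> (2 * \<theta>)\<^sup>2" .
    then show ?thesis
      by (rule power2_le_imp_le) (use \<theta> in auto)
  qed
  \<comment> \<open>A childless child has odds exactly \<theta> once it lies above the cut, hence
    the two generations in \<open>Suc (Suc m)\<close>. The odds at its parent are then at most
    \<theta> / (1 + \<theta>), which is below 1.\<close>
  have occ: "occ_iter \<theta> ch c (Suc (Suc m)) u \<le> w u" for m u
  proof (cases "1 \<le> w u")
    case True
    have "occ_iter \<theta> ch c (Suc (Suc m)) u \<le> 1"
      using \<theta> by (intro occ_iter_bounds c) auto
    with True show ?thesis by simp
  next
    case False
    with w obtain x where x: "x \<in> ch u" "ch x = {}" by blast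
    have "ratio_iter \<theta> ch c (Suc (Suc m)) u \<le> \<theta> * (1 / (1 + ratio_iter \<theta> ch c (Suc m) x))"
      unfolding ratio_iter.simps(2)[of _ _ _ "Suc m" u]
      using c \<theta> fin x by (intro mult_left_mono prod_inverse_one_plus_le_single ratio_iter_bounds) auto
    also have "\<dots> \<le> 1"
      using x \<theta> by simp
    finally have "occ_iter \<theta> ch c (Suc (Suc m)) u \<le> 1 / 2"
      using ratio_iter_bounds(1)[of c \<theta> ch "Suc (Suc m)" u, OF c(1)] \<theta>
      by (simp add: occ_iter_def field_simps del: ratio_iter.simps)
    with w(1)[of u] show ?thesis by simp
  qed
  have "D (Suc m) u \<le> 4 * \<theta> * path_sum ch w (Suc m) u" for m u
  proof (induction m arbitrary: u)
    case 0
    have "D (Suc 0) u \<le> occ_iter \<theta> ch c (Suc 0) u * (\<Sum>x\<in>ch u. D 0 x)"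
      by (rule D)
    also have "\<dots> \<le> 1 * (\<Sum>x\<in>ch u. 2 * \<theta>)"
      using c \<theta> by (intro mult_mono occ_iter_bounds sum_mono D0 sum_nonneg D) auto
    also have "\<dots> = 4 * \<theta> * (1 / 2 * real (card (ch u)))"
      by simp
    also have "\<dots> \<le> 4 * \<theta> * (w u * real (card (ch u)))"
      using \<theta> w by (intro mult_left_mono mult_right_mono) auto
    finally show ?case by simp
  next
    case (Suc m)
    have "D (Suc (Suc m)) u \<le> occ_iter \<theta> ch c (Suc (Suc m)) u * (\<Sum>x\<in>ch u. D (Suc m) x)"
      by (rule D)
    also have "\<dots> \<le> w u * (\<Sum>x\<in>ch u. 4 * \<theta> * path_sum ch w (Suc m) x)"
      using c \<theta> by (intro mult_mono occ sum_mono Suc sum_nonneg D w0)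
    also have "\<dots> = 4 * \<theta> * path_sum ch w (Suc (Suc m)) u"
      by (simp add: sum_distrib_left mult_ac del: path_sum.simps(2)) (simp add: sum_distrib_left mult_ac)
    finally show ?case .
  qed
  with D(4) show ?thesis
    by (rule order_trans)
qed

text \<open>Generations are grouped in pairs. If a child has odds \<open>y\<close>, its parent has
  odds at most \<theta> / (1 + y), so the product of the two occupation probabilities is a function
  of \<open>y\<close> alone, bounded by \<open>K\<close>. What remains is \<open>K ^ n\<close> times
  the number of vertices at depth \<open>2 * n\<close>.\<close>

lemma ratio_iter_decay_two_step:
  fixes a b :: "'v \<Rightarrow> real"
  assumes ab: "\<And>v. 0 \<le> a v" "\<And>v. a v \<le> \<theta>" "\<And>v. 0 \<le> b v" "\<And>v. b v \<le> \<theta>" and \<theta>: "0 < \<theta>"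
    and fin: "\<And>v. finite (ch v)"
    and K: "\<And>x. 0 \<le> x \<Longrightarrow> x \<le> \<theta> \<Longrightarrow> \<theta> / (1 + x + \<theta>) * (x / (1 + x)) \<le> K"
  shows "\<bar>ln (1 + ratio_iter \<theta> ch b (2 * n) v) - ln (1 + ratio_iter \<theta> ch a (2 * n) v)\<bar> \<le>
    2 * \<theta> * (K ^ n * path_sum ch (\<lambda>_. 1) (2 * n) v)"
proof -
  obtain c D where c: "\<And>u. 0 \<le> c u" "\<And>u. c u \<le> \<theta>" and D: "\<And>m u. 0 \<le> D m u"
    "\<And>u. (D 0 u)\<^sup>2 \<le> occ_iter \<theta> ch c 0 u * (4 * \<theta>)"
    "\<And>m u. D (Suc m) u \<le> occ_iter \<theta> ch c (Suc m) u * (\<Sum>w\<in>ch u. D m w)"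
    "\<bar>ln (1 + ratio_iter \<theta> ch b (2 * n) v) - ln (1 + ratio_iter \<theta> ch a (2 * n) v)\<bar> \<le> D (2 * n) v"
    by (rule ratio_iter_interpolation[of a \<theta> b ch "2 * n" v]) (use ab \<theta> fin in auto)
  have K0: "0 \<le> K"
    using K[of 0] \<theta> by simp
  have D0: "D 0 u \<le> 2 * \<theta>" for u
  proof -
    have "(D 0 u)\<^sup>2 \<le> occ_iter \<theta> ch c 0 u * (4 * \<theta>)"
      by (rule D)
    also have "\<dots> \<le> \<theta> * (4 * \<theta>)"
      using \<theta> by (intro mult_right_mono occ_iter_bounds(3) c) auto
    also have "\<dots> = (2 * \<theta>)\<^sup>2"
      by algebra
    finally have "(D 0 u)\<^sup>2 \<le> (2 * \<theta>)\<^sup>2" .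
    then show ?thesis
      by (rule power2_le_imp_le) (use \<theta> in auto)
  qed
  have occ: "occ_iter \<theta> ch c (Suc m) u * occ_iter \<theta> ch c m x \<le> K" if "x \<in> ch u" for m u x
  proof -
    define y where "y = ratio_iter \<theta> ch c m x"
    define z where "z = ratio_iter \<theta> ch c (Suc m) u"
    have y: "0 \<le> y" "y \<le> \<theta>" and z: "0 \<le> z"
      using c \<theta> by (auto simp: y_def z_def intro!: ratio_iter_bounds ratio_iter_le simp del: ratio_iter.simps)
    have "z \<le> \<theta> * (1 / (1 + y))"
      unfolding z_def y_def ratio_iter.simps(2)[of _ _ _ m u]
      using c \<theta> fin that by (intro mult_left_mono prod_inverse_one_plus_le_single ratio_iter_bounds) auto
    then have "z * (1 + y) \<le> \<theta>"
      using y by (simp add: field_simps)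
    then have "z / (1 + z) \<le> \<theta> / (1 + y + \<theta>)"
      using y z \<theta> by (simp add: field_simps)
    then have "z / (1 + z) * (y / (1 + y)) \<le> \<theta> / (1 + y + \<theta>) * (y / (1 + y))"
      using y by (intro mult_right_mono) auto
    also have "\<dots> \<le> K"
      using y by (intro K)
    finally show ?thesis
      by (simp add: occ_iter_def y_def z_def)
  qed
  have "D (2 * m) u \<le> 2 * \<theta> * (K ^ m * path_sum ch (\<lambda>_. 1) (2 * m) u)" for m u
  proof (induction m arbitrary: u)
    case 0
    show ?case using D0 by simp
  next
    case (Suc m)
    have "D (Suc (Suc (2 * m))) u \<le> occ_iter \<theta> ch c (Suc (Suc (2 * m))) u * (\<Sum>x\<in>ch u. D (Suc (2 * m)) x)"
      by (rule D)
    also have "\<dots> \<le> occ_iter \<theta> ch c (Suc (Suc (2 * m))) u *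
        (\<Sum>x\<in>ch u. occ_iter \<theta> ch c (Suc (2 * m)) x * (\<Sum>y\<in>ch x. D (2 * m) y))"
      using c \<theta> by (intro mult_left_mono sum_mono D occ_iter_bounds) auto
    also have "\<dots> = (\<Sum>x\<in>ch u. (occ_iter \<theta> ch c (Suc (Suc (2 * m))) u * occ_iter \<theta> ch c (Suc (2 * m)) x) *
        (\<Sum>y\<in>ch x. D (2 * m) y))"
      by (simp add: sum_distrib_left mult_ac)
    also have "\<dots> \<le> (\<Sum>x\<in>ch u. K * (\<Sum>y\<in>ch x. 2 * \<theta> * (K ^ m * path_sum ch (\<lambda>_. 1) (2 * m) y)))"
      by (intro sum_mono mult_mono occ Suc sum_nonneg D K0)
    also have "\<dots> = 2 * \<theta> * (K ^ Suc m * path_sum ch (\<lambda>_. 1) (2 * Suc m) u)"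
      by (simp add: sum_distrib_left mult_ac)
    finally show ?case by simp
  qed
  with D(4) show ?thesis
    by (rule order_trans)
qed

text \<open>With \<open>s\<close> the sum of \<open>ln (1 + f c)\<close>, the product equals
  \<open>exp (- s)\<close>. The sum of the occupation probabilities is at most \<open>s\<close>,
  because x / (1 + x) is at most ln (1 + x).\<close>

lemma sum_occ_le:
  fixes f :: "'v \<Rightarrow> real"
  assumes f: "\<And>c. c \<in> A \<Longrightarrow> 0 \<le> f c" and "finite A" "0 < \<theta>"
  shows "\<theta> * (\<Prod>c\<in>A. 1 / (1 + f c)) * (\<Sum>c\<in>A. f c / (1 + f c)) \<le> \<theta> / exp 1"
proof -
  define s where "s = (\<Sum>c\<in>A. ln (1 + f c))"
  have "f c / (1 + f c) \<le> ln (1 + f c)" if "c \<in> A" for c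
  proof -
    have "ln (1 / (1 + f c)) \<le> 1 / (1 + f c) - 1"
      using f[OF that] by (intro ln_le_minus_one) auto
    then show ?thesis
      using f[OF that] by (simp add: ln_div field_simps)
  qed
  then have "(\<Sum>c\<in>A. f c / (1 + f c)) \<le> s"
    unfolding s_def by (rule sum_mono)
  moreover have "(\<Prod>c\<in>A. 1 / (1 + f c)) = exp (- s)"
    using assms by (simp add: s_def exp_sum exp_minus sum_negf[symmetric] inverse_eq_divide add_pos_nonneg)
  ultimately have "\<theta> * (\<Prod>c\<in>A. 1 / (1 + f c)) * (\<Sum>c\<in>A. f c / (1 + f c)) \<le> \<theta> * exp (- s) * s"
    using \<open>0 < \<theta>\<close> by (intro mult_mono) (auto intro!: sum_nonneg divide_nonneg_nonneg add_nonneg_nonneg f)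
  also have "exp (- s) * s \<le> 1 / exp 1"
  proof -
    have "s \<le> exp (s - 1)"
      using exp_ge_add_one_self[of "s - 1"] by simp
    then have "exp (- s) * s \<le> exp (- s) * exp (s - 1)"
      by (intro mult_left_mono) auto
    also have "\<dots> = 1 / exp 1"
      by (simp add: exp_add[symmetric] exp_minus inverse_eq_divide[symmetric] flip: exp_minus)
    finally show ?thesis .
  qed
  then have "\<theta> * exp (- s) * s \<le> \<theta> / exp 1"
    using mult_left_mono[of "exp (- s) * s" "1 / exp 1" \<theta>] \<open>0 < \<theta>\<close> by (simp add: mult.assoc)
  finally show ?thesis .
qed

text \<open>The factor \<open>\<theta> / e\<close> is the maximum of \<open>\<theta> s e\<^sup>-\<^sup>s\<close>.\<close>

lemma ratio_iter_decay_cauchy_schwarz: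
  fixes a b :: "'v \<Rightarrow> real"
  assumes ab: "\<And>v. 0 \<le> a v" "\<And>v. a v \<le> \<theta>" "\<And>v. 0 \<le> b v" "\<And>v. b v \<le> \<theta>" and \<theta>: "0 < \<theta>"
    and fin: "\<And>v. finite (ch v)"
  shows "(ln (1 + ratio_iter \<theta> ch b n v) - ln (1 + ratio_iter \<theta> ch a n v))\<^sup>2 \<le>
    4 * \<theta> * ((\<theta> / exp 1) ^ n * path_sum ch (\<lambda>_. 1) n v)"
proof -
  obtain c D where c: "\<And>u. 0 \<le> c u" "\<And>u. c u \<le> \<theta>" and D: "\<And>m u. 0 \<le> D m u"
    "\<And>u. (D 0 u)\<^sup>2 \<le> occ_iter \<theta> ch c 0 u * (4 * \<theta>)"
    "\<And>m u. D (Suc m) u \<le> occ_iter \<theta> ch c (Suc m) u * (\<Sum>w\<in>ch u. D m w)"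
    "\<bar>ln (1 + ratio_iter \<theta> ch b n v) - ln (1 + ratio_iter \<theta> ch a n v)\<bar> \<le> D n v"
    by (rule ratio_iter_interpolation[of a \<theta> b ch n v]) (use ab \<theta> fin in auto)
  \<comment> \<open>The majorant of the squared derivative divided by the occupation probability.
    The claim below is stated in product form because that probability may vanish on the
    cut.\<close>
  define B where "B m u = 4 * \<theta> * ((\<theta> / exp 1) ^ m * path_sum ch (\<lambda>_. 1) m u)" for m u
  have B0: "0 \<le> B m u" for m u
    using \<theta> by (auto simp: B_def intro!: mult_nonneg_nonneg path_sum_nonneg)
  have p0: "0 \<le> occ_iter \<theta> ch c m u" for m u
    using c \<theta> by (intro occ_iter_bounds) auto
  have "(D m u)\<^sup>2 \<le> occ_iter \<theta> ch c m u * B m u" for m u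
  proof (induction m arbitrary: u)
    case 0
    show ?case using D(2) by (simp add: B_def)
  next
    case (Suc m)
    let ?p = "occ_iter \<theta> ch c"
    have "D m x \<le> sqrt (?p m x) * sqrt (B m x)" for x
      using Suc[of x] D(1)[of m x] real_le_rsqrt by (metis real_sqrt_mult)
    then have "(\<Sum>x\<in>ch u. D m x) \<le> (\<Sum>x\<in>ch u. sqrt (?p m x) * sqrt (B m x))"
      by (rule sum_mono)
    then have "(\<Sum>x\<in>ch u. D m x)\<^sup>2 \<le> (\<Sum>x\<in>ch u. sqrt (?p m x) * sqrt (B m x))\<^sup>2"
      by (intro power_mono sum_nonneg D)
    also have "\<dots> \<le> (\<Sum>x\<in>ch u. (sqrt (?p m x))\<^sup>2) * (\<Sum>x\<in>ch u. (sqrt (B m x))\<^sup>2)"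
      by (rule Cauchy_Schwarz_ineq_sum)
    also have "\<dots> = (\<Sum>x\<in>ch u. ?p m x) * (\<Sum>x\<in>ch u. B m x)"
      using p0 B0 by simp
    finally have cs: "(\<Sum>x\<in>ch u. D m x)\<^sup>2 \<le> (\<Sum>x\<in>ch u. ?p m x) * (\<Sum>x\<in>ch u. B m x)" .
    \<comment> \<open>Squaring produces the factor \<open>?p (Suc m) u\<close> twice. One copy is
      spent here against the sum over the children, the other stays in the bound and closes the
      induction.\<close>
    have "?p (Suc m) u * (\<Sum>x\<in>ch u. ?p m x) \<le> ratio_iter \<theta> ch c (Suc m) u * (\<Sum>x\<in>ch u. ?p m x)"
    proof (intro mult_right_mono sum_nonneg p0)
      have "0 \<le> ratio_iter \<theta> ch c (Suc m) u"
        using c \<theta> by (intro ratio_iter_bounds) auto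
      then have "ratio_iter \<theta> ch c (Suc m) u / (1 + ratio_iter \<theta> ch c (Suc m) u) \<le> ratio_iter \<theta> ch c (Suc m) u / 1"
        by (intro divide_left_mono) auto
      then show "?p (Suc m) u \<le> ratio_iter \<theta> ch c (Suc m) u"
        by (simp add: occ_iter_def)
    qed
    also have "\<dots> \<le> \<theta> / exp 1"
      unfolding ratio_iter.simps(2) occ_iter_def
      using c \<theta> fin by (intro sum_occ_le ratio_iter_bounds) auto
    finally have contr: "?p (Suc m) u * (\<Sum>x\<in>ch u. ?p m x) \<le> \<theta> / exp 1" .
    have "(D (Suc m) u)\<^sup>2 \<le> (?p (Suc m) u * (\<Sum>x\<in>ch u. D m x))\<^sup>2"
      by (intro power_mono D)
    also have "\<dots> = (?p (Suc m) u)\<^sup>2 * (\<Sum>x\<in>ch u. D m x)\<^sup>2"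
      by (rule power_mult_distrib)
    also have "\<dots> \<le> (?p (Suc m) u)\<^sup>2 * ((\<Sum>x\<in>ch u. ?p m x) * (\<Sum>x\<in>ch u. B m x))"
      by (intro mult_left_mono cs) auto
    also have "\<dots> = ?p (Suc m) u * ((?p (Suc m) u * (\<Sum>x\<in>ch u. ?p m x)) * (\<Sum>x\<in>ch u. B m x))"
      by (simp add: power2_eq_square mult_ac)
    also have "\<dots> \<le> ?p (Suc m) u * (\<theta> / exp 1 * (\<Sum>x\<in>ch u. B m x))"
      by (intro mult_left_mono mult_right_mono contr sum_nonneg B0 p0)
    also have "\<theta> / exp 1 * (\<Sum>x\<in>ch u. B m x) = B (Suc m) u"
      by (simp add: B_def sum_distrib_left sum_divide_distrib mult_ac)
    finally show ?case .
  qed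
  then have "(D n v)\<^sup>2 \<le> occ_iter \<theta> ch c n v * B n v" .
  also have "\<dots> \<le> 1 * B n v"
    using c \<theta> by (intro mult_right_mono B0 occ_iter_bounds) auto
  finally have "(D n v)\<^sup>2 \<le> B n v" by simp
  moreover have "\<bar>ln (1 + ratio_iter \<theta> ch b n v) - ln (1 + ratio_iter \<theta> ch a n v)\<bar>\<^sup>2 \<le> (D n v)\<^sup>2"
    using D(4) by (intro power_mono) auto
  ultimately show ?thesis
    by (simp add: B_def)
qed

section \<open>Marginals of the hard-core model on forests\<close>

text \<open>Edges are oriented by the labels and not by the distance to a root, so the orientation
  is inherited by subgraphs, whose components need not contain the empty word.\<close>

definition child_set :: "nat list graph \<Rightarrow> nat list \<Rightarrow> nat list set" where
  "child_set H v = {v @ [i] | i. adjacent H v (v @ [i])}"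

text \<open>These properties pass from a Galton-Watson tree to all its subgraphs, which is what
  strong spatial mixing quantifies over.\<close>

locale forest =
  fixes H :: "nat list graph"
  assumes simple: "simple_graph H"
    and adjacent_cases: "adjacent H u v \<Longrightarrow> (\<exists>i. v = u @ [i]) \<or> (\<exists>i. u = v @ [i])"
    and finite_child_set [simp]: "finite (child_set H v)"
begin

lemma adjacent_sym: "adjacent H u v \<longleftrightarrow> adjacent H v u"
  by (simp add: adjacent_def insert_commute)

lemma adjacent_verts:
  assumes "adjacent H u v"
  shows "u \<in> verts H" "v \<in> verts H" "u \<noteq> v"
  using assms simple by (auto simp: adjacent_def simple_graph_def doubleton_eq_iff)

lemma adjacent_iff: "adjacent H u v \<longleftrightarrow> v \<in> child_set H u \<or> u \<in> child_set H v"
  using adjacent_cases[of u v] by (auto simp: child_set_def adjacent_sym)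

end

lemma child_set_parent: "c \<in> child_set H u \<Longrightarrow> u = butlast c"
  by (auto simp: child_set_def)

lemma length_child: "c \<in> child_set H u \<Longrightarrow> length c = Suc (length u)"
  by (auto simp: child_set_def)

section \<open>Partition functions and occupation odds\<close>

definition indep_sets :: "'v graph \<Rightarrow> 'v set \<Rightarrow> 'v set set" where
  "indep_sets H W = {S. S \<subseteq> W \<and> independent_in H S}"

definition partition_fun :: "real \<Rightarrow> 'v graph \<Rightarrow> 'v set \<Rightarrow> real" where
  "partition_fun \<theta> H W = (\<Sum>S\<in>indep_sets H W. \<theta> ^ card S)"

lemma finite_indep_sets [simp]: "finite W \<Longrightarrow> finite (indep_sets H W)"
  by (rule finite_subset[of _ "Pow W"]) (auto simp: indep_sets_def)

lemma empty_in_indep_sets [simp]: "{} \<in> indep_sets H W"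
  by (simp add: indep_sets_def independent_in_def)

lemma partition_fun_pos:
  assumes "finite W" "0 < \<theta>"
  shows "0 < partition_fun \<theta> H W"
proof -
  have "indep_sets H W \<noteq> {}"
    using empty_in_indep_sets by blast
  with assms show ?thesis
    unfolding partition_fun_def by (intro sum_pos) auto
qed

text \<open>The odds of \<open>v\<close> being occupied in the hard-core model on the part of \<open>W\<close> below \<open>v\<close>.\<close>

function occ_ratio :: "real \<Rightarrow> nat list graph \<Rightarrow> nat list set \<Rightarrow> nat list \<Rightarrow> real" where
  "occ_ratio \<theta> H W v = (if finite W \<and> v \<in> W
     then \<theta> * (\<Prod>c\<in>child_set H v. 1 / (1 + occ_ratio \<theta> H W c)) else 0)"
  by auto
termination
\<comment> \<open>The measure is the height of \<open>v\<close> above the deepest level of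
  \<open>W\<close>. It is shifted by one so that it still drops when a vertex of that level calls
  its children.\<close>
proof (relation "Wellfounded.measure (\<lambda>(\<theta>, H, W, v). Suc (Max (length ` W)) - length v)")
  fix \<theta> H W v c
  assume "finite W \<and> v \<in> W" "c \<in> child_set H v"
  then have "length v \<le> Max (length ` W)" "length c = Suc (length v)"
    by (auto simp: length_child)
  then show "((\<theta>, H, W, c), \<theta>, H, W, v) \<in> Wellfounded.measure (\<lambda>(\<theta>, H, W, v). Suc (Max (length ` W)) - length v)"
    by simp
qed simp

declare occ_ratio.simps [simp del]

text \<open>Odds 0 belong to a vertex that cannot be occupied. Its factor in the recursion is 1, so
  products may range over all children.\<close>

lemma occ_ratio_outside [simp]: "v \<notin> W \<Longrightarrow> occ_ratio \<theta> H W v = 0"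
  by (simp add: occ_ratio.simps)

lemma occ_ratio_nonneg: "0 \<le> \<theta> \<Longrightarrow> 0 \<le> occ_ratio \<theta> H W v"
proof (induction \<theta> H W v rule: occ_ratio.induct)
  case (1 \<theta> H W v)
  then show ?case
    by (subst occ_ratio.simps) (auto intro!: mult_nonneg_nonneg prod_nonneg)
qed

lemma occ_ratio_le:
  assumes "0 \<le> \<theta>"
  shows "occ_ratio \<theta> H W v \<le> \<theta>"
proof -
  have "(\<Prod>c\<in>child_set H v. 1 / (1 + occ_ratio \<theta> H W c)) \<le> 1"
    using occ_ratio_nonneg[OF assms, of H W] by (intro prod_le_1) (auto simp: divide_le_eq_1 add_nonneg_pos)
  then show ?thesis
    using assms by (subst occ_ratio.simps) (auto simp: mult_left_le)
qed

text \<open>The odds at \<open>v\<close> depend only on the part of \<open>W\<close> below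
  \<open>v\<close>. The first assumption makes \<open>B\<close> closed under parents inside
  \<open>W\<close>, so nothing below a vertex outside \<open>B\<close> is removed.\<close>

lemma occ_ratio_Diff:
  assumes "\<And>u b. u \<in> W \<Longrightarrow> b \<in> W \<Longrightarrow> b \<in> B \<Longrightarrow> b \<in> child_set H u \<Longrightarrow> u \<in> B"
    and "v \<notin> B" "finite W"
  shows "occ_ratio \<theta> H (W - B) v = occ_ratio \<theta> H W v"
  using assms
proof (induction \<theta> H W v rule: occ_ratio.induct)
  case (1 \<theta> H W v)
  show ?case
  proof (cases "v \<in> W")
    case True
    have "occ_ratio \<theta> H (W - B) c = occ_ratio \<theta> H W c" if c: "c \<in> child_set H v" for c
    proof (cases "c \<in> W")
      case True
      with c "1.prems"(1)[of v c] "1.prems"(2) \<open>v \<in> W\<close> have "c \<notin> B" by auto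
      moreover have "finite W \<and> v \<in> W"
        using "1.prems"(3) \<open>v \<in> W\<close> by simp
      ultimately show ?thesis
        using "1.IH"[OF _ c] "1.prems"(1,3) by blast
    qed simp
    with True "1.prems"(2,3) show ?thesis
      by (simp add: occ_ratio.simps[of \<theta> H _ v])
  qed simp
qed

context forest
begin

text \<open>Independent sets are split by whether they contain \<open>c\<close>. If they do, the
  neighbours of \<open>c\<close> are excluded, and within \<open>W\<close> these are only its
  children.\<close>

lemma partition_fun_delete:
  assumes "c \<in> W" "finite W" "W \<subseteq> verts H" and top: "\<And>u. u \<in> W \<Longrightarrow> c \<notin> child_set H u"
  shows "partition_fun \<theta> H W =
    partition_fun \<theta> H (W - {c}) + \<theta> * partition_fun \<theta> H (W - {c} - child_set H c)"
proof -
  let ?I = "indep_sets H (W - {c} - child_set H c)"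
  have nadj: "\<not> adjacent H c u \<and> \<not> adjacent H u c" if "u \<in> W - {c} - child_set H c" for u
    using that top[of u] by (auto simp: adjacent_iff)
  have "indep_sets H W = indep_sets H (W - {c}) \<union> insert c ` ?I"
  proof (intro equalityI subsetI)
    fix S assume S: "S \<in> indep_sets H W"
    show "S \<in> indep_sets H (W - {c}) \<union> insert c ` ?I"
    proof (cases "c \<in> S")
      case True
      have "S - {c} \<in> ?I"
        using S True by (auto simp: indep_sets_def independent_in_def adjacent_iff)
      moreover have "S = insert c (S - {c})"
        using True by auto
      ultimately show ?thesis by blast
    qed (use S in \<open>auto simp: indep_sets_def\<close>)
  next
    fix S assume "S \<in> indep_sets H (W - {c}) \<union> insert c ` ?I"
    then show "S \<in> indep_sets H W"
    proof
      assume "S \<in> indep_sets H (W - {c})"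
      then show ?thesis by (auto simp: indep_sets_def)
    next
      assume "S \<in> insert c ` ?I"
      then obtain S' where S': "S = insert c S'" "S' \<in> ?I" by auto
      then have "S' \<subseteq> W - {c} - child_set H c" "independent_in H S'"
        by (auto simp: indep_sets_def)
      moreover from this have "\<forall>u\<in>S'. \<not> adjacent H c u \<and> \<not> adjacent H u c"
        using nadj by blast
      moreover have "\<not> adjacent H c c" "c \<in> verts H"
        using adjacent_verts(3)[of c c] assms(1,3) by auto
      ultimately have "independent_in H S" "S \<subseteq> W"
        using S'(1) assms(1) by (auto simp: independent_in_def)
      then show ?thesis
        by (simp add: indep_sets_def)
    qed
  qed
  moreover have "indep_sets H (W - {c}) \<inter> insert c ` ?I = {}"
    by (auto simp: indep_sets_def)
  ultimately have "partition_fun \<theta> H W =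
      partition_fun \<theta> H (W - {c}) + (\<Sum>S\<in>insert c ` ?I. \<theta> ^ card S)"
    using assms(2) by (simp add: partition_fun_def sum.union_disjoint)
  also have "(\<Sum>S\<in>insert c ` ?I. \<theta> ^ card S) = (\<Sum>S\<in>?I. \<theta> ^ card (insert c S))"
  proof (rule sum.reindex_cong[of "insert c"])
    show "inj_on (insert c) ?I"
    proof (rule inj_onI)
      fix S S' assume "S \<in> ?I" "S' \<in> ?I" "insert c S = insert c S'"
      moreover from this have "c \<notin> S" "c \<notin> S'"
        by (auto simp: indep_sets_def)
      ultimately show "S = S'"
        by (simp add: insert_ident)
    qed
  qed auto
  also have "\<dots> = (\<Sum>S\<in>?I. \<theta> * \<theta> ^ card S)"
  proof (intro sum.cong refl)
    fix S assume "S \<in> ?I"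
    then have "finite S" "c \<notin> S"
      using assms(2) by (auto simp: indep_sets_def dest: finite_subset)
    then show "\<theta> ^ card (insert c S) = \<theta> * \<theta> ^ card S" by simp
  qed
  finally show ?thesis
    by (simp add: partition_fun_def sum_distrib_left)
qed

text \<open>The vertices of \<open>C\<close> have no parent in \<open>W\<close>, so the parts below
  them do not interact. Putting back a top vertex \<open>c\<close> multiplies the partition function
  by 1 plus the odds at \<open>c\<close>, the two terms being the weights of \<open>c\<close> empty
  and \<open>c\<close> occupied.\<close>

lemma partition_fun_tops:
  assumes "finite W" "W \<subseteq> verts H" "C \<subseteq> W" "0 < \<theta>"
    and "\<And>c u. c \<in> C \<Longrightarrow> u \<in> W \<Longrightarrow> c \<notin> child_set H u"
  shows "partition_fun \<theta> H W = partition_fun \<theta> H (W - C) * (\<Prod>c\<in>C. 1 + occ_ratio \<theta> H W c)"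
  using assms
proof (induction "card W" arbitrary: W C rule: less_induct)
  case less
  show ?case
  proof (cases "C = {}")
    case False
    then obtain c where c: "c \<in> C" by auto
    define W1 where "W1 = W - {c}"
    have cW: "c \<in> W" and top: "\<And>u. u \<in> W \<Longrightarrow> c \<notin> child_set H u"
      using c less by auto
    have card: "card W1 < card W"
      unfolding W1_def using cW less by (intro psubset_card_mono) auto
    have W1: "finite W1" "W1 \<subseteq> verts H"
      using less by (auto simp: W1_def)
    have ratio: "occ_ratio \<theta> H W1 v = occ_ratio \<theta> H W v" if "v \<noteq> c" for v
      unfolding W1_def using that top less.prems(1) by (intro occ_ratio_Diff) auto
    have c_not_child: "c \<notin> child_set H c"
      using length_child[of c H c] by auto
    have pos: "0 < 1 + occ_ratio \<theta> H W v" for v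
      using occ_ratio_nonneg[of \<theta> H W v] less.prems(4) by simp
    \<comment> \<open>Once \<open>c\<close> is deleted its children are top vertices. The induction
      hypothesis for them gives the cost of forcing them to be empty, which is the product in the
      recursion for the odds at \<open>c\<close>.\<close>
    have "partition_fun \<theta> H W1 = partition_fun \<theta> H (W1 - (child_set H c \<inter> W)) *
        (\<Prod>x\<in>child_set H c \<inter> W. 1 + occ_ratio \<theta> H W1 x)"
    proof (rule less.hyps[OF card W1 _ less.prems(4)])
      show "child_set H c \<inter> W \<subseteq> W1"
        using c_not_child by (auto simp: W1_def)
      fix x u assume "x \<in> child_set H c \<inter> W" "u \<in> W1"
      then show "x \<notin> child_set H u"
        using child_set_parent[of x H c] child_set_parent[of x H u] by (auto simp: W1_def)
    qed
    also have "W1 - (child_set H c \<inter> W) = W - {c} - child_set H c"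
      by (auto simp: W1_def)
    also have "(\<Prod>x\<in>child_set H c \<inter> W. 1 + occ_ratio \<theta> H W1 x) = (\<Prod>x\<in>child_set H c. 1 + occ_ratio \<theta> H W x)"
      using c_not_child by (intro prod.mono_neutral_cong_left) (auto intro!: ratio)
    finally have "partition_fun \<theta> H (W - {c} - child_set H c) =
        partition_fun \<theta> H W1 * (\<Prod>x\<in>child_set H c. 1 / (1 + occ_ratio \<theta> H W x))"
      using pos by (simp add: prod_dividef field_simps prod_zero_iff less_imp_neq[THEN not_sym])
    then have "partition_fun \<theta> H W = partition_fun \<theta> H W1 * (1 + occ_ratio \<theta> H W c)"
      using partition_fun_delete[OF cW less.prems(1,2) top] cW less.prems(1)
      by (simp add: W1_def[symmetric] occ_ratio.simps[of \<theta> H W c] algebra_simps)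
    also have "partition_fun \<theta> H W1 = partition_fun \<theta> H (W1 - (C - {c})) *
        (\<Prod>x\<in>C - {c}. 1 + occ_ratio \<theta> H W1 x)"
      using less.prems by (intro less.hyps[OF card W1]) (auto simp: W1_def)
    also have "(\<Prod>x\<in>C - {c}. 1 + occ_ratio \<theta> H W1 x) = (\<Prod>x\<in>C - {c}. 1 + occ_ratio \<theta> H W x)"
      by (intro prod.cong) (auto intro!: ratio)
    also have "W1 - (C - {c}) = W - C"
      using c by (auto simp: W1_def)
    finally show ?thesis
      using c less.prems finite_subset[of C W] by (simp add: prod.remove[of C c] mult_ac)
  qed simp
qed

section \<open>Law of the configuration on a block\<close>

definition free_region :: "nat list set \<Rightarrow> nat list set \<Rightarrow> nat list set" where
  "free_region \<Psi> \<sigma> = \<Psi> - inner_boundary H \<Psi> - {u. \<exists>s\<in>\<sigma>. adjacent H u s}"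

definition outer_children :: "nat list set \<Rightarrow> nat list set \<Rightarrow> nat list set" where
  "outer_children B A = (\<Union>a\<in>A. child_set H a) - B"

text \<open>The probability of the trace \<open>A\<close> on the block up to normalisation:
  occupying \<open>A\<close> forces its children outside the block to be empty, and an empty child
  \<open>c\<close> has probability 1 / (1 + odds at \<open>c\<close>).\<close>

definition marginal_weight :: "real \<Rightarrow> nat list set \<Rightarrow> nat list set \<Rightarrow> nat list set \<Rightarrow> real" where
  "marginal_weight \<theta> W B A = \<theta> ^ card A / (\<Prod>c\<in>outer_children B A. 1 + occ_ratio \<theta> H W c)"

text \<open>Closure under parents makes everything outside the block hang below it or in other
  components, and the distance from the boundary keeps the boundary condition from acting on the
  block directly.\<close>

definition interior_block :: "nat list set \<Rightarrow> nat list set \<Rightarrow> bool" where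
  "interior_block \<Psi> B \<longleftrightarrow> finite \<Psi> \<and> \<Psi> \<subseteq> verts H \<and> B \<subseteq> \<Psi> \<and>
     (\<forall>b\<in>B. \<forall>s\<in>inner_boundary H \<Psi>. b \<noteq> s \<and> \<not> adjacent H b s) \<and>
     (\<forall>u b. b \<in> B \<longrightarrow> b \<in> child_set H u \<longrightarrow> u \<in> B)"

lemma marginal_weight_pos: "0 < \<theta> \<Longrightarrow> 0 < marginal_weight \<theta> W B A"
  using occ_ratio_nonneg[of \<theta> H W]
  by (auto simp: marginal_weight_def intro!: divide_pos_pos prod_pos add_pos_nonneg)

text \<open>A configuration with trace \<open>A\<close> is the disjoint union of \<sigma>,
  \<open>A\<close> and an independent set of the vertices that neither \<sigma> nor \<open>A\<close>
  excludes. The partition function of those vertices is compared with that of \<open>W - B\<close>,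
  which does not depend on \<open>A\<close>.\<close>

lemma sum_configs_block:
  assumes bl: "interior_block \<Psi> B" and bc: "boundary_condition H \<Psi> \<sigma>" and \<theta>: "0 < \<theta>"
    and A: "A \<in> indep_sets H B"
  defines "W \<equiv> free_region \<Psi> \<sigma>"
  shows "(\<Sum>S | S \<in> hardcore_configs H \<Psi> \<sigma> \<and> S \<inter> B = A. \<theta> ^ card S) =
    \<theta> ^ card \<sigma> * partition_fun \<theta> H (W - B) * marginal_weight \<theta> W B A"
proof -
  let ?C = "outer_children B A"
  have "finite \<Psi>" "W \<subseteq> \<Psi>" "B \<subseteq> \<Psi>" "A \<subseteq> \<Psi>" "\<sigma> \<subseteq> \<Psi>"
    using bl bc A by (auto simp: interior_block_def W_def free_region_def boundary_condition_def
        inner_boundary_def indep_sets_def)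
  then have fin: "finite \<Psi>" "finite W" "finite B" "finite A" "finite \<sigma>"
    by (auto intro: finite_subset)
  have finC: "finite ?C"
    using fin by (auto simp: outer_children_def)
  have \<sigma>: "\<sigma> \<subseteq> inner_boundary H \<Psi>" "independent_in H \<sigma>" "inner_boundary H \<Psi> \<subseteq> \<Psi>"
    using bc by (auto simp: boundary_condition_def inner_boundary_def)
  have B: "B \<subseteq> \<Psi>" "\<And>b s. b \<in> B \<Longrightarrow> s \<in> inner_boundary H \<Psi> \<Longrightarrow> b \<noteq> s \<and> \<not> adjacent H b s \<and> \<not> adjacent H s b"
    "\<And>u b. b \<in> B \<Longrightarrow> b \<in> child_set H u \<Longrightarrow> u \<in> B"
    using bl by (auto simp: interior_block_def adjacent_sym)
  have A': "A \<subseteq> B" "independent_in H A"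
    using A by (auto simp: indep_sets_def)
  have BI: "B \<inter> inner_boundary H \<Psi> = {}"
    using B(2) by blast
  then have \<sigma>A: "\<sigma> \<inter> A = {}"
    using \<sigma> A' by blast
  have "(\<Sum>S | S \<in> hardcore_configs H \<Psi> \<sigma> \<and> S \<inter> B = A. \<theta> ^ card S) =
    (\<Sum>S\<in>indep_sets H (W - B - ?C). \<theta> ^ card \<sigma> * \<theta> ^ card A * \<theta> ^ card S)"
  proof (rule sum.reindex_bij_witness[of _ "\<lambda>S. \<sigma> \<union> A \<union> S" "\<lambda>S. S - \<sigma> - A"])
    fix S assume S: "S \<in> {S. S \<in> hardcore_configs H \<Psi> \<sigma> \<and> S \<inter> B = A}"
    then have S': "S \<subseteq> \<Psi>" "independent_in H S" "S \<inter> inner_boundary H \<Psi> = \<sigma>" "S \<inter> B = A"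
      by (auto simp: hardcore_configs_def)
    then show "\<sigma> \<union> A \<union> (S - \<sigma> - A) = S"
      by auto
    have nadj: "\<not> adjacent H u v" if "u \<in> S" "v \<in> S" for u v
      using S'(2) that by (auto simp: independent_in_def)
    have "S - \<sigma> - A \<subseteq> W - B - ?C"
    proof
      fix x assume x: "x \<in> S - \<sigma> - A"
      with S' have "x \<in> \<Psi>" "x \<notin> inner_boundary H \<Psi>" "x \<notin> B" by auto
      moreover have "\<not> adjacent H x s" if "s \<in> \<sigma>" for s
        using that x S' nadj by blast
      moreover have "x \<notin> child_set H a" if "a \<in> A" for a
        using that x S' nadj[of a x] by (auto simp: adjacent_iff)
      ultimately show "x \<in> W - B - ?C"
        by (auto simp: W_def free_region_def outer_children_def)
    qed
    with S'(2) show "S - \<sigma> - A \<in> indep_sets H (W - B - ?C)"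
      by (auto simp: indep_sets_def independent_in_def)
    have "card S = card (\<sigma> \<union> A \<union> (S - \<sigma> - A))"
      using S' by (intro arg_cong[of _ _ card]) auto
    also have "\<dots> = card (\<sigma> \<union> A) + card (S - \<sigma> - A)"
      using fin S' by (intro card_Un_disjoint) (auto intro: finite_subset[of _ \<Psi>])
    also have "card (\<sigma> \<union> A) = card \<sigma> + card A"
      using fin \<sigma>A by (intro card_Un_disjoint) auto
    finally show "\<theta> ^ card \<sigma> * \<theta> ^ card A * \<theta> ^ card (S - \<sigma> - A) = \<theta> ^ card S"
      by (simp add: power_add)
  next
    fix S assume S: "S \<in> indep_sets H (W - B - ?C)"
    then have S': "S \<subseteq> W - B - ?C" "independent_in H S"
      by (auto simp: indep_sets_def)
    have disj: "S \<inter> \<sigma> = {}" "S \<inter> A = {}"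
      using S' \<sigma> A' by (auto simp: W_def free_region_def)
    with \<sigma>A show "\<sigma> \<union> A \<union> S - \<sigma> - A = S"
      by auto
    have "\<not> adjacent H u v \<and> \<not> adjacent H v u" if "u \<in> \<sigma>" "v \<in> S" for u v
      using that S' adjacent_sym[of u v] by (auto simp: W_def free_region_def)
    moreover have "\<not> adjacent H u v \<and> \<not> adjacent H v u" if "u \<in> \<sigma>" "v \<in> A" for u v
      using that \<sigma> A' B by blast
    moreover have "\<not> adjacent H u v \<and> \<not> adjacent H v u" if "u \<in> A" "v \<in> S" for u v
    proof -
      have "v \<notin> B" "v \<notin> ?C" "u \<in> B"
        using that S' A' by auto
      with B(3)[of u v] that show ?thesis
        by (auto simp: adjacent_iff outer_children_def)
    qed
    ultimately have "independent_in H (\<sigma> \<union> A \<union> S)"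
      using \<sigma>(2) A'(2) S'(2) unfolding independent_in_def by blast
    moreover have "\<sigma> \<union> A \<union> S \<subseteq> \<Psi>"
      using \<sigma> A' B S' by (auto simp: W_def free_region_def)
    moreover have "(\<sigma> \<union> A \<union> S) \<inter> inner_boundary H \<Psi> = \<sigma>"
      using \<sigma> A' BI S' by (auto simp: W_def free_region_def)
    moreover have "(\<sigma> \<union> A \<union> S) \<inter> B = A"
      using \<sigma> A' BI S' by auto
    ultimately show "\<sigma> \<union> A \<union> S \<in> {S. S \<in> hardcore_configs H \<Psi> \<sigma> \<and> S \<inter> B = A}"
      by (auto simp: hardcore_configs_def)
  qed
  also have "\<dots> = \<theta> ^ card \<sigma> * \<theta> ^ card A * partition_fun \<theta> H (W - B - ?C)"
    by (simp add: partition_fun_def sum_distrib_left)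
  also have "partition_fun \<theta> H (W - B - ?C) * (\<Prod>c\<in>?C. 1 + occ_ratio \<theta> H W c) = partition_fun \<theta> H (W - B)"
  proof -
    \<comment> \<open>The parent of an outer child lies in \<open>A\<close> and hence in
      \<open>B\<close>, so inside \<open>W - B\<close> the outer children are top vertices.\<close>
    have "partition_fun \<theta> H (W - B) = partition_fun \<theta> H (W - B - (?C \<inter> W)) *
        (\<Prod>c\<in>?C \<inter> W. 1 + occ_ratio \<theta> H (W - B) c)"
    proof (rule partition_fun_tops)
      fix c u assume "c \<in> ?C \<inter> W" "u \<in> W - B"
      then show "c \<notin> child_set H u"
        using A' child_set_parent[of c H] by (auto simp: outer_children_def)
    qed (use fin \<theta> bl in \<open>auto simp: interior_block_def W_def free_region_def outer_children_def\<close>)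
    also have "W - B - (?C \<inter> W) = W - B - ?C"
      by auto
    also have "(\<Prod>c\<in>?C \<inter> W. 1 + occ_ratio \<theta> H (W - B) c) = (\<Prod>c\<in>?C. 1 + occ_ratio \<theta> H W c)"
    proof (intro prod.mono_neutral_cong_left ballI)
      fix c assume "c \<in> ?C \<inter> W"
      then show "1 + occ_ratio \<theta> H (W - B) c = 1 + occ_ratio \<theta> H W c"
        using B(3) fin by (subst occ_ratio_Diff) (auto simp: outer_children_def)
    qed (use finC in auto)
    finally show ?thesis ..
  qed
  then have "partition_fun \<theta> H (W - B - ?C) = partition_fun \<theta> H (W - B) / (\<Prod>c\<in>?C. 1 + occ_ratio \<theta> H W c)"
    using occ_ratio_nonneg[of \<theta> H W] \<theta> prod_pos[of ?C "\<lambda>c. 1 + occ_ratio \<theta> H W c"]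
    by (simp add: field_simps add_pos_nonneg)
  finally show ?thesis
    by (simp add: marginal_weight_def)
qed

text \<open>The factor \<open>k\<close> common to all traces cancels, so the boundary condition
  enters only through the odds at the outer children.\<close>

lemma prob_hardcore_block:
  assumes bl: "interior_block \<Psi> B" and bc: "boundary_condition H \<Psi> \<sigma>" and \<theta>: "0 < \<theta>"
  shows "measure_pmf.prob (hardcore \<theta> H \<Psi> \<sigma>) {S. S \<inter> B \<in> X} =
    (\<Sum>A\<in>indep_sets H B \<inter> X. marginal_weight \<theta> (free_region \<Psi> \<sigma>) B A) /
    (\<Sum>A\<in>indep_sets H B. marginal_weight \<theta> (free_region \<Psi> \<sigma>) B A)"
proof -
  let ?C = "hardcore_configs H \<Psi> \<sigma>" and ?q = "marginal_weight \<theta> (free_region \<Psi> \<sigma>) B"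
  define k where "k = \<theta> ^ card \<sigma> * partition_fun \<theta> H (free_region \<Psi> \<sigma> - B)"
  have fin: "finite \<Psi>" "\<Psi> \<subseteq> verts H" "finite B"
    using bl by (auto simp: interior_block_def intro: finite_subset)
  have finC: "finite ?C"
    using fin by (auto simp: hardcore_configs_def intro: finite_subset[of _ "Pow \<Psi>"])
  have k: "0 < k"
    using fin \<theta> by (auto simp: k_def free_region_def intro!: mult_pos_pos partition_fun_pos)
  have sumX: "(\<Sum>S | S \<in> ?C \<and> S \<inter> B \<in> Y. \<theta> ^ card S) = k * (\<Sum>A\<in>indep_sets H B \<inter> Y. ?q A)" for Y
  proof -
    have "(\<Sum>S | S \<in> ?C \<and> S \<inter> B \<in> Y. \<theta> ^ card S) =
      (\<Sum>A\<in>indep_sets H B \<inter> Y. \<Sum>S | S \<in> {S. S \<in> ?C \<and> S \<inter> B \<in> Y} \<and> S \<inter> B = A. \<theta> ^ card S)"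
      using finC fin by (intro sum.group[symmetric])
        (auto simp: indep_sets_def hardcore_configs_def independent_in_def)
    also have "\<dots> = (\<Sum>A\<in>indep_sets H B \<inter> Y. \<Sum>S | S \<in> ?C \<and> S \<inter> B = A. \<theta> ^ card S)"
      by (intro sum.cong) auto
    also have "\<dots> = (\<Sum>A\<in>indep_sets H B \<inter> Y. k * ?q A)"
      by (intro sum.cong) (auto simp: sum_configs_block[OF bl bc \<theta>] k_def)
    finally show ?thesis
      by (simp add: sum_distrib_left)
  qed
  have pmf: "pmf (hardcore \<theta> H \<Psi> \<sigma>) S =
      (if S \<in> ?C then \<theta> ^ card S / (\<Sum>S'\<in>?C. \<theta> ^ card S') else 0)" for S
    using fin bc \<theta> by (intro pmf_hardcore) auto
  have "measure_pmf.prob (hardcore \<theta> H \<Psi> \<sigma>) {S. S \<inter> B \<in> X} =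
      measure_pmf.prob (hardcore \<theta> H \<Psi> \<sigma>) {S. S \<in> ?C \<and> S \<inter> B \<in> X}"
    by (rule measure_prob_cong_0) (auto simp: pmf)
  also have "\<dots> = (\<Sum>S | S \<in> ?C \<and> S \<inter> B \<in> X. pmf (hardcore \<theta> H \<Psi> \<sigma>) S)"
    using finC by (intro measure_measure_pmf_finite) auto
  also have "\<dots> = (\<Sum>S | S \<in> ?C \<and> S \<inter> B \<in> X. \<theta> ^ card S) / (\<Sum>S\<in>?C. \<theta> ^ card S)"
    by (simp add: pmf sum_divide_distrib)
  also have "(\<Sum>S\<in>?C. \<theta> ^ card S) = (\<Sum>S | S \<in> ?C \<and> S \<inter> B \<in> UNIV. \<theta> ^ card S)"
    by simp
  finally show ?thesis
    unfolding sumX using k by simp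
qed

end

section \<open>Weak spatial mixing from decay of ratios\<close>

lemma tv_dist_on_le:
  assumes "\<Lambda> \<subseteq> B"
    and "\<And>X. \<bar>measure_pmf.prob p {S. S \<inter> B \<in> X} - measure_pmf.prob q {S. S \<inter> B \<in> X}\<bar> \<le> \<epsilon>"
  shows "tv_dist_on \<Lambda> p q \<le> \<epsilon>"
  unfolding tv_dist_on_def tv_dist_def
proof (rule cSUP_least)
  fix A :: "'a set set"
  have "(\<lambda>S. S \<inter> \<Lambda>) -` A = {S. S \<inter> B \<in> {T. T \<inter> \<Lambda> \<in> A}}"
    using assms(1) by (auto simp: Int_assoc Int_absorb1)
  then show "\<bar>measure_pmf.prob (map_pmf (\<lambda>S. S \<inter> \<Lambda>) p) A - measure_pmf.prob (map_pmf (\<lambda>S. S \<inter> \<Lambda>) q) A\<bar> \<le> \<epsilon>"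
    using assms(2)[of "{T. T \<inter> \<Lambda> \<in> A}"] by simp
qed simp

lemma tv_dist_on_ge:
  "\<bar>measure_pmf.prob p {S. S \<inter> \<Lambda> \<in> X} - measure_pmf.prob q {S. S \<inter> \<Lambda> \<in> X}\<bar> \<le> tv_dist_on \<Lambda> p q"
proof -
  let ?f = "\<lambda>A. \<bar>measure_pmf.prob (map_pmf (\<lambda>S. S \<inter> \<Lambda>) p) A - measure_pmf.prob (map_pmf (\<lambda>S. S \<inter> \<Lambda>) q) A\<bar>"
  have "?f A \<le> 1" for A
    using measure_pmf.prob_le_1[of "map_pmf (\<lambda>S. S \<inter> \<Lambda>) p" A] measure_pmf.prob_le_1[of "map_pmf (\<lambda>S. S \<inter> \<Lambda>) q" A]
      measure_nonneg[of "measure_pmf (map_pmf (\<lambda>S. S \<inter> \<Lambda>) p)" A] measure_nonneg[of "measure_pmf (map_pmf (\<lambda>S. S \<inter> \<Lambda>) q)" A]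
    by linarith
  then have "?f X \<le> (SUP A. ?f A)"
    by (intro cSUP_upper bdd_aboveI2[of _ _ 1]) auto
  moreover have "(\<lambda>S. S \<inter> \<Lambda>) -` X = {S. S \<inter> \<Lambda> \<in> X}"
    by auto
  ultimately show ?thesis
    by (simp add: tv_dist_on_def tv_dist_def)
qed

lemma tv_dist_on_nonneg: "0 \<le> tv_dist_on \<Lambda> p q"
  using tv_dist_on_ge[of p \<Lambda> "{}" q] by simp

text \<open>Numerator and denominator each cost one factor \<open>exp \<delta>\<close>. As a
  quotient of sums is at most 1, the resulting multiplicative error is also an additive one.\<close>

lemma normalized_weights_close:
  fixes p q :: "'a \<Rightarrow> real"
  assumes "finite I" "I \<noteq> {}" "J \<subseteq> I" and pos: "\<And>x. x \<in> I \<Longrightarrow> 0 < p x" "\<And>x. x \<in> I \<Longrightarrow> 0 < q x"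
    and le: "\<And>x. x \<in> I \<Longrightarrow> p x \<le> exp \<delta> * q x" "\<And>x. x \<in> I \<Longrightarrow> q x \<le> exp \<delta> * p x"
  shows "sum p J / sum p I - sum q J / sum q I \<le> exp (2 * \<delta>) - 1"
proof -
  have I: "0 < sum p I" "0 < sum q I"
    using assms(1,2) pos by (simp_all add: sum_pos)
  have nonneg: "0 \<le> p x" "0 \<le> q x" if "x \<in> I" for x
    using pos[OF that] by simp_all
  have J: "0 \<le> sum p J" "0 \<le> sum q J" "sum q J \<le> sum q I"
    using nonneg assms(1,3) by (auto intro!: sum_nonneg sum_mono2)
  have E: "exp (2 * \<delta>) = exp \<delta> * exp \<delta>" "exp (\<delta> * 2) = exp \<delta> * exp \<delta>"
    by (simp_all add: exp_double power2_eq_square mult.commute[of \<delta> 2])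
  have "sum p J \<le> exp \<delta> * sum q J" "sum q I \<le> exp \<delta> * sum p I"
    using le assms(3) by (auto simp: sum_distrib_left intro!: sum_mono)
  then have "sum p J * sum q I \<le> (exp \<delta> * sum q J) * (exp \<delta> * sum p I)"
    using I J by (intro mult_mono) auto
  then have "sum p J / sum p I \<le> exp (2 * \<delta>) * (sum q J / sum q I)"
    using I by (simp add: E field_simps)
  then have "sum p J / sum p I - sum q J / sum q I \<le> (exp (2 * \<delta>) - 1) * (sum q J / sum q I)"
    by (simp add: algebra_simps)
  also have "\<dots> \<le> (exp (2 * \<delta>) - 1) * 1"
  proof (rule mult_left_mono)
    obtain x where x: "x \<in> I" using assms by auto
    have "p x \<le> exp \<delta> * (exp \<delta> * p x)"
      using le(1)[OF x] le(2)[OF x] by (meson exp_ge_zero mult_left_mono order_trans)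
    then have "1 \<le> exp (2 * \<delta>)"
      using pos(1)[OF x] mult_le_cancel_left_pos[of "p x" 1 "exp (2 * \<delta>)"] by (simp add: E mult_ac)
    then show "0 \<le> exp (2 * \<delta>) - 1" by simp
  qed (use I J in simp)
  finally show ?thesis by simp
qed

text \<open>Uniform over all values in [0, \<theta>] at depth \<open>n\<close>. One depth per
  \<epsilon> suffices, as whatever lies further down is absorbed into \<open>a\<close> and
  \<open>b\<close>.\<close>

definition ratio_decay :: "real \<Rightarrow> ('v \<Rightarrow> 'v set) \<Rightarrow> 'v \<Rightarrow> bool" where
  "ratio_decay \<theta> ch v \<longleftrightarrow> (\<forall>\<epsilon>>0. \<exists>n. \<forall>a b. (\<forall>u. 0 \<le> a u \<and> a u \<le> \<theta> \<and> 0 \<le> b u \<and> b u \<le> \<theta>) \<longrightarrow>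
     \<bar>ln (1 + ratio_iter \<theta> ch b n v) - ln (1 + ratio_iter \<theta> ch a n v)\<bar> \<le> \<epsilon>)"

text \<open>The depths \<open>s n\<close> accommodate bounds that are available only at positive or
  only at even depths.\<close>

lemma ratio_decayI:
  assumes "f \<longlonglongrightarrow> (0::real)"
    and "\<And>n a b. (\<And>u. 0 \<le> a u) \<Longrightarrow> (\<And>u. a u \<le> \<theta>) \<Longrightarrow> (\<And>u. 0 \<le> b u) \<Longrightarrow> (\<And>u. b u \<le> \<theta>) \<Longrightarrow>
      \<bar>ln (1 + ratio_iter \<theta> ch b (s n) v) - ln (1 + ratio_iter \<theta> ch a (s n) v)\<bar> \<le> f n"
  shows "ratio_decay \<theta> ch v"
  unfolding ratio_decay_def
proof (intro allI impI)
  fix \<epsilon> :: real assume "0 < \<epsilon>"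
  then obtain n where n: "f n < \<epsilon>"
    using order_tendstoD(2)[OF assms(1)] by (auto simp: eventually_sequentially)
  show "\<exists>n. \<forall>a b. (\<forall>u. 0 \<le> a u \<and> a u \<le> \<theta> \<and> 0 \<le> b u \<and> b u \<le> \<theta>) \<longrightarrow>
     \<bar>ln (1 + ratio_iter \<theta> ch b n v) - ln (1 + ratio_iter \<theta> ch a n v)\<bar> \<le> \<epsilon>"
  proof (intro exI[of _ "s n"] allI impI)
    fix a b :: "'a \<Rightarrow> real" assume "\<forall>u. 0 \<le> a u \<and> a u \<le> \<theta> \<and> 0 \<le> b u \<and> b u \<le> \<theta>"
    then have "\<bar>ln (1 + ratio_iter \<theta> ch b (s n) v) - ln (1 + ratio_iter \<theta> ch a (s n) v)\<bar> \<le> f n"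
      by (intro assms(2)) auto
    with n show "\<bar>ln (1 + ratio_iter \<theta> ch b (s n) v) - ln (1 + ratio_iter \<theta> ch a (s n) v)\<bar> \<le> \<epsilon>"
      by simp
  qed
qed

text \<open>As long as the first \<open>n\<close> generations from \<open>v\<close> on lie in
  \<open>W\<close>, the boundary condition can influence \<open>v\<close> only through the odds at
  depth \<open>n\<close>.\<close>

lemma occ_ratio_eq_ratio_iter:
  assumes "finite W" "\<And>k u. k < n \<Longrightarrow> (v, u) \<in> {(x, y). y \<in> child_set H x} ^^ k \<Longrightarrow> u \<in> W"
  shows "occ_ratio \<theta> H W v = ratio_iter \<theta> (child_set H) (occ_ratio \<theta> H W) n v"
  using assms(2)
proof (induction n arbitrary: v)
  case (Suc n)
  have "occ_ratio \<theta> H W c = ratio_iter \<theta> (child_set H) (occ_ratio \<theta> H W) n c" if "c \<in> child_set H v" for c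
  proof (rule Suc.IH)
    fix k u assume "k < n" "(c, u) \<in> {(x, y). y \<in> child_set H x} ^^ k"
    then show "u \<in> W"
      using that relpow_Suc_I2[of v c "{(x, y). y \<in> child_set H x}" u k] by (intro Suc.prems[of "Suc k"]) auto
  qed
  moreover have "v \<in> W"
    by (rule Suc.prems[of 0]) auto
  ultimately show ?case
    using assms(1) by (simp add: occ_ratio.simps[of \<theta> H W v])
qed simp

context forest
begin

lemma marginal_weight_le:
  assumes "finite B" "A \<subseteq> B" "0 < \<theta>"
    and close: "(\<Sum>c\<in>outer_children B B. \<bar>ln (1 + occ_ratio \<theta> H W c) - ln (1 + occ_ratio \<theta> H W' c)\<bar>) \<le> \<delta>"
  shows "marginal_weight \<theta> W B A \<le> exp \<delta> * marginal_weight \<theta> W' B A"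
proof -
  let ?y = "\<lambda>W c. ln (1 + occ_ratio \<theta> H W c)"
  have fin: "finite (outer_children B A)" "finite (outer_children B B)"
    using finite_subset[OF assms(2,1)] assms(1) by (auto simp: outer_children_def)
  have w: "marginal_weight \<theta> W B A = \<theta> ^ card A * exp (- (\<Sum>c\<in>outer_children B A. ?y W c))" for W
    using fin occ_ratio_nonneg[of \<theta> H W] assms(3)
    by (simp add: marginal_weight_def exp_minus exp_sum add_pos_nonneg field_simps)
  have "(\<Sum>c\<in>outer_children B A. ?y W' c) - (\<Sum>c\<in>outer_children B A. ?y W c) \<le>
      (\<Sum>c\<in>outer_children B A. \<bar>?y W c - ?y W' c\<bar>)"
    unfolding sum_subtractf[symmetric] by (rule sum_mono) auto
  also have "\<dots> \<le> (\<Sum>c\<in>outer_children B B. \<bar>?y W c - ?y W' c\<bar>)"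
    using fin assms(2) by (intro sum_mono2) (auto simp: outer_children_def)
  also note close
  finally have "exp (- (\<Sum>c\<in>outer_children B A. ?y W c)) \<le> exp (\<delta> + - (\<Sum>c\<in>outer_children B A. ?y W' c))"
    by simp
  then have "\<theta> ^ card A * exp (- (\<Sum>c\<in>outer_children B A. ?y W c)) \<le>
      \<theta> ^ card A * exp (\<delta> + - (\<Sum>c\<in>outer_children B A. ?y W' c))"
    using assms(3) by (intro mult_left_mono) auto
  then show ?thesis
    unfolding w by (simp only: exp_add mult_ac)
qed

lemma tv_dist_on_hardcore_le:
  assumes bl: "interior_block \<Psi> B" and bc: "boundary_condition H \<Psi> \<sigma>" "boundary_condition H \<Psi> \<tau>"
    and \<theta>: "0 < \<theta>" and "\<Lambda> \<subseteq> B"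
    and close: "(\<Sum>c\<in>outer_children B B. \<bar>ln (1 + occ_ratio \<theta> H (free_region \<Psi> \<sigma>) c) -
       ln (1 + occ_ratio \<theta> H (free_region \<Psi> \<tau>) c)\<bar>) \<le> \<delta>"
  shows "tv_dist_on \<Lambda> (hardcore \<theta> H \<Psi> \<sigma>) (hardcore \<theta> H \<Psi> \<tau>) \<le> exp (2 * \<delta>) - 1"
proof (rule tv_dist_on_le[OF \<open>\<Lambda> \<subseteq> B\<close>])
  fix X
  let ?I = "indep_sets H B" and ?p = "marginal_weight \<theta> (free_region \<Psi> \<sigma>) B"
    and ?q = "marginal_weight \<theta> (free_region \<Psi> \<tau>) B"
  have finB: "finite B"
    using bl by (auto simp: interior_block_def intro: finite_subset)
  have I: "finite ?I" "?I \<noteq> {}" "?I \<inter> X \<subseteq> ?I"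
    using finB empty_in_indep_sets[of H B] by (simp, blast, blast)
  have close': "(\<Sum>c\<in>outer_children B B. \<bar>ln (1 + occ_ratio \<theta> H (free_region \<Psi> \<tau>) c) -
       ln (1 + occ_ratio \<theta> H (free_region \<Psi> \<sigma>) c)\<bar>) \<le> \<delta>"
    using close by (simp add: abs_minus_commute)
  have le: "?p A \<le> exp \<delta> * ?q A" "?q A \<le> exp \<delta> * ?p A" if "A \<in> ?I" for A
    using that marginal_weight_le[OF finB _ \<theta> close] marginal_weight_le[OF finB _ \<theta> close']
    by (auto simp: indep_sets_def)
  have "sum ?p (?I \<inter> X) / sum ?p ?I - sum ?q (?I \<inter> X) / sum ?q ?I \<le> exp (2 * \<delta>) - 1"
    by (rule normalized_weights_close[OF I]) (use le \<theta> in \<open>auto simp: marginal_weight_pos\<close>)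
  moreover have "sum ?q (?I \<inter> X) / sum ?q ?I - sum ?p (?I \<inter> X) / sum ?p ?I \<le> exp (2 * \<delta>) - 1"
    by (rule normalized_weights_close[OF I]) (use le \<theta> in \<open>auto simp: marginal_weight_pos\<close>)
  ultimately show "\<bar>measure_pmf.prob (hardcore \<theta> H \<Psi> \<sigma>) {S. S \<inter> B \<in> X} -
      measure_pmf.prob (hardcore \<theta> H \<Psi> \<tau>) {S. S \<inter> B \<in> X}\<bar> \<le> exp (2 * \<delta>) - 1"
    by (simp add: prob_hardcore_block[OF bl _ \<theta>] bc abs_le_iff)
qed

section \<open>Vertices far from the boundary\<close>

abbreviation adj_rel :: "(nat list \<times> nat list) set" where
  "adj_rel \<equiv> {(x, y). adjacent H x y}"

lemma set_dist_le:
  assumes "v \<in> A" "u \<in> B" "(v, u) \<in> adj_rel ^^ k"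
  shows "set_dist H A B \<le> enat k"
proof -
  have "set_dist H A B \<le> vertex_dist H v u"
    unfolding set_dist_def using assms by (intro INF_lower2[of v] INF_lower) auto
  also have "\<dots> \<le> enat k"
    unfolding vertex_dist_def using assms by (intro INF_lower) auto
  finally show ?thesis .
qed

text \<open>A path from \<Lambda> can leave \<Psi> only through the inner boundary, which is too far
  away to be met within \<open>N\<close> steps.\<close>

lemma near_in_region:
  assumes dist: "enat N < set_dist H \<Lambda> (inner_boundary H \<Psi>)" and "\<Lambda> \<subseteq> \<Psi>" "v \<in> \<Lambda>"
    and "(v, u) \<in> adj_rel ^^ k" "k \<le> N"
  shows "u \<in> \<Psi>" "u \<notin> inner_boundary H \<Psi>"
proof -
  have nb: "u \<notin> inner_boundary H \<Psi>" if "(v, u) \<in> adj_rel ^^ k" "k \<le> N" for u k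
  proof
    assume "u \<in> inner_boundary H \<Psi>"
    with that assms have "set_dist H \<Lambda> (inner_boundary H \<Psi>) \<le> enat k"
      by (intro set_dist_le)
    also have "\<dots> \<le> enat N" using that by simp
    finally show False using dist by simp
  qed
  show "u \<in> \<Psi>"
    using assms(4,5)
  proof (induction k arbitrary: u)
    case 0
    then show ?case using assms by auto
  next
    case (Suc k)
    then obtain w where w: "(v, w) \<in> adj_rel ^^ k" "adjacent H w u" by auto
    then have "w \<in> \<Psi>" "w \<notin> inner_boundary H \<Psi>"
      using Suc nb[of w k] by auto
    with w adjacent_verts[of w u] show ?case
      by (auto simp: inner_boundary_def)
  qed
  show "u \<notin> inner_boundary H \<Psi>"
    using nb assms by blast
qed

text \<open>One step is given up: a vertex leaves the free region already when it is next to an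
  occupied boundary vertex.\<close>

lemma near_in_free_region:
  assumes dist: "enat N < set_dist H \<Lambda> (inner_boundary H \<Psi>)" and "\<Lambda> \<subseteq> \<Psi>" "v \<in> \<Lambda>"
    and u: "(v, u) \<in> adj_rel ^^ k" "k < N" and "boundary_condition H \<Psi> \<sigma>"
  shows "u \<in> free_region \<Psi> \<sigma>" "\<forall>s\<in>inner_boundary H \<Psi>. u \<noteq> s \<and> \<not> adjacent H u s"
proof -
  have "\<not> adjacent H u s" if "s \<in> inner_boundary H \<Psi>" for s
  proof
    assume "adjacent H u s"
    with u have "(v, s) \<in> adj_rel ^^ Suc k" by auto
    with near_in_region(2)[OF assms(1-3) this] that u(2) show False by simp
  qed
  moreover have "u \<in> \<Psi>" "u \<notin> inner_boundary H \<Psi>"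
    using near_in_region[OF assms(1-3) u(1)] u(2) by auto
  ultimately show "u \<in> free_region \<Psi> \<sigma>" "\<forall>s\<in>inner_boundary H \<Psi>. u \<noteq> s \<and> \<not> adjacent H u s"
    using assms(6) by (auto simp: free_region_def boundary_condition_def)
qed

lemma child_relpow_subset: "(v, u) \<in> {(x, y). y \<in> child_set H x} ^^ k \<Longrightarrow> (v, u) \<in> adj_rel ^^ k"
proof (induction k arbitrary: u)
  case (Suc k)
  then show ?case by (auto simp: adjacent_iff)
qed simp

definition ancestors :: "nat list set \<Rightarrow> nat list set" where
  "ancestors \<Lambda> = {u. \<exists>v\<in>\<Lambda>. (u, v) \<in> {(x, y). y \<in> child_set H x}\<^sup>*}"

text \<open>The label of an ancestor is a prefix, and a word has finitely many prefixes.\<close>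

lemma finite_ancestors:
  assumes "finite \<Lambda>"
  shows "finite (ancestors \<Lambda>)"
proof -
  have "u = take (length u) v \<and> length u \<le> length v" if "(u, v) \<in> {(x, y). y \<in> child_set H x}\<^sup>*" for u v
    using that
  proof (induction rule: rtrancl_induct)
    case (step y z)
    then show ?case by (auto simp: child_set_def)
  qed simp
  then have "ancestors \<Lambda> \<subseteq> (\<Union>v\<in>\<Lambda>. (\<lambda>k. take k v) ` {..length v})"
    unfolding ancestors_def by fastforce
  then show ?thesis
    by (rule finite_subset) (use assms in auto)
qed

lemma ancestors_reachable:
  assumes "b \<in> ancestors \<Lambda>"
  shows "\<exists>v\<in>\<Lambda>. \<exists>k. (v, b) \<in> adj_rel ^^ k"
proof -
  obtain v where v: "v \<in> \<Lambda>" "(b, v) \<in> {(x, y). y \<in> child_set H x}\<^sup>*"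
    using assms by (auto simp: ancestors_def)
  from v(2) have "(v, b) \<in> adj_rel\<^sup>*"
  proof (induction rule: converse_rtrancl_induct)
    case (step y z)
    then have "(z, y) \<in> adj_rel" by (auto simp: adjacent_iff)
    with step show ?case by (meson rtrancl.rtrancl_into_rtrancl)
  qed simp
  then have "\<exists>k. (v, b) \<in> adj_rel ^^ k"
    by (rule rtrancl_imp_relpow)
  with v(1) show ?thesis
    by blast
qed

text \<open>The block consists of \<Lambda> and its ancestors and does not change with
  \<open>n\<close>. The law on it depends on the boundary condition only through the odds at its
  finitely many outer children, where the assumed decay applies.\<close>

theorem WSM_of_ratio_decay:
  assumes \<theta>: "0 < \<theta>" and decay: "\<And>v. v \<in> verts H \<Longrightarrow> ratio_decay \<theta> (child_set H) v"
  shows "WSM \<theta> H"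
  unfolding WSM_def
proof (intro allI impI)
  fix \<Lambda> :: "nat list set" and \<Psi> :: "nat \<Rightarrow> nat list set" and \<sigma> \<tau> :: "nat \<Rightarrow> nat list set"
  assume fin\<Lambda>: "finite \<Lambda>"
    and seq: "\<forall>n. finite (\<Psi> n) \<and> \<Lambda> \<subseteq> \<Psi> n \<and> \<Psi> n \<subseteq> verts H \<and>
      boundary_condition H (\<Psi> n) (\<sigma> n) \<and> boundary_condition H (\<Psi> n) (\<tau> n)"
    and dist: "(\<lambda>n. set_dist H \<Lambda> (inner_boundary H (\<Psi> n))) \<longlonglongrightarrow> \<infinity>"
  define B where "B = ancestors \<Lambda>"
  define C where "C = outer_children B B"
  have finB: "finite B"
    unfolding B_def by (rule finite_ancestors[OF fin\<Lambda>])
  have finC: "finite C"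
    using finB by (auto simp: C_def outer_children_def)
  have \<Lambda>B: "\<Lambda> \<subseteq> B"
    by (auto simp: B_def ancestors_def)
  have up: "u \<in> B" if "b \<in> B" "b \<in> child_set H u" for u b
    using that unfolding B_def ancestors_def
    by (auto intro: converse_rtrancl_into_rtrancl)
  have reach: "\<exists>k. \<exists>v\<in>\<Lambda>. (v, c) \<in> adj_rel ^^ k" if "c \<in> B \<union> C" for c
  proof (cases "c \<in> B")
    case True
    then show ?thesis using ancestors_reachable[of c \<Lambda>] by (auto simp: B_def)
  next
    case False
    with that obtain b where b: "b \<in> B" "adjacent H b c"
      by (auto simp: C_def outer_children_def adjacent_iff)
    then obtain v k where "v \<in> \<Lambda>" "(v, b) \<in> adj_rel ^^ k"
      using ancestors_reachable[of b \<Lambda>] by (auto simp: B_def)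
    with b(2) have "v \<in> \<Lambda>" "(v, c) \<in> adj_rel ^^ Suc k" by auto
    then show ?thesis by blast
  qed
  then obtain \<kappa> where \<kappa>: "\<And>c. c \<in> B \<union> C \<Longrightarrow> \<exists>v\<in>\<Lambda>. (v, c) \<in> adj_rel ^^ \<kappa> c"
    by metis
  \<comment> \<open>All vertices of the block and all its outer children are within distance
    \<open>m\<close> of \<Lambda>.\<close>
  define m where "m = Max (insert 0 (\<kappa> ` (B \<union> C)))"
  have \<kappa>m: "\<kappa> c \<le> m" if "c \<in> B \<union> C" for c
    unfolding m_def using that finB finC by (intro Max_ge) auto
  show "(\<lambda>n. tv_dist_on \<Lambda> (hardcore \<theta> H (\<Psi> n) (\<sigma> n)) (hardcore \<theta> H (\<Psi> n) (\<tau> n))) \<longlonglongrightarrow> 0"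
  proof (rule tendstoI)
    fix e :: real assume e: "0 < e"
    \<comment> \<open>Chosen such that the total error over \<open>C\<close> satisfies
      \<open>exp (2 * (\<Sum>c\<in>C. \<epsilon>)) \<le> 1 + e / 2\<close>; the added 1 covers an
      empty \<open>C\<close>.\<close>
    define \<epsilon> where "\<epsilon> = ln (1 + e / 2) / 2 / (real (card C) + 1)"
    have \<epsilon>: "0 < \<epsilon>"
      using e by (simp add: \<epsilon>_def ln_gt_zero)
    have "ratio_decay \<theta> (child_set H) c" if "c \<in> C" for c
      using that decay adjacent_verts(2) by (auto simp: C_def outer_children_def adjacent_iff)
    then have "\<forall>c\<in>C. \<exists>n. \<forall>a b. (\<forall>u. 0 \<le> a u \<and> a u \<le> \<theta> \<and> 0 \<le> b u \<and> b u \<le> \<theta>) \<longrightarrow>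
        \<bar>ln (1 + ratio_iter \<theta> (child_set H) b n c) - ln (1 + ratio_iter \<theta> (child_set H) a n c)\<bar> \<le> \<epsilon>"
      using \<epsilon> unfolding ratio_decay_def by blast
    then obtain s where "\<forall>c\<in>C. \<forall>a b. (\<forall>u. 0 \<le> a u \<and> a u \<le> \<theta> \<and> 0 \<le> b u \<and> b u \<le> \<theta>) \<longrightarrow>
        \<bar>ln (1 + ratio_iter \<theta> (child_set H) b (s c) c) - ln (1 + ratio_iter \<theta> (child_set H) a (s c) c)\<bar> \<le> \<epsilon>"
      unfolding bchoice_iff by blast
    then have s: "\<bar>ln (1 + ratio_iter \<theta> (child_set H) b (s c) c) - ln (1 + ratio_iter \<theta> (child_set H) a (s c) c)\<bar> \<le> \<epsilon>"
      if "c \<in> C" "\<forall>u. 0 \<le> a u \<and> a u \<le> \<theta> \<and> 0 \<le> b u \<and> b u \<le> \<theta>" for c a b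
      using that by blast
    define N where "N = (\<Sum>c\<in>C. s c)"
    have sN: "s c \<le> N" if "c \<in> C" for c
      unfolding N_def using that finC by (intro member_le_sum) auto
    \<comment> \<open>\<open>m\<close> steps lead to the outer children and at most \<open>N\<close>
      further generations are inspected below them. The last 1 gives the strict inequality for the
      block itself, also when \<open>N\<close> is 0.\<close>
    have tv: "tv_dist_on \<Lambda> (hardcore \<theta> H (\<Psi> n) (\<sigma> n)) (hardcore \<theta> H (\<Psi> n) (\<tau> n)) \<le> exp (2 * (\<Sum>c\<in>C. \<epsilon>)) - 1"
      if far: "enat (m + N + 1) < set_dist H \<Lambda> (inner_boundary H (\<Psi> n))" for n
    proof -
      have seq': "finite (\<Psi> n)" "\<Lambda> \<subseteq> \<Psi> n" "\<Psi> n \<subseteq> verts H"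
        "boundary_condition H (\<Psi> n) (\<sigma> n)" "boundary_condition H (\<Psi> n) (\<tau> n)"
        using seq by auto
      have "interior_block (\<Psi> n) B"
        unfolding interior_block_def
      proof (intro conjI subsetI ballI)
        fix b assume b: "b \<in> B"
        then obtain v where v: "v \<in> \<Lambda>" "(v, b) \<in> adj_rel ^^ \<kappa> b"
          using \<kappa> by blast
        have k: "\<kappa> b < m + N + 1"
          using \<kappa>m[of b] b by simp
        show "b \<in> \<Psi> n"
          using near_in_region(1)[OF far seq'(2) v] k by simp
        fix s assume "s \<in> inner_boundary H (\<Psi> n)"
        with near_in_free_region(2)[OF far seq'(2) v k seq'(4)]
        show "b \<noteq> s" "\<not> adjacent H b s" by auto
      qed (use seq' up in auto)
      moreover have "(\<Sum>c\<in>outer_children B B. \<bar>ln (1 + occ_ratio \<theta> H (free_region (\<Psi> n) (\<sigma> n)) c) -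
         ln (1 + occ_ratio \<theta> H (free_region (\<Psi> n) (\<tau> n)) c)\<bar>) \<le> (\<Sum>c\<in>C. \<epsilon>)"
        unfolding C_def[symmetric]
      proof (rule sum_mono)
        fix c assume c: "c \<in> C"
        then obtain v where v: "v \<in> \<Lambda>" "(v, c) \<in> adj_rel ^^ \<kappa> c"
          using \<kappa> by blast
        have iter: "occ_ratio \<theta> H (free_region (\<Psi> n) \<rho>) c =
            ratio_iter \<theta> (child_set H) (occ_ratio \<theta> H (free_region (\<Psi> n) \<rho>)) (s c) c"
          if bc: "boundary_condition H (\<Psi> n) \<rho>" for \<rho>
        proof (rule occ_ratio_eq_ratio_iter)
          show "finite (free_region (\<Psi> n) \<rho>)"
            using seq' by (simp add: free_region_def)
          fix k u assume k: "k < s c" "(c, u) \<in> {(x, y). y \<in> child_set H x} ^^ k"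
          have "(v, u) \<in> adj_rel ^^ (\<kappa> c + k)"
            using v(2) child_relpow_subset[OF k(2)] by (auto simp: relpow_add)
          moreover have "\<kappa> c + k < m + N + 1"
            using \<kappa>m[of c] sN[of c] c k(1) by simp
          ultimately show "u \<in> free_region (\<Psi> n) \<rho>"
            using near_in_free_region(1)[OF far seq'(2) v(1) _ _ bc] by blast
        qed
        show "\<bar>ln (1 + occ_ratio \<theta> H (free_region (\<Psi> n) (\<sigma> n)) c) -
            ln (1 + occ_ratio \<theta> H (free_region (\<Psi> n) (\<tau> n)) c)\<bar> \<le> \<epsilon>"
          unfolding iter[OF seq'(4)] iter[OF seq'(5)]
          using \<theta> by (intro s[OF c]) (auto simp: occ_ratio_nonneg occ_ratio_le)
      qed
      ultimately show ?thesis
        using seq' \<theta> \<Lambda>B by (intro tv_dist_on_hardcore_le) auto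
    qed
    have "(\<Sum>c\<in>C. \<epsilon>) \<le> ln (1 + e / 2) / 2"
      using e by (simp add: \<epsilon>_def field_simps)
    then have "exp (2 * (\<Sum>c\<in>C. \<epsilon>)) \<le> exp (ln (1 + e / 2))"
      by simp
    then have small: "exp (2 * (\<Sum>c\<in>C. \<epsilon>)) - 1 < e"
      using e by simp
    have "\<forall>\<^sub>F n in sequentially. enat (m + N + 1) < set_dist H \<Lambda> (inner_boundary H (\<Psi> n))"
      using order_tendstoD(1)[OF dist] by simp
    then show "\<forall>\<^sub>F n in sequentially. dist (tv_dist_on \<Lambda> (hardcore \<theta> H (\<Psi> n) (\<sigma> n)) (hardcore \<theta> H (\<Psi> n) (\<tau> n))) 0 < e"
    proof eventually_elim
      case (elim n)
      then show ?case
        using tv[OF elim] small tv_dist_on_nonneg[of \<Lambda> "hardcore \<theta> H (\<Psi> n) (\<sigma> n)"] by simp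
    qed
  qed
qed

end

section \<open>Branching sums on Poisson trees\<close>

definition subtree :: "nat list \<Rightarrow> (nat list \<Rightarrow> nat) \<Rightarrow> nat list \<Rightarrow> nat" where
  "subtree v \<xi> = (\<lambda>u. \<xi> (v @ u))"

lemma subtree_Nil [simp]: "subtree [] \<xi> = \<xi>"
  by (simp add: subtree_def)

lemma subtree_subtree [simp]: "subtree v (subtree u \<xi>) = subtree (u @ v) \<xi>"
  by (simp add: subtree_def)

lemma subtree_root [simp]: "subtree v \<xi> [] = \<xi> v"
  by (simp add: subtree_def)

lemma space_offspring [simp]: "space (offspring d) = UNIV"
  by (simp add: offspring_def space_PiM PiE_def)

lemma measurable_offspring_component [measurable]:
  "(\<lambda>\<xi>. \<xi> v) \<in> measurable (offspring d) (count_space UNIV)"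
  unfolding offspring_def
  using measurable_component_singleton[of v UNIV "\<lambda>_. measure_pmf (poisson_pmf d)"] by simp

lemma measurable_offspring_indicator [measurable]:
  "(\<lambda>\<xi>. indicator A (\<xi> v) :: 'a::{topological_space, zero_neq_one}) \<in> borel_measurable (offspring d)"
  by (rule measurable_compose[OF measurable_offspring_component]) simp

lemma measurable_subtree [measurable]: "subtree v \<in> measurable (offspring d) (offspring d)"
proof -
  have "(\<lambda>\<xi>. \<lambda>u\<in>UNIV. \<xi> (v @ u)) \<in> measurable (offspring d) (offspring d)"
    unfolding offspring_def[of d]
    by (rule measurable_restrict) (simp add: measurable_offspring_component[unfolded offspring_def])
  then show ?thesis
    by (simp add: subtree_def[abs_def] restrict_def)
qed

text \<open>Reindexing an independent, identically distributed family along the injection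
  \<open>\<lambda>u. v @ u\<close> does not change its law.\<close>

lemma distr_subtree: "distr (offspring d) (offspring d) (subtree v) = offspring d"
proof -
  have "distr (\<Pi>\<^sub>M v\<in>UNIV. measure_pmf (poisson_pmf d)) (\<Pi>\<^sub>M u\<in>UNIV. measure_pmf (poisson_pmf d))
      (\<lambda>\<xi>. \<lambda>u\<in>UNIV. \<xi> (v @ u)) = (\<Pi>\<^sub>M u\<in>UNIV. measure_pmf (poisson_pmf d))"
    by (rule distr_PiM_reindex[where f = "\<lambda>u. v @ u"])
       (auto intro: measure_pmf.prob_space_axioms simp: inj_on_def)
  then show ?thesis
    by (simp add: offspring_def subtree_def[abs_def] restrict_def)
qed

lemma nn_integral_subtree:
  assumes "g \<in> borel_measurable (offspring d)"
  shows "(\<integral>\<^sup>+\<xi>. g (subtree v \<xi>) \<partial>offspring d) = (\<integral>\<^sup>+\<xi>. g \<xi> \<partial>offspring d)"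
proof -
  have "(\<integral>\<^sup>+\<xi>. g \<xi> \<partial>offspring d) = (\<integral>\<^sup>+\<xi>. g \<xi> \<partial>distr (offspring d) (offspring d) (subtree v))"
    by (simp add: distr_subtree)
  also have "\<dots> = (\<integral>\<^sup>+\<xi>. g (subtree v \<xi>) \<partial>offspring d)"
    using assms by (intro nn_integral_distr) auto
  finally show ?thesis ..
qed

section \<open>Branching property and generating functionals\<close>

lemma nn_integral_offspring_root:
  "(\<integral>\<^sup>+\<xi>. indicator {k} (\<xi> v) \<partial>offspring d) = ennreal (pmf (poisson_pmf d) k)"
proof -
  interpret product_prob_space "\<lambda>_. measure_pmf (poisson_pmf d)" UNIV
    by unfold_locales
  have "distr (offspring d) (measure_pmf (poisson_pmf d)) (\<lambda>\<xi>. \<xi> v) = measure_pmf (poisson_pmf d)"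
    unfolding offspring_def by (rule PiM_component) simp
  then have "emeasure (measure_pmf (poisson_pmf d)) {k} =
      emeasure (distr (offspring d) (measure_pmf (poisson_pmf d)) (\<lambda>\<xi>. \<xi> v)) {k}"
    by simp
  also have "\<dots> = emeasure (offspring d) ((\<lambda>\<xi>. \<xi> v) -` {k} \<inter> space (offspring d))"
    by (rule emeasure_distr) auto
  also have "\<dots> = (\<integral>\<^sup>+\<xi>. indicator ((\<lambda>\<xi>. \<xi> v) -` {k} \<inter> space (offspring d)) \<xi> \<partial>offspring d)"
    by (rule nn_integral_indicator[symmetric]) measurable
  also have "\<dots> = (\<integral>\<^sup>+\<xi>. indicator {k} (\<xi> v) \<partial>offspring d)"
    by (intro nn_integral_cong) (auto simp: indicator_def)
  finally show ?thesis
    by (simp add: emeasure_pmf_single)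
qed

text \<open>The branching property: the offspring number of the root and the subtrees below its
  potential children depend on disjoint sets of coordinates, and each subtree is distributed like
  the whole tree.\<close>

lemma nn_integral_branching:
  assumes g: "\<And>j. g j \<in> borel_measurable (offspring d)"
  shows "(\<integral>\<^sup>+\<xi>. indicator {k} (\<xi> []) * (\<Prod>j<k. g j (subtree [j] \<xi>)) \<partial>offspring d) =
    ennreal (pmf (poisson_pmf d) k) * (\<Prod>j<k. \<integral>\<^sup>+\<xi>. g j \<xi> \<partial>offspring d)"
proof -
  let ?P = "\<lambda>_::nat list. measure_pmf (poisson_pmf d)"
  interpret prob_space "offspring d"
    by (rule prob_space_offspring)
  \<comment> \<open>Block 0 is the root, block \<open>Suc j\<close> consists of the words beginning
    with \<open>j\<close>.\<close>
  define K :: "nat \<Rightarrow> nat list set" where "K n = (case n of 0 \<Rightarrow> {[]} | Suc j \<Rightarrow> range (Cons j))" for n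
  define Y :: "nat \<Rightarrow> (nat list \<Rightarrow> nat) \<Rightarrow> ennreal" where
    "Y n \<xi> = (case n of 0 \<Rightarrow> indicator {k} (\<xi> []) | Suc j \<Rightarrow> g j (\<lambda>u. \<xi> (j # u)))" for n \<xi>
  have comp: "indep_vars ?P (\<lambda>v \<xi>. \<xi> v) UNIV"
  proof -
    interpret P: product_prob_space ?P UNIV
      by unfold_locales
    have "distr (offspring d) (?P v) (\<lambda>\<xi>. \<xi> v) = ?P v" for v
      unfolding offspring_def by (rule P.PiM_component) simp
    then show ?thesis
      by (subst indep_vars_iff_distr_eq_PiM)
         (auto simp: offspring_def[of d] restrict_def
           measurable_offspring_component[unfolded offspring_def])
  qed
  have "indep_vars (\<lambda>n. PiM (K n) ?P) (\<lambda>n \<xi>. restrict (\<lambda>v. \<xi> v) (K n)) UNIV"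
    by (rule indep_vars_restrict[OF comp])
       (auto simp: disjoint_family_on_def K_def split: nat.splits)
  then have "indep_vars (\<lambda>_. borel) (\<lambda>n \<xi>. Y n (restrict \<xi> (K n))) UNIV"
  proof (rule indep_vars_compose2)
    fix n :: nat
    show "Y n \<in> measurable (PiM (K n) ?P) borel"
    proof (cases n)
      case 0
      have "(\<lambda>\<xi>. \<xi> []) \<in> measurable (PiM {[]} ?P) (count_space UNIV)"
        using measurable_component_singleton[of "[]" "{[]}" ?P] by simp
      then have "(\<lambda>\<xi>. indicator {k} (\<xi> []) :: ennreal) \<in> borel_measurable (PiM {[]} ?P)"
        by (rule measurable_compose) simp
      then show ?thesis
        by (simp add: 0 K_def Y_def[abs_def])
    next
      case (Suc j)
      have "(\<lambda>\<xi>. \<lambda>u\<in>UNIV. \<xi> (j # u)) \<in> measurable (PiM (range (Cons j)) ?P) (offspring d)"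
        unfolding offspring_def by (intro measurable_restrict measurable_component_singleton) auto
      then have "(\<lambda>\<xi> u. \<xi> (j # u)) \<in> measurable (PiM (range (Cons j)) ?P) (offspring d)"
        by (simp add: restrict_def)
      from measurable_compose[OF this g[of j]] show ?thesis
        by (simp add: Suc K_def Y_def[abs_def])
    qed
  qed
  then have "indep_vars (\<lambda>_. borel) (\<lambda>n \<xi>. Y n (restrict \<xi> (K n))) {..k}"
    by (rule indep_vars_subset) auto
  then have "(\<integral>\<^sup>+\<xi>. (\<Prod>n\<le>k. Y n (restrict \<xi> (K n))) \<partial>offspring d) =
      (\<Prod>n\<le>k. \<integral>\<^sup>+\<xi>. Y n (restrict \<xi> (K n)) \<partial>offspring d)"
    by (intro indep_vars_nn_integral) auto
  moreover have "Y 0 (restrict \<xi> (K 0)) = indicator {k} (\<xi> [])" for \<xi>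
    by (simp add: Y_def K_def)
  moreover have "Y (Suc j) (restrict \<xi> (K (Suc j))) = g j (subtree [j] \<xi>)" for \<xi> j
    by (simp add: Y_def K_def subtree_def)
  ultimately show ?thesis
    using g by (simp add: prod.atMost_shift nn_integral_offspring_root nn_integral_subtree)
qed

lemma nn_integral_branching_sum:
  assumes [measurable]: "\<And>k j. g k j \<in> borel_measurable (offspring d)"
  shows "(\<integral>\<^sup>+\<xi>. (\<Prod>j<\<xi> []. g (\<xi> []) j (subtree [j] \<xi>)) \<partial>offspring d) =
    (\<Sum>k. ennreal (pmf (poisson_pmf d) k) * (\<Prod>j<k. \<integral>\<^sup>+\<xi>. g k j \<xi> \<partial>offspring d))"
proof -
  have "(\<Prod>j<\<xi> []. g (\<xi> []) j (subtree [j] \<xi>)) =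
      (\<Sum>k. indicator {k} (\<xi> []) * (\<Prod>j<k. g k j (subtree [j] \<xi>)))" for \<xi> :: "nat list \<Rightarrow> nat"
    by (subst suminf_finite[of "{\<xi> []}"]) auto
  then have "(\<integral>\<^sup>+\<xi>. (\<Prod>j<\<xi> []. g (\<xi> []) j (subtree [j] \<xi>)) \<partial>offspring d) =
    (\<integral>\<^sup>+\<xi>. (\<Sum>k. indicator {k} (\<xi> []) * (\<Prod>j<k. g k j (subtree [j] \<xi>))) \<partial>offspring d)"
    by simp
  also have "\<dots> = (\<Sum>k. \<integral>\<^sup>+\<xi>. indicator {k} (\<xi> []) * (\<Prod>j<k. g k j (subtree [j] \<xi>)) \<partial>offspring d)"
    by (intro nn_integral_suminf) measurable
  finally show ?thesis
    using assms by (simp add: nn_integral_branching)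
qed

text \<open>The offspring number takes countably many values, so sums and products of random length
  may be checked for each fixed length.\<close>

lemma measurable_branching:
  assumes [measurable]: "\<And>k. f k \<in> measurable (offspring d) M"
  shows "(\<lambda>\<xi>. f (\<xi> []) \<xi>) \<in> measurable (offspring d) M"
  by (rule measurable_compose_countable[where f = f and g = "\<lambda>\<xi>. \<xi> []"]) measurable

lemma suminf_poisson_pgf:
  assumes "0 < d" "0 \<le> y"
  shows "(\<Sum>k. ennreal (pmf (poisson_pmf d) k) * ennreal y ^ k) = ennreal (exp (d * (y - 1)))"
proof -
  have "(\<lambda>k. exp (-d) * ((d * y) ^ k /\<^sub>R fact k)) sums (exp (-d) * exp (d * y))"
    by (intro sums_mult exp_converges)
  then have "(\<lambda>k. pmf (poisson_pmf d) k * y ^ k) sums exp (d * (y - 1))"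
    using assms(1) by (simp add: power_mult_distrib field_simps exp_diff exp_minus)
  then have "(\<Sum>k. ennreal (pmf (poisson_pmf d) k * y ^ k)) = ennreal (exp (d * (y - 1)))"
    using assms by (intro suminf_ennreal_eq) auto
  then show ?thesis
    using assms by (simp add: ennreal_mult ennreal_power del: pmf_poisson)
qed

text \<open>The derivative of the generating function, obtained from (k + 1) p(k + 1) = d p(k) for
  the Poisson weights p.\<close>

lemma suminf_poisson_pgf_deriv:
  assumes "0 < d" "0 \<le> y"
  shows "(\<Sum>k. ennreal (pmf (poisson_pmf d) k) * (of_nat k * ennreal y ^ (k - 1))) =
    ennreal (d * exp (d * (y - 1)))"
proof -
  let ?f = "\<lambda>k. ennreal (pmf (poisson_pmf d) k) * (of_nat k * ennreal y ^ (k - 1))"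
  have "?f (Suc k) = ennreal d * (ennreal (pmf (poisson_pmf d) k) * ennreal y ^ k)" for k
  proof -
    have "pmf (poisson_pmf d) (Suc k) * real (Suc k) = d * pmf (poisson_pmf d) k"
      using assms(1) by (simp add: field_simps del: of_nat_Suc)
    then have "ennreal (pmf (poisson_pmf d) (Suc k)) * of_nat (Suc k) = ennreal d * ennreal (pmf (poisson_pmf d) k)"
      using assms by (simp add: ennreal_mult'[symmetric] ennreal_of_nat_eq_real_of_nat del: of_nat_Suc pmf_poisson)
    then show ?thesis
      by (simp add: mult.assoc[symmetric] del: of_nat_Suc pmf_poisson)
  qed
  then have "(\<Sum>k. ?f (Suc k)) = ennreal d * ennreal (exp (d * (y - 1)))"
    using assms by (simp add: suminf_poisson_pgf del: of_nat_Suc pmf_poisson)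
  moreover have "(\<Sum>k. ?f k) = (\<Sum>k. ?f (Suc k))"
    using suminf_offset[of ?f 1] by (simp del: of_nat_Suc pmf_poisson)
  ultimately show ?thesis
    using assms by (simp add: ennreal_mult)
qed

lemma nn_integral_prod_subtrees:
  assumes "0 < d" and [measurable]: "g \<in> borel_measurable (offspring d)"
    and "(\<integral>\<^sup>+\<xi>. g \<xi> \<partial>offspring d) = ennreal y" "0 \<le> y"
  shows "(\<integral>\<^sup>+\<xi>. (\<Prod>j<\<xi> []. g (subtree [j] \<xi>)) \<partial>offspring d) = ennreal (exp (d * (y - 1)))"
  using nn_integral_branching_sum[of "\<lambda>_ _. g" d] assms by (simp add: suminf_poisson_pgf del: pmf_poisson)

text \<open>One child is marked: it contributes the integral of \<open>h * g\<close>, the others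
  contribute \<open>y\<close> each. Summing over the marked child gives k y^(k - 1), hence the
  derivative of the generating function.\<close>

lemma nn_integral_sum_prod_subtrees:
  assumes d: "0 < d" and [measurable]: "g \<in> borel_measurable (offspring d)" "h \<in> borel_measurable (offspring d)"
    and g: "(\<integral>\<^sup>+\<xi>. g \<xi> \<partial>offspring d) = ennreal y" "0 \<le> y"
  shows "(\<integral>\<^sup>+\<xi>. (\<Sum>i<\<xi> []. h (subtree [i] \<xi>)) * (\<Prod>j<\<xi> []. g (subtree [j] \<xi>)) \<partial>offspring d) =
    ennreal (d * exp (d * (y - 1))) * (\<integral>\<^sup>+\<xi>. h \<xi> * g \<xi> \<partial>offspring d)"
proof -
  define f where "f i j = (if j = i then \<lambda>\<xi>. h \<xi> * g \<xi> else g)" for i j :: nat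
  have [measurable]: "f i j \<in> borel_measurable (offspring d)" for i j
    by (simp add: f_def)
  have split_f: "(\<Prod>j<k. if j = i then a j * b j else b j) = a i * (\<Prod>j<k. b j)"
    if "i < k" for i k and a b :: "nat \<Rightarrow> ennreal"
    using that by (subst (1 2) prod.remove[of _ i]) (auto intro!: prod.cong simp: mult_ac)
  have eq: "(\<Sum>i<\<xi> []. h (subtree [i] \<xi>)) * (\<Prod>j<\<xi> []. g (subtree [j] \<xi>)) =
      (\<Sum>k. \<Sum>i<k. indicator {k} (\<xi> []) * (\<Prod>j<k. f i j (subtree [j] \<xi>)))" for \<xi> :: "nat list \<Rightarrow> nat"
  proof -
    have "(\<Sum>k. \<Sum>i<k. indicator {k} (\<xi> []) * (\<Prod>j<k. f i j (subtree [j] \<xi>))) =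
        (\<Sum>i<\<xi> []. \<Prod>j<\<xi> []. f i j (subtree [j] \<xi>))"
      by (subst suminf_finite[of "{\<xi> []}"]) auto
    also have "\<dots> = (\<Sum>i<\<xi> []. h (subtree [i] \<xi>) * (\<Prod>j<\<xi> []. g (subtree [j] \<xi>)))"
    proof (intro sum.cong refl)
      fix i assume "i \<in> {..<\<xi> []}"
      then have "h (subtree [i] \<xi>) * (\<Prod>j<\<xi> []. g (subtree [j] \<xi>)) = (\<Prod>j<\<xi> []. if j = i
          then h (subtree [j] \<xi>) * g (subtree [j] \<xi>) else g (subtree [j] \<xi>))"
        by (subst split_f) auto
      also have "\<dots> = (\<Prod>j<\<xi> []. f i j (subtree [j] \<xi>))"
        by (intro prod.cong) (auto simp: f_def)
      finally show "(\<Prod>j<\<xi> []. f i j (subtree [j] \<xi>)) = h (subtree [i] \<xi>) * (\<Prod>j<\<xi> []. g (subtree [j] \<xi>))" ..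
    qed
    finally show ?thesis
      by (simp add: sum_distrib_right)
  qed
  have prod_f: "(\<Prod>j<k. \<integral>\<^sup>+\<xi>. f i j \<xi> \<partial>offspring d) = (\<integral>\<^sup>+\<xi>. h \<xi> * g \<xi> \<partial>offspring d) * ennreal y ^ (k - 1)"
    if "i < k" for i k
  proof -
    have "(\<Prod>j<k. \<integral>\<^sup>+\<xi>. f i j \<xi> \<partial>offspring d) =
      (\<integral>\<^sup>+\<xi>. f i i \<xi> \<partial>offspring d) * (\<Prod>j\<in>{..<k} - {i}. \<integral>\<^sup>+\<xi>. f i j \<xi> \<partial>offspring d)"
      using that by (subst prod.remove[of _ i]) auto
    also have "(\<Prod>j\<in>{..<k} - {i}. \<integral>\<^sup>+\<xi>. f i j \<xi> \<partial>offspring d) = (\<Prod>j\<in>{..<k} - {i}. ennreal y)"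
      by (intro prod.cong) (auto simp: f_def g)
    finally show ?thesis
      using that by (simp add: f_def)
  qed
  have "(\<integral>\<^sup>+\<xi>. (\<Sum>i<\<xi> []. h (subtree [i] \<xi>)) * (\<Prod>j<\<xi> []. g (subtree [j] \<xi>)) \<partial>offspring d) =
    (\<Sum>k. \<integral>\<^sup>+\<xi>. (\<Sum>i<k. indicator {k} (\<xi> []) * (\<Prod>j<k. f i j (subtree [j] \<xi>))) \<partial>offspring d)"
    unfolding eq by (intro nn_integral_suminf) measurable
  also have "\<dots> = (\<Sum>k. \<Sum>i<k. ennreal (pmf (poisson_pmf d) k) * (\<Prod>j<k. \<integral>\<^sup>+\<xi>. f i j \<xi> \<partial>offspring d))"
    by (subst nn_integral_sum) (auto simp: nn_integral_branching)
  also have "\<dots> = (\<Sum>k. (\<integral>\<^sup>+\<xi>. h \<xi> * g \<xi> \<partial>offspring d) * (ennreal (pmf (poisson_pmf d) k) * (of_nat k * ennreal y ^ (k - 1))))"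
    by (intro suminf_cong) (simp add: prod_f mult_ac)
  also have "\<dots> = (\<integral>\<^sup>+\<xi>. h \<xi> * g \<xi> \<partial>offspring d) * ennreal (d * exp (d * (y - 1)))"
    using suminf_poisson_pgf_deriv[OF d g(2)] by (simp del: pmf_poisson)
  finally show ?thesis
    by (simp add: mult.commute)
qed

section \<open>Weighted path sums as random variables\<close>

fun branch_sum :: "((nat list \<Rightarrow> nat) \<Rightarrow> real) \<Rightarrow> nat \<Rightarrow> (nat list \<Rightarrow> nat) \<Rightarrow> real" where
  "branch_sum w 0 \<xi> = 1"
| "branch_sum w (Suc n) \<xi> = w \<xi> * (\<Sum>i<\<xi> []. branch_sum w n (subtree [i] \<xi>))"

lemma branch_sum_nonneg:
  assumes "\<And>\<xi>. 0 \<le> w \<xi>"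
  shows "0 \<le> branch_sum w n \<xi>"
  by (induction n arbitrary: \<xi>) (auto intro!: mult_nonneg_nonneg sum_nonneg assms)

lemma measurable_branch_sum [measurable]:
  assumes [measurable]: "w \<in> borel_measurable (offspring d)"
  shows "branch_sum w n \<in> borel_measurable (offspring d)"
proof (induction n)
  case (Suc n)
  note [measurable] = this
  have [measurable]: "(\<lambda>\<xi>. \<Sum>i<\<xi> []. branch_sum w n (subtree [i] \<xi>)) \<in> borel_measurable (offspring d)"
    by (rule measurable_branching) measurable
  show ?case
    unfolding branch_sum.simps[abs_def] by measurable
qed simp

lemma nn_integral_sum_subtrees:
  assumes "0 < d" and [measurable]: "h \<in> borel_measurable (offspring d)"
  shows "(\<integral>\<^sup>+\<xi>. (\<Sum>i<\<xi> []. h (subtree [i] \<xi>)) \<partial>offspring d) = ennreal d * (\<integral>\<^sup>+\<xi>. h \<xi> \<partial>offspring d)"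
proof -
  interpret prob_space "offspring d" by (rule prob_space_offspring)
  show ?thesis
    using nn_integral_sum_prod_subtrees[of d "\<lambda>_. 1" h 1] assms
    by (simp add: emeasure_space_1[simplified])
qed

lemma nn_integral_branch_sum_one:
  assumes "0 < d"
  shows "(\<integral>\<^sup>+\<xi>. ennreal (branch_sum (\<lambda>_. 1) n \<xi>) \<partial>offspring d) = ennreal (d ^ n)"
proof (induction n)
  case 0
  interpret prob_space "offspring d" by (rule prob_space_offspring)
  show ?case
    by (simp add: emeasure_space_1[simplified])
next
  case (Suc n)
  have "ennreal (branch_sum (\<lambda>_. 1) (Suc n) \<xi>) = (\<Sum>i<\<xi> []. ennreal (branch_sum (\<lambda>_. 1) n (subtree [i] \<xi>)))" for \<xi>
    by (simp add: branch_sum_nonneg)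
  with Suc assms show ?case
    using nn_integral_sum_subtrees[of d "\<lambda>\<xi>. ennreal (branch_sum (\<lambda>_. 1) n \<xi>)"]
    by (simp add: ennreal_mult)
qed

definition leaf_weight :: "(nat list \<Rightarrow> nat) \<Rightarrow> real" where
  "leaf_weight \<xi> = (if \<exists>i<\<xi> []. \<xi> [i] = 0 then 1 / 2 else 1)"

text \<open>Written as a product over the children, the condition that none of them is childless
  fits the generating functional.\<close>

lemma leaf_weight_eq: "leaf_weight \<xi> = (1 + (\<Prod>i<\<xi> []. indicator {0<..} (\<xi> [i]))) / 2"
proof (cases "\<exists>i<\<xi> []. \<xi> [i] = 0")
  case True
  then have "(\<Prod>i<\<xi> []. indicator {0<..} (\<xi> [i])) = (0::real)"
    by (intro prod_zero) (auto simp: indicator_def)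
  with True show ?thesis by (simp add: leaf_weight_def)
next
  case False
  then have "(\<Prod>i<\<xi> []. indicator {0<..} (\<xi> [i])) = (1::real)"
    by (intro prod.neutral) (auto simp: indicator_def)
  with False show ?thesis by (auto simp add: leaf_weight_def)
qed

lemma measurable_leaf_weight [measurable]: "leaf_weight \<in> borel_measurable (offspring d)"
proof -
  have [measurable]: "(\<lambda>\<xi>. \<Prod>i<\<xi> []. indicator {0<..} (\<xi> [i]) :: real) \<in> borel_measurable (offspring d)"
    by (rule measurable_branching) measurable
  show ?thesis
    unfolding leaf_weight_eq[abs_def] by measurable
qed

text \<open>The weight is the average of 1 and the indicator that no child is childless, an event of
  probability \<open>exp (- (d * exp (- d)))\<close>. Each of the two terms is computed by the
  branching property.\<close>

lemma nn_integral_branch_sum_leaf: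
  assumes d: "0 < d"
  shows "(\<integral>\<^sup>+\<xi>. ennreal (branch_sum leaf_weight n \<xi>) \<partial>offspring d) \<le>
    ennreal ((d * ((1 + exp (- (d * exp (- d)))) / 2)) ^ n)"
proof (induction n)
  case 0
  interpret prob_space "offspring d" by (rule prob_space_offspring)
  show ?case
    by (simp add: emeasure_space_1[simplified])
next
  case (Suc n)
  interpret prob_space "offspring d" by (rule prob_space_offspring)
  let ?q = "exp (- (d * exp (- d)))"
  define h where "h \<xi> = ennreal (branch_sum leaf_weight n \<xi>)" for \<xi>
  define g :: "(nat list \<Rightarrow> nat) \<Rightarrow> ennreal" where "g \<xi> = indicator {0<..} (\<xi> [])" for \<xi>
  have [measurable]: "h \<in> borel_measurable (offspring d)" "g \<in> borel_measurable (offspring d)"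
    unfolding h_def[abs_def] g_def[abs_def] by measurable
  have lw: "0 \<le> leaf_weight \<xi>" for \<xi>
    by (simp add: leaf_weight_def)
  have int_g: "(\<integral>\<^sup>+\<xi>. g \<xi> \<partial>offspring d) = ennreal (1 - exp (- d))"
  proof -
    have "1 = (\<integral>\<^sup>+\<xi>. (g \<xi> + indicator {0} (\<xi> [])) \<partial>offspring d)"
      using emeasure_space_1
      by (subst nn_integral_cong[of _ _ "\<lambda>_. 1"]) (auto simp: g_def indicator_def)
    also have "\<dots> = (\<integral>\<^sup>+\<xi>. g \<xi> \<partial>offspring d) + ennreal (exp (- d))"
      using d by (subst nn_integral_add) (auto simp: nn_integral_offspring_root)
    finally have "(\<integral>\<^sup>+\<xi>. g \<xi> \<partial>offspring d) = 1 - ennreal (exp (- d))"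
      by (metis ennreal_add_diff_cancel_right ennreal_neq_top)
    then show ?thesis
      by (simp add: ennreal_minus flip: ennreal_1)
  qed
  have eq: "ennreal (branch_sum leaf_weight (Suc n) \<xi>) =
     ennreal (1 / 2) * ((\<Sum>i<\<xi> []. h (subtree [i] \<xi>)) +
       (\<Sum>i<\<xi> []. h (subtree [i] \<xi>)) * (\<Prod>i<\<xi> []. g (subtree [i] \<xi>)))" for \<xi>
  proof -
    have "branch_sum leaf_weight (Suc n) \<xi> =
      1 / 2 * ((\<Sum>i<\<xi> []. branch_sum leaf_weight n (subtree [i] \<xi>)) +
         (\<Sum>i<\<xi> []. branch_sum leaf_weight n (subtree [i] \<xi>)) * (\<Prod>i<\<xi> []. indicator {0<..} (\<xi> [i])))"
      by (simp add: leaf_weight_eq algebra_simps add_divide_distrib)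
    moreover have "(\<Sum>i<\<xi> []. h (subtree [i] \<xi>)) = ennreal (\<Sum>i<\<xi> []. branch_sum leaf_weight n (subtree [i] \<xi>))"
      by (simp add: h_def branch_sum_nonneg lw)
    moreover have "(\<Prod>i<\<xi> []. g (subtree [i] \<xi>)) = ennreal (\<Prod>i<\<xi> []. indicator {0<..} (\<xi> [i]))"
      by (subst prod_ennreal[symmetric]) (auto simp: g_def ennreal_indicator)
    moreover have "ennreal (1 / 2 * (s + s * p)) = ennreal (1 / 2) * (ennreal s + ennreal s * ennreal p)"
      if "0 \<le> s" "0 \<le> p" for s p :: real
      using that by (subst ennreal_mult) (simp_all add: ennreal_mult)
    ultimately show ?thesis
      by (simp only: sum_nonneg branch_sum_nonneg lw prod_nonneg indicator_pos_le)
  qed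
  have "(\<integral>\<^sup>+\<xi>. ennreal (branch_sum leaf_weight (Suc n) \<xi>) \<partial>offspring d) =
    ennreal (1 / 2) * ((\<integral>\<^sup>+\<xi>. (\<Sum>i<\<xi> []. h (subtree [i] \<xi>)) \<partial>offspring d) +
      (\<integral>\<^sup>+\<xi>. (\<Sum>i<\<xi> []. h (subtree [i] \<xi>)) * (\<Prod>i<\<xi> []. g (subtree [i] \<xi>)) \<partial>offspring d))"
  proof -
    have [measurable]: "(\<lambda>\<xi>. \<Sum>i<\<xi> []. h (subtree [i] \<xi>)) \<in> borel_measurable (offspring d)"
      "(\<lambda>\<xi>. \<Prod>i<\<xi> []. g (subtree [i] \<xi>)) \<in> borel_measurable (offspring d)"
      by (rule measurable_branching; measurable)+
    show ?thesis
      unfolding eq by (simp add: nn_integral_cmult nn_integral_add)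
  qed
  also have "\<dots> = ennreal (1 / 2) * (ennreal d * (\<integral>\<^sup>+\<xi>. h \<xi> \<partial>offspring d) +
      ennreal (d * exp (d * ((1 - exp (- d)) - 1))) * (\<integral>\<^sup>+\<xi>. h \<xi> * g \<xi> \<partial>offspring d))"
    using d int_g by (simp add: nn_integral_sum_subtrees nn_integral_sum_prod_subtrees)
  \<comment> \<open>The marked child, through which the path continues, is also required to have
    children. Dropping this requirement decouples the generations.\<close>
  also have "(\<integral>\<^sup>+\<xi>. h \<xi> * g \<xi> \<partial>offspring d) \<le> (\<integral>\<^sup>+\<xi>. h \<xi> \<partial>offspring d)"
    by (intro nn_integral_mono) (auto simp: g_def indicator_def)
  also have "ennreal (1 / 2) * (ennreal d * (\<integral>\<^sup>+\<xi>. h \<xi> \<partial>offspring d) +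
      ennreal (d * exp (d * ((1 - exp (- d)) - 1))) * (\<integral>\<^sup>+\<xi>. h \<xi> \<partial>offspring d)) =
      ennreal (d * ((1 + ?q) / 2)) * (\<integral>\<^sup>+\<xi>. h \<xi> \<partial>offspring d)"
  proof -
    have "d * ((1 + ?q) / 2) = 1 / 2 * (d + d * ?q)"
      by (simp add: field_simps)
    then have "ennreal (d * ((1 + ?q) / 2)) = ennreal (1 / 2) * (ennreal d + ennreal (d * ?q))"
      using d by (simp only:) (subst ennreal_mult; simp)
    then show ?thesis
      by (simp only: distrib_right mult.assoc) (simp add: distrib_left)
  qed
  also have "\<dots> \<le> ennreal (d * ((1 + ?q) / 2)) * ennreal ((d * ((1 + ?q) / 2)) ^ n)"
    using Suc by (intro mult_left_mono) (auto simp: h_def)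
  also have "\<dots> = ennreal ((d * ((1 + ?q) / 2)) ^ Suc n)"
    using d by (simp add: ennreal_mult[symmetric])
  finally show ?case
    by (simp add: mult_left_mono add_left_mono del: branch_sum.simps)
qed

text \<open>The whole series has an expectation bounded by a convergent geometric series, so almost
  surely it converges and its terms tend to 0.\<close>

lemma AE_branch_sum_tendsto_0:
  assumes [measurable]: "w \<in> borel_measurable (offspring d)" and w: "\<And>\<xi>. 0 \<le> w \<xi>"
    and int: "\<And>n. (\<integral>\<^sup>+\<xi>. ennreal (branch_sum w n \<xi>) \<partial>offspring d) \<le> ennreal (\<kappa> ^ n)"
    and a: "0 \<le> a" "0 \<le> \<kappa>" "a * \<kappa> < 1"
  shows "AE \<xi> in offspring d. (\<lambda>n. a ^ n * branch_sum w n \<xi>) \<longlonglongrightarrow> 0"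
proof -
  have "(\<integral>\<^sup>+\<xi>. (\<Sum>n. ennreal (a ^ n * branch_sum w n \<xi>)) \<partial>offspring d) =
      (\<Sum>n. \<integral>\<^sup>+\<xi>. ennreal (a ^ n * branch_sum w n \<xi>) \<partial>offspring d)"
    by (rule nn_integral_suminf) measurable
  also have "\<dots> \<le> (\<Sum>n. ennreal ((a * \<kappa>) ^ n))"
  proof (intro suminf_le)
    fix n
    have "(\<integral>\<^sup>+\<xi>. ennreal (a ^ n * branch_sum w n \<xi>) \<partial>offspring d) =
        ennreal (a ^ n) * (\<integral>\<^sup>+\<xi>. ennreal (branch_sum w n \<xi>) \<partial>offspring d)"
      using a by (subst nn_integral_cmult[symmetric]) (auto simp: ennreal_mult branch_sum_nonneg w)
    also have "\<dots> \<le> ennreal (a ^ n) * ennreal (\<kappa> ^ n)"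
      by (intro mult_left_mono int) auto
    finally show "(\<integral>\<^sup>+\<xi>. ennreal (a ^ n * branch_sum w n \<xi>) \<partial>offspring d) \<le> ennreal ((a * \<kappa>) ^ n)"
      using a by (simp add: ennreal_mult power_mult_distrib)
  qed auto
  also have "\<dots> < top"
    using a by (subst suminf_ennreal2) auto
  finally have "AE \<xi> in offspring d. (\<Sum>n. ennreal (a ^ n * branch_sum w n \<xi>)) \<noteq> \<infinity>"
    by (intro nn_integral_PInf_AE) auto
  then show ?thesis
  proof eventually_elim
    case (elim \<xi>)
    then have "summable (\<lambda>n. a ^ n * branch_sum w n \<xi>)"
      using a by (intro summable_suminf_not_top) (auto simp: branch_sum_nonneg w)
    then show ?case
      by (rule summable_LIMSEQ_zero)
  qed
qed

text \<open>Among the paths from the root only those through \<open>v\<close> are kept. Each step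
  towards \<open>v\<close> has weight at least 1/2, which accounts for the power of 2.\<close>

lemma branch_sum_subtree_le:
  assumes w: "\<And>\<xi>. 1 / 2 \<le> w \<xi>"
  shows "v \<in> gw_verts \<xi> \<Longrightarrow> branch_sum w n (subtree v \<xi>) \<le> 2 ^ length v * branch_sum w (n + length v) \<xi>"
proof (induction v arbitrary: n rule: rev_induct)
  case (snoc i v)
  then have v: "v \<in> gw_verts \<xi>" "i < \<xi> v"
    by (auto simp: gw_verts_snoc)
  have w0: "0 \<le> w \<xi>" for \<xi>
    using w[of \<xi>] by simp
  have "branch_sum w n (subtree (v @ [i]) \<xi>) \<le> (\<Sum>i<\<xi> v. branch_sum w n (subtree (v @ [i]) \<xi>))"
    using v by (intro member_le_sum) (auto intro: branch_sum_nonneg w0)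
  also have "\<dots> \<le> 2 * (w (subtree v \<xi>) * (\<Sum>i<\<xi> v. branch_sum w n (subtree (v @ [i]) \<xi>)))"
    using mult_right_mono[OF w[of "subtree v \<xi>"], of "\<Sum>i<\<xi> v. branch_sum w n (subtree (v @ [i]) \<xi>)"]
    by (simp add: sum_nonneg branch_sum_nonneg w0)
  also have "\<dots> = 2 * branch_sum w (Suc n) (subtree v \<xi>)"
    by simp
  also have "\<dots> \<le> 2 * (2 ^ length v * branch_sum w (Suc n + length v) \<xi>)"
    using v by (intro mult_left_mono snoc.IH) auto
  finally show ?case
    by (simp del: branch_sum.simps)
qed simp

lemma branch_sum_subtree_tendsto_0:
  assumes w: "\<And>\<xi>. 1 / 2 \<le> w \<xi>" and a: "0 < a"
    and lim: "(\<lambda>n. a ^ n * branch_sum w n \<xi>) \<longlonglongrightarrow> 0" and v: "v \<in> gw_verts \<xi>"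
  shows "(\<lambda>n. a ^ n * branch_sum w n (subtree v \<xi>)) \<longlonglongrightarrow> 0"
proof (rule tendsto_sandwich[of "\<lambda>_. 0" _ _ "\<lambda>n. a ^ n * (2 ^ length v * branch_sum w (n + length v) \<xi>)"])
  have "(\<lambda>n. (2 / a) ^ length v * (a ^ (n + length v) * branch_sum w (n + length v) \<xi>)) \<longlonglongrightarrow> (2 / a) ^ length v * 0"
    using lim by (intro tendsto_mult tendsto_const LIMSEQ_ignore_initial_segment)
  moreover have "(2 / a) ^ length v * (a ^ (n + length v) * x) = a ^ n * (2 ^ length v * x)" for n x
    using a by (simp add: power_add power_divide)
  ultimately show "(\<lambda>n. a ^ n * (2 ^ length v * branch_sum w (n + length v) \<xi>)) \<longlonglongrightarrow> 0"
    by simp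
  have w0: "0 \<le> w \<xi>" for \<xi>
    using w[of \<xi>] by simp
  show "\<forall>\<^sub>F n in sequentially. 0 \<le> a ^ n * branch_sum w n (subtree v \<xi>)"
    using a by (auto intro!: always_eventually mult_nonneg_nonneg branch_sum_nonneg w0)
  show "\<forall>\<^sub>F n in sequentially. a ^ n * branch_sum w n (subtree v \<xi>) \<le>
      a ^ n * (2 ^ length v * branch_sum w (n + length v) \<xi>)"
    using a w v by (auto intro!: always_eventually mult_left_mono branch_sum_subtree_le)
qed simp

section \<open>Mixing on Poisson trees\<close>

lemma adjacent_gw_tree:
  "adjacent (gw_tree \<xi>) u v \<longleftrightarrow> u \<in> gw_verts \<xi> \<and> v \<in> gw_verts \<xi> \<and> ((\<exists>i. v = u @ [i]) \<or> (\<exists>i. u = v @ [i]))"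
  by (auto simp: adjacent_def gw_tree_def doubleton_eq_iff gw_verts_snoc) blast+

lemma child_set_gw_tree:
  "child_set (gw_tree \<xi>) v = (if v \<in> gw_verts \<xi> then (\<lambda>i. v @ [i]) ` {..<\<xi> v} else {})"
  by (auto simp: child_set_def adjacent_gw_tree gw_verts_snoc)

lemma adjacent_subgraph: "subgraph_of H G \<Longrightarrow> adjacent H u v \<Longrightarrow> adjacent G u v"
  by (auto simp: subgraph_of_def adjacent_def)

lemma child_set_subgraph: "subgraph_of H G \<Longrightarrow> child_set H v \<subseteq> child_set G v"
  using adjacent_subgraph by (fastforce simp: child_set_def)

lemma finite_child_set_gw_tree [simp]: "finite (child_set (gw_tree \<xi>) v)"
  by (simp add: child_set_gw_tree)

lemma forest_subgraph_gw_tree: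
  assumes "subgraph_of H (gw_tree \<xi>)"
  shows "forest H"
proof
  show "simple_graph H"
    using assms by (simp add: subgraph_of_def)
  show "(\<exists>i. v = u @ [i]) \<or> (\<exists>i. u = v @ [i])" if "adjacent H u v" for u v
    using adjacent_subgraph[OF assms that] by (simp add: adjacent_gw_tree)
  show "finite (child_set H v)" for v
    by (rule finite_subset[OF child_set_subgraph[OF assms]]) simp
qed

lemma subgraph_gw_tree_refl: "subgraph_of (gw_tree \<xi>) (gw_tree \<xi>)"
  by (simp add: subgraph_of_def simple_graph_gw_tree)

lemma path_sum_gw_tree:
  assumes w: "\<And>v. v \<in> gw_verts \<xi> \<Longrightarrow> w v = \<omega> (subtree v \<xi>)"
  shows "v \<in> gw_verts \<xi> \<Longrightarrow> path_sum (child_set (gw_tree \<xi>)) w n v = branch_sum \<omega> n (subtree v \<xi>)"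
proof (induction n arbitrary: v)
  case (Suc n)
  then show ?case
    by (simp add: child_set_gw_tree sum.reindex inj_on_def gw_verts_snoc w)
qed simp

lemma path_sum_mono:
  assumes "\<And>v. ch v \<subseteq> ch' v" "\<And>v. finite (ch' v)"
  shows "path_sum ch (\<lambda>_. 1) n v \<le> path_sum ch' (\<lambda>_. 1) n v"
proof (induction n arbitrary: v)
  case (Suc n)
  have "(\<Sum>c\<in>ch v. path_sum ch (\<lambda>_. 1) n c) \<le> (\<Sum>c\<in>ch v. path_sum ch' (\<lambda>_. 1) n c)"
    by (intro sum_mono Suc)
  also have "\<dots> \<le> (\<Sum>c\<in>ch' v. path_sum ch' (\<lambda>_. 1) n c)"
    using assms by (intro sum_mono2) (auto intro: path_sum_nonneg)
  finally show ?case by simp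
qed simp

lemma almost_surely_given_infiniteI:
  assumes "AE \<xi> in offspring d. \<xi> \<in> tree_infinite \<longrightarrow> P (gw_tree \<xi>)"
  shows "almost_surely_given_infinite d P"
  unfolding almost_surely_given_infinite_def offspring_inf_def
  using assms tree_infinite_measurable by (intro AE_uniform_measureI) auto

text \<open>By monotonicity (1 + exp (- d exp (- d))) / 2 is at most its value 1 / \<open>d0\<close>
  at \<open>d0\<close>, hence below 1 / d. So the expected leaf-weighted path sums decay
  geometrically.\<close>

theorem WSM_below_d0:
  assumes d: "1 < d" "d < d0" and \<theta>: "0 < \<theta>"
  shows "almost_surely_given_infinite d (\<lambda>T. WSM \<theta> T)"
proof (rule almost_surely_given_infiniteI)
  let ?\<kappa> = "d * ((1 + exp (- (d * exp (- d)))) / 2)"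
  have "d0 > 1 \<and> (1 + exp (- (d0 * exp (- d0)))) / 2 = 1 / d0"
    unfolding d0_def by (rule theI') (rule d0_ex1)
  then have "(1 + exp (- (d * exp (- d)))) / 2 \<le> 1 / d0"
    using d0_lhs_mono[of d d0] d by simp
  also have "\<dots> < 1 / d"
    using d by (simp add: field_simps)
  finally have \<kappa>: "?\<kappa> < 1"
    using d by (simp add: field_simps)
  have \<kappa>0: "0 \<le> ?\<kappa>"
    using d by (intro mult_nonneg_nonneg) (auto intro: add_nonneg_nonneg)
  have w: "1 / 2 \<le> leaf_weight \<xi>" "0 \<le> leaf_weight \<xi>" for \<xi>
    by (auto simp: leaf_weight_def)
  have "AE \<xi> in offspring d. (\<lambda>n. 1 ^ n * branch_sum leaf_weight n \<xi>) \<longlonglongrightarrow> 0"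
    using d \<kappa> \<kappa>0 w by (intro AE_branch_sum_tendsto_0[OF _ _ nn_integral_branch_sum_leaf]) auto
  then show "AE \<xi> in offspring d. \<xi> \<in> tree_infinite \<longrightarrow> WSM \<theta> (gw_tree \<xi>)"
  proof eventually_elim
    case (elim \<xi>)
    interpret forest "gw_tree \<xi>"
      by (rule forest_subgraph_gw_tree[OF subgraph_gw_tree_refl])
    \<comment> \<open>Labels outside the tree have no children. Weight 1 there satisfies the first
      alternative of the leaf condition.\<close>
    define \<omega> where "\<omega> v = (if v \<in> gw_verts \<xi> then leaf_weight (subtree v \<xi>) else 1)" for v
    have \<omega>: "1 / 2 \<le> \<omega> v" for v
      using w by (simp add: \<omega>_def)
    have leaf: "1 \<le> \<omega> v \<or> (\<exists>c\<in>child_set (gw_tree \<xi>) v. child_set (gw_tree \<xi>) c = {})" for v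
    proof (cases "v \<in> gw_verts \<xi> \<and> (\<exists>i<\<xi> v. \<xi> (v @ [i]) = 0)")
      case True
      then obtain i where i: "i < \<xi> v" "\<xi> (v @ [i]) = 0" by auto
      have "v @ [i] \<in> child_set (gw_tree \<xi>) v" "child_set (gw_tree \<xi>) (v @ [i]) = {}"
        using True i by (auto simp: child_set_gw_tree)
      then show ?thesis by blast
    qed (auto simp: \<omega>_def leaf_weight_def subtree_def)
    have "WSM \<theta> (gw_tree \<xi>)"
    proof (rule WSM_of_ratio_decay[OF \<theta>])
      fix v assume "v \<in> verts (gw_tree \<xi>)"
      then have v: "v \<in> gw_verts \<xi>" by (simp add: gw_tree_def)
      have "(\<lambda>n. branch_sum leaf_weight n (subtree v \<xi>)) \<longlonglongrightarrow> 0"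
        using branch_sum_subtree_tendsto_0[of leaf_weight 1 \<xi> v] w v elim by simp
      then have "(\<lambda>n. 4 * \<theta> * branch_sum leaf_weight (Suc n) (subtree v \<xi>)) \<longlonglongrightarrow> 4 * \<theta> * 0"
        by (intro tendsto_mult tendsto_const LIMSEQ_Suc)
      then have lim: "(\<lambda>n. 4 * \<theta> * branch_sum leaf_weight (Suc n) (subtree v \<xi>)) \<longlonglongrightarrow> 0"
        by simp
      show "ratio_decay \<theta> (child_set (gw_tree \<xi>)) v"
      proof (rule ratio_decayI[OF lim, of \<theta> _ Suc])
        fix n and a b :: "nat list \<Rightarrow> real"
        assume "\<And>u. 0 \<le> a u" "\<And>u. a u \<le> \<theta>" "\<And>u. 0 \<le> b u" "\<And>u. b u \<le> \<theta>"
        then have "\<bar>ln (1 + ratio_iter \<theta> (child_set (gw_tree \<xi>)) b (Suc n) v) -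
            ln (1 + ratio_iter \<theta> (child_set (gw_tree \<xi>)) a (Suc n) v)\<bar> \<le>
            4 * \<theta> * path_sum (child_set (gw_tree \<xi>)) \<omega> (Suc n) v"
          using \<theta> \<omega> leaf by (intro ratio_iter_decay_leaf) auto
        also have "path_sum (child_set (gw_tree \<xi>)) \<omega> (Suc n) v = branch_sum leaf_weight (Suc n) (subtree v \<xi>)"
          using v by (intro path_sum_gw_tree) (auto simp: \<omega>_def)
        finally show "\<bar>ln (1 + ratio_iter \<theta> (child_set (gw_tree \<xi>)) b (Suc n) v) -
            ln (1 + ratio_iter \<theta> (child_set (gw_tree \<xi>)) a (Suc n) v)\<bar> \<le>
            4 * \<theta> * branch_sum leaf_weight (Suc n) (subtree v \<xi>)" .
      qed
    qed
    then show ?case ..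
  qed
qed

text \<open>The expected size of generation \<open>n\<close> is \<open>d ^ n\<close>. The almost
  sure bound is proved at the root and passes to every vertex by comparison of path sums.\<close>

lemma AE_growth:
  assumes "1 < d" "0 < a" "a * d < 1"
  shows "AE \<xi> in offspring d. \<forall>v\<in>gw_verts \<xi>. (\<lambda>n. a ^ n * branch_sum (\<lambda>_. 1) n (subtree v \<xi>)) \<longlonglongrightarrow> 0"
proof -
  have "AE \<xi> in offspring d. (\<lambda>n. a ^ n * branch_sum (\<lambda>_. 1) n \<xi>) \<longlonglongrightarrow> 0"
    using assms by (intro AE_branch_sum_tendsto_0[where \<kappa> = d]) (auto simp: nn_integral_branch_sum_one)
  then show ?thesis
  proof eventually_elim
    case (elim \<xi>)
    then show ?case
      using assms by (intro ballI branch_sum_subtree_tendsto_0) auto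
  qed
qed

text \<open>The bound for \<open>p\<^sub>v p\<^sub>c\<close> in terms of the ratio \<open>x\<close> at \<open>c\<close>, maximal at \<open>x = sqrt (1 + \<theta>)\<close>
  if this is at most \<open>\<theta>\<close>, and at \<open>x = \<theta>\<close> otherwise.\<close>

lemma two_step_contraction:
  assumes d: "1 < d" and \<theta>: "0 < \<theta>"
    and le: "\<theta> < (if d < sqrt (2 + sqrt 5) then 4 * d\<^sup>2 / (d\<^sup>2 - 1)\<^sup>2
              else (3 + sqrt (1 + 4 * d\<^sup>2)) / (2 * d\<^sup>2 - 4))"
  obtains K where "0 < K" "K * d\<^sup>2 < 1"
    "\<And>x. 0 \<le> x \<Longrightarrow> x \<le> \<theta> \<Longrightarrow> \<theta> / (1 + x + \<theta>) * (x / (1 + x)) \<le> K"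
proof (cases "d < sqrt (2 + sqrt 5)")
  case True
  \<comment> \<open>The maximiser of the bound over all \<open>x \<ge> 0\<close>; the maximum is
    \<open>(s - 1) / (s + 1)\<close>.\<close>
  define s where "s = sqrt (1 + \<theta>)"
  have s: "1 < s" "s\<^sup>2 = 1 + \<theta>"
    using \<theta> by (auto simp: s_def)
  have d2: "1 < d\<^sup>2"
    using d by simp
  \<comment> \<open>The assumption on \<theta> in terms of \<open>s\<close>: taking square roots
    gives \<open>(s - 1) / (s + 1) < 1 / d\<^sup>2\<close>.\<close>
  have "(s * (d\<^sup>2 - 1))\<^sup>2 < (d\<^sup>2 + 1)\<^sup>2"
  proof -
    have "\<theta> * (d\<^sup>2 - 1)\<^sup>2 < 4 * d\<^sup>2"
      using le True d2 by (simp add: field_simps)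
    then have "(1 + \<theta>) * (d\<^sup>2 - 1)\<^sup>2 < (d\<^sup>2 + 1)\<^sup>2"
      by (simp add: power2_eq_square algebra_simps)
    then show ?thesis
      using s by (simp add: power_mult_distrib)
  qed
  then have "s * (d\<^sup>2 - 1) < d\<^sup>2 + 1"
    using d2 by (intro power_less_imp_less_base[of "s * (d\<^sup>2 - 1)" 2 "d\<^sup>2 + 1"]) auto
  then have lt: "(s - 1) / (s + 1) * d\<^sup>2 < 1"
    using s by (simp add: field_simps)
  show thesis
  proof (rule that[OF _ lt])
    show "0 < (s - 1) / (s + 1)" using s by simp
    fix x assume x: "0 \<le> x" "x \<le> \<theta>"
    \<comment> \<open>The perfect square confirms that \<open>x = s\<close> is the
      maximiser.\<close>
    have "(s - 1) * ((1 + x + \<theta>) * (1 + x)) - (s + 1) * (\<theta> * x) = (s - 1) * (s - x)\<^sup>2"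
    proof -
      have \<theta>_eq: "\<theta> = s * s - 1"
        using s by (simp add: power2_eq_square)
      show ?thesis
        unfolding \<theta>_eq by (simp add: power2_eq_square algebra_simps)
    qed
    also have "\<dots> \<ge> 0" using s by simp
    finally have "(s + 1) * (\<theta> * x) \<le> (s - 1) * ((1 + x + \<theta>) * (1 + x))" by simp
    then show "\<theta> / (1 + x + \<theta>) * (x / (1 + x)) \<le> (s - 1) / (s + 1)"
      using s x \<theta> by (simp add: frac_le_eq divide_simps mult_ac)
  qed
next
  case False
  have s5: "sqrt 5 * sqrt 5 = 5" "0 \<le> sqrt 5"
    by (simp_all)
  have "sqrt (2 + sqrt 5) \<le> d" using False by simp
  then have d2: "2 + sqrt 5 \<le> d\<^sup>2"
    using power_mono[of "sqrt (2 + sqrt 5)" d 2] s5 by simp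
  have s5': "2 < sqrt 5"
    by (rule real_less_rsqrt) simp
  define q where "q = sqrt (1 + 4 * d\<^sup>2)"
  have q: "0 < q" "q * q = 1 + 4 * d\<^sup>2"
    using d2 s5' by (auto simp: q_def)
  have lt: "\<theta> * (2 * d\<^sup>2 - 4) < 3 + q"
    using le False d2 s5' by (simp add: q_def field_simps)
  text \<open>The polynomial \<open>(d\<^sup>2 - 2) x\<^sup>2 - 3 x - 1\<close> has the roots \<open>(3 \<plusminus> q) / (2 d\<^sup>2 - 4)\<close>.\<close>
  have neg: "(d\<^sup>2 - 2) * \<theta> * \<theta> - 3 * \<theta> - 1 < 0"
  proof -
    have "3 < q"
    proof (rule power_less_imp_less_base[of 3 2])
      show "3\<^sup>2 < q\<^sup>2" using q d2 s5' by (simp add: power2_eq_square)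
    qed (use q in auto)
    moreover have "0 < \<theta> * (2 * d\<^sup>2 - 4)"
      using \<theta> d2 s5' by (intro mult_pos_pos) auto
    ultimately have "0 < \<theta> * (2 * d\<^sup>2 - 4) - 3 + q"
      by linarith
    then have "(\<theta> * (2 * d\<^sup>2 - 4) - 3 + q) * (\<theta> * (2 * d\<^sup>2 - 4) - 3 - q) < 0"
      using lt by (intro mult_pos_neg) auto
    also have "(\<theta> * (2 * d\<^sup>2 - 4) - 3 + q) * (\<theta> * (2 * d\<^sup>2 - 4) - 3 - q) =
        4 * (d\<^sup>2 - 2) * ((d\<^sup>2 - 2) * \<theta> * \<theta> - 3 * \<theta> - 1)"
    proof -
      have "(\<theta> * (2 * d\<^sup>2 - 4) - 3 + q) * (\<theta> * (2 * d\<^sup>2 - 4) - 3 - q) = (\<theta> * (2 * d\<^sup>2 - 4) - 3)\<^sup>2 - q * q"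
        by (simp add: power2_eq_square algebra_simps)
      then show ?thesis
        unfolding q(2) by (simp add: power2_eq_square algebra_simps)
    qed
    finally show ?thesis
      using d2 s5' by (simp add: mult_less_0_iff)
  qed
  have phi: "\<theta> \<le> (1 + sqrt 5) / 2"
  proof (rule ccontr)
    assume "\<not> ?thesis"
    then have "(1 + sqrt 5) / 2 < \<theta>" by simp
    then have "0 < (\<theta> - (1 + sqrt 5) / 2) * (sqrt 5 * \<theta> + (sqrt 5 - 1) / 2)"
      using s5' \<theta> by (intro mult_pos_pos) (auto intro: add_pos_pos)
    also have "\<dots> = sqrt 5 * \<theta> * \<theta> - 3 * \<theta> - 1"
      using s5 by (simp add: algebra_simps) (simp add: field_simps)
    also have "\<dots> \<le> (d\<^sup>2 - 2) * \<theta> * \<theta> - 3 * \<theta> - 1"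
      using d2 \<theta> by (intro diff_right_mono mult_right_mono) auto
    finally show False using neg by simp
  qed
  \<comment> \<open>This says that \<theta> does not exceed the maximiser
    \<open>sqrt (1 + \<theta>)\<close>, so on [0, \<theta>] the bound is largest at the right
    end.\<close>
  have golden: "\<theta> * \<theta> \<le> 1 + \<theta>"
  proof -
    have "(\<theta> - (1 + sqrt 5) / 2) * (\<theta> - (1 - sqrt 5) / 2) \<le> 0"
      using phi \<theta> s5' by (intro mult_nonpos_nonneg) auto
    moreover have "(\<theta> - (1 + sqrt 5) / 2) * (\<theta> - (1 - sqrt 5) / 2) = \<theta> * \<theta> - \<theta> - 1"
      using s5 by (simp add: field_simps)
    ultimately show ?thesis by simp
  qed
  let ?K = "\<theta> / (1 + \<theta> + \<theta>) * (\<theta> / (1 + \<theta>))"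
  show thesis
  proof (rule that[of ?K])
    show "0 < ?K" using \<theta> by (intro mult_pos_pos divide_pos_pos) auto
    have "\<theta> * \<theta> * d\<^sup>2 < (1 + \<theta> + \<theta>) * (1 + \<theta>)"
      using neg by (simp add: algebra_simps)
    then show "?K * d\<^sup>2 < 1"
      using \<theta> by (simp add: divide_less_eq)
    fix x assume x: "0 \<le> x" "x \<le> \<theta>"
    have "0 \<le> \<theta> * (\<theta> - x) * (1 + \<theta> - \<theta> * x)"
    proof (intro mult_nonneg_nonneg)
      have "\<theta> * x \<le> \<theta> * \<theta>" using x \<theta> by (intro mult_left_mono) auto
      with golden show "0 \<le> 1 + \<theta> - \<theta> * x" by simp
    qed (use x \<theta> in auto)
    also have "\<dots> = (\<theta> * \<theta>) * ((1 + x + \<theta>) * (1 + x)) - (\<theta> * x) * ((1 + \<theta> + \<theta>) * (1 + \<theta>))"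
      by (simp add: algebra_simps)
    finally have "(\<theta> * x) * ((1 + \<theta> + \<theta>) * (1 + \<theta>)) \<le> (\<theta> * \<theta>) * ((1 + x + \<theta>) * (1 + x))"
      by simp
    then have "\<theta> * x / ((1 + x + \<theta>) * (1 + x)) \<le> \<theta> * \<theta> / ((1 + \<theta> + \<theta>) * (1 + \<theta>))"
      using x \<theta> by (intro frac_le_eq[THEN iffD2]) (auto simp: divide_nonpos_pos add_pos_pos)
    then show "\<theta> / (1 + x + \<theta>) * (x / (1 + x)) \<le> ?K"
      by simp
  qed
qed

text \<open>A factor \<open>K\<close> per two generations is \<open>sqrt K\<close> per generation,
  which beats the growth rate \<open>d\<close>. The almost sure event concerns path counts in the
  whole tree; these dominate the counts in every subgraph, so all subgraphs are treated at
  once.\<close>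

theorem SSM_of_two_step_contraction:
  assumes d: "1 < d" and \<theta>: "0 < \<theta>" and K: "0 < K" "K * d\<^sup>2 < 1"
    "\<And>x. 0 \<le> x \<Longrightarrow> x \<le> \<theta> \<Longrightarrow> \<theta> / (1 + x + \<theta>) * (x / (1 + x)) \<le> K"
  shows "almost_surely_given_infinite d (\<lambda>T. SSM \<theta> T)"
proof (rule almost_surely_given_infiniteI)
  have "(sqrt K * d)\<^sup>2 < 1\<^sup>2"
    using K by (simp add: power_mult_distrib)
  then have "sqrt K * d < 1"
    by (rule power_less_imp_less_base) simp
  then have "AE \<xi> in offspring d. \<forall>v\<in>gw_verts \<xi>.
      (\<lambda>n. sqrt K ^ n * branch_sum (\<lambda>_. 1) n (subtree v \<xi>)) \<longlonglongrightarrow> 0"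
    using d K by (intro AE_growth) auto
  then show "AE \<xi> in offspring d. \<xi> \<in> tree_infinite \<longrightarrow> SSM \<theta> (gw_tree \<xi>)"
  proof eventually_elim
    case (elim \<xi>)
    have "WSM \<theta> H" if H: "subgraph_of H (gw_tree \<xi>)" for H
    proof -
      interpret forest H
        by (rule forest_subgraph_gw_tree[OF H])
      show ?thesis
      proof (rule WSM_of_ratio_decay[OF \<theta>])
        fix v assume "v \<in> verts H"
        then have v: "v \<in> gw_verts \<xi>"
          using H by (auto simp: subgraph_of_def gw_tree_def)
        let ?f = "\<lambda>n. sqrt K ^ n * branch_sum (\<lambda>_. 1) n (subtree v \<xi>)"
        have "(\<lambda>n. 2 * \<theta> * ?f (2 * n)) \<longlonglongrightarrow> 2 * \<theta> * 0"
          using elim v by (intro tendsto_mult tendsto_const LIMSEQ_subseq_LIMSEQ[of ?f 0 "\<lambda>n. 2 * n", unfolded o_def])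
            (auto simp: strict_mono_def)
        then have lim: "(\<lambda>n. 2 * \<theta> * ?f (2 * n)) \<longlonglongrightarrow> 0" by simp
        show "ratio_decay \<theta> (child_set H) v"
        proof (rule ratio_decayI[OF lim, of \<theta> _ "\<lambda>n. 2 * n"])
          fix n and a b :: "nat list \<Rightarrow> real"
          assume ab: "\<And>u. 0 \<le> a u" "\<And>u. a u \<le> \<theta>" "\<And>u. 0 \<le> b u" "\<And>u. b u \<le> \<theta>"
          have "\<bar>ln (1 + ratio_iter \<theta> (child_set H) b (2 * n) v) - ln (1 + ratio_iter \<theta> (child_set H) a (2 * n) v)\<bar> \<le>
              2 * \<theta> * (K ^ n * path_sum (child_set H) (\<lambda>_. 1) (2 * n) v)"
            by (rule ratio_iter_decay_two_step) (use ab \<theta> K(3) in auto)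
          also have "path_sum (child_set H) (\<lambda>_. 1) (2 * n) v \<le> path_sum (child_set (gw_tree \<xi>)) (\<lambda>_. 1) (2 * n) v"
            by (intro path_sum_mono child_set_subgraph[OF H]) simp
          also have "path_sum (child_set (gw_tree \<xi>)) (\<lambda>_. 1) (2 * n) v = branch_sum (\<lambda>_. 1) (2 * n) (subtree v \<xi>)"
            using v by (intro path_sum_gw_tree) auto
          also have "K ^ n = sqrt K ^ (2 * n)"
            using K by (simp add: power_mult)
          finally show "\<bar>ln (1 + ratio_iter \<theta> (child_set H) b (2 * n) v) - ln (1 + ratio_iter \<theta> (child_set H) a (2 * n) v)\<bar> \<le>
              2 * \<theta> * ?f (2 * n)"
            using K \<theta> by (simp add: mult_left_mono)
        qed
      qed
    qed
    then show ?case
      by (simp add: SSM_def)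
  qed
qed

text \<open>The contraction \<theta> / e of the squared derivatives beats the growth rate
  \<open>d\<close>. The square root returns to the logarithms themselves.\<close>

theorem WSM_below_e:
  assumes d: "1 < d" and \<theta>: "0 < \<theta>" "\<theta> < exp 1 / d"
  shows "almost_surely_given_infinite d (\<lambda>T. WSM \<theta> T)"
proof (rule almost_surely_given_infiniteI)
  have "\<theta> / exp 1 * d < 1"
    using d \<theta> by (simp add: field_simps)
  then have "AE \<xi> in offspring d. \<forall>v\<in>gw_verts \<xi>.
      (\<lambda>n. (\<theta> / exp 1) ^ n * branch_sum (\<lambda>_. 1) n (subtree v \<xi>)) \<longlonglongrightarrow> 0"
    using d \<theta> by (intro AE_growth) auto
  then show "AE \<xi> in offspring d. \<xi> \<in> tree_infinite \<longrightarrow> WSM \<theta> (gw_tree \<xi>)"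
  proof eventually_elim
    case (elim \<xi>)
    interpret forest "gw_tree \<xi>"
      by (rule forest_subgraph_gw_tree[OF subgraph_gw_tree_refl])
    have "WSM \<theta> (gw_tree \<xi>)"
    proof (rule WSM_of_ratio_decay[OF \<theta>(1)])
      fix v assume "v \<in> verts (gw_tree \<xi>)"
      then have v: "v \<in> gw_verts \<xi>" by (simp add: gw_tree_def)
      let ?f = "\<lambda>n. (\<theta> / exp 1) ^ n * branch_sum (\<lambda>_. 1) n (subtree v \<xi>)"
      have "(\<lambda>n. sqrt (4 * \<theta> * ?f n)) \<longlonglongrightarrow> sqrt (4 * \<theta> * 0)"
        using elim v by (intro tendsto_real_sqrt tendsto_mult tendsto_const) auto
      then have lim: "(\<lambda>n. sqrt (4 * \<theta> * ?f n)) \<longlonglongrightarrow> 0" by simp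
      show "ratio_decay \<theta> (child_set (gw_tree \<xi>)) v"
      proof (rule ratio_decayI[OF lim, of \<theta> _ "\<lambda>n. n"])
        fix n and a b :: "nat list \<Rightarrow> real"
        assume ab: "\<And>u. 0 \<le> a u" "\<And>u. a u \<le> \<theta>" "\<And>u. 0 \<le> b u" "\<And>u. b u \<le> \<theta>"
        have "(ln (1 + ratio_iter \<theta> (child_set (gw_tree \<xi>)) b n v) - ln (1 + ratio_iter \<theta> (child_set (gw_tree \<xi>)) a n v))\<^sup>2 \<le>
            4 * \<theta> * ((\<theta> / exp 1) ^ n * path_sum (child_set (gw_tree \<xi>)) (\<lambda>_. 1) n v)"
          by (rule ratio_iter_decay_cauchy_schwarz) (use ab \<theta> in auto)
        also have "path_sum (child_set (gw_tree \<xi>)) (\<lambda>_. 1) n v = branch_sum (\<lambda>_. 1) n (subtree v \<xi>)"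
          using v by (intro path_sum_gw_tree) auto
        finally show "\<bar>ln (1 + ratio_iter \<theta> (child_set (gw_tree \<xi>)) b n v) -
            ln (1 + ratio_iter \<theta> (child_set (gw_tree \<xi>)) a n v)\<bar> \<le> sqrt (4 * \<theta> * ?f n)"
          by (intro real_le_rsqrt) simp
      qed
    qed
    then show ?case ..
  qed
qed

section \<open>Expected ratios and non-uniqueness\<close>

fun cut_ratio :: "real \<Rightarrow> nat \<Rightarrow> (nat list \<Rightarrow> nat) \<Rightarrow> real" where
  "cut_ratio \<theta> 0 \<xi> = \<theta>"
| "cut_ratio \<theta> (Suc n) \<xi> = \<theta> * (\<Prod>i<\<xi> []. 1 / (1 + cut_ratio \<theta> n (subtree [i] \<xi>)))"

text \<open>The recursion reverses order and starts from the largest value \<theta>, so the odds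
  truncated at even depths decrease and those truncated at odd depths increase. Both limits
  therefore exist.\<close>

definition upper_ratio :: "real \<Rightarrow> (nat list \<Rightarrow> nat) \<Rightarrow> real" where
  "upper_ratio \<theta> \<xi> = lim (\<lambda>k. cut_ratio \<theta> (2 * k) \<xi>)"

definition lower_ratio :: "real \<Rightarrow> (nat list \<Rightarrow> nat) \<Rightarrow> real" where
  "lower_ratio \<theta> \<xi> = lim (\<lambda>k. cut_ratio \<theta> (Suc (2 * k)) \<xi>)"

lemma prod_inverse_one_plus_antimono:
  fixes f g :: "'a \<Rightarrow> real"
  assumes "\<And>i. i \<in> A \<Longrightarrow> 0 \<le> f i" "\<And>i. i \<in> A \<Longrightarrow> f i \<le> g i"
  shows "(\<Prod>i\<in>A. 1 / (1 + g i)) \<le> (\<Prod>i\<in>A. 1 / (1 + f i))"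
proof (intro prod_mono conjI)
  fix i assume "i \<in> A"
  then have "0 \<le> f i" "f i \<le> g i" using assms by auto
  then show "0 \<le> 1 / (1 + g i)" "1 / (1 + g i) \<le> 1 / (1 + f i)"
    by (auto intro!: divide_left_mono mult_pos_pos)
qed

context
  fixes \<theta> :: real
  assumes \<theta>: "0 < \<theta>"
begin

section \<open>Monotonicity and limits of the truncated odds\<close>

lemma cut_ratio_nonneg: "0 \<le> cut_ratio \<theta> n \<xi>"
  by (induction n arbitrary: \<xi>) (use \<theta> in \<open>auto intro!: mult_nonneg_nonneg prod_nonneg\<close>)

lemma cut_ratio_le: "cut_ratio \<theta> n \<xi> \<le> \<theta>"
proof (cases n)
  case (Suc m)
  have "(\<Prod>i<\<xi> []. 1 / (1 + cut_ratio \<theta> m (subtree [i] \<xi>))) \<le> 1"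
    using cut_ratio_nonneg by (intro prod_inverse_one_plus_le)
  then show ?thesis
    using Suc \<theta> by (simp add: mult_left_le)
qed simp

lemma cut_ratio_antimono_step:
  assumes "\<And>\<xi>. cut_ratio \<theta> n \<xi> \<le> cut_ratio \<theta> m \<xi>"
  shows "cut_ratio \<theta> (Suc m) \<xi> \<le> cut_ratio \<theta> (Suc n) \<xi>"
  using \<theta> by (auto intro!: mult_left_mono prod_inverse_one_plus_antimono cut_ratio_nonneg assms)

lemma cut_ratio_even_Suc: "cut_ratio \<theta> (Suc (Suc (2 * k))) \<xi> \<le> cut_ratio \<theta> (2 * k) \<xi>"
proof (induction k arbitrary: \<xi>)
  case 0
  show ?case using cut_ratio_le[of "Suc (Suc (2 * 0))" \<xi>] by simp
next
  case (Suc k)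
  have "cut_ratio \<theta> (Suc (Suc (Suc (Suc (2 * k))))) \<xi> \<le> cut_ratio \<theta> (Suc (Suc (2 * k))) \<xi>"
    by (intro cut_ratio_antimono_step Suc)
  then show ?case by (simp del: cut_ratio.simps)
qed

lemma cut_ratio_odd_Suc: "cut_ratio \<theta> (Suc (2 * k)) \<xi> \<le> cut_ratio \<theta> (Suc (Suc (Suc (2 * k)))) \<xi>"
  by (intro cut_ratio_antimono_step cut_ratio_even_Suc)

lemma cut_ratio_odd_le_even: "cut_ratio \<theta> (Suc (2 * k)) \<xi> \<le> cut_ratio \<theta> (2 * k) \<xi>"
proof (induction k arbitrary: \<xi>)
  case 0
  show ?case using cut_ratio_le[of "Suc (2 * 0)" \<xi>] by simp
next
  case (Suc k)
  have "cut_ratio \<theta> (Suc (Suc (Suc (2 * k)))) \<xi> \<le> cut_ratio \<theta> (Suc (Suc (2 * k))) \<xi>"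
    by (intro cut_ratio_antimono_step Suc)
  then show ?case by (simp del: cut_ratio.simps)
qed

lemma upper_ratio_LIMSEQ: "(\<lambda>k. cut_ratio \<theta> (2 * k) \<xi>) \<longlonglongrightarrow> upper_ratio \<theta> \<xi>"
proof -
  have "decseq (\<lambda>k. cut_ratio \<theta> (2 * k) \<xi>)"
    using cut_ratio_even_Suc by (intro decseq_SucI) (simp del: cut_ratio.simps)
  then have "convergent (\<lambda>k. cut_ratio \<theta> (2 * k) \<xi>)"
    by (rule decseq_convergent[of _ 0]) (use cut_ratio_nonneg in \<open>auto intro: convergentI\<close>)
  then show ?thesis
    by (simp add: upper_ratio_def convergent_LIMSEQ_iff)
qed

lemma lower_ratio_LIMSEQ: "(\<lambda>k. cut_ratio \<theta> (Suc (2 * k)) \<xi>) \<longlonglongrightarrow> lower_ratio \<theta> \<xi>"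
proof -
  have "incseq (\<lambda>k. cut_ratio \<theta> (Suc (2 * k)) \<xi>)"
    using cut_ratio_odd_Suc by (intro incseq_SucI) (simp del: cut_ratio.simps)
  then have "convergent (\<lambda>k. cut_ratio \<theta> (Suc (2 * k)) \<xi>)"
    by (rule incseq_convergent[of _ \<theta>]) (use cut_ratio_le in \<open>auto intro: convergentI simp del: cut_ratio.simps\<close>)
  then show ?thesis
    by (simp add: lower_ratio_def convergent_LIMSEQ_iff)
qed

lemma lower_le_upper_ratio: "lower_ratio \<theta> \<xi> \<le> upper_ratio \<theta> \<xi>"
  by (rule LIMSEQ_le[OF lower_ratio_LIMSEQ upper_ratio_LIMSEQ]) (use cut_ratio_odd_le_even in blast)

lemma lower_ratio_nonneg: "0 \<le> lower_ratio \<theta> \<xi>"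
  by (rule LIMSEQ_le_const[OF lower_ratio_LIMSEQ]) (use cut_ratio_nonneg in blast)

lemma upper_ratio_rec: "upper_ratio \<theta> \<xi> = \<theta> * (\<Prod>i<\<xi> []. 1 / (1 + lower_ratio \<theta> (subtree [i] \<xi>)))"
proof (rule LIMSEQ_unique)
  show "(\<lambda>k. cut_ratio \<theta> (2 * Suc k) \<xi>) \<longlonglongrightarrow> upper_ratio \<theta> \<xi>"
    using upper_ratio_LIMSEQ by (rule LIMSEQ_Suc)
  have "1 + lower_ratio \<theta> \<xi> \<noteq> 0" for \<xi>
    using lower_ratio_nonneg[of \<xi>] by simp
  then have "(\<lambda>k. \<theta> * (\<Prod>i<\<xi> []. 1 / (1 + cut_ratio \<theta> (Suc (2 * k)) (subtree [i] \<xi>)))) \<longlonglongrightarrow>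
      \<theta> * (\<Prod>i<\<xi> []. 1 / (1 + lower_ratio \<theta> (subtree [i] \<xi>)))"
    by (intro tendsto_intros lower_ratio_LIMSEQ)
  then show "(\<lambda>k. cut_ratio \<theta> (2 * Suc k) \<xi>) \<longlonglongrightarrow> \<theta> * (\<Prod>i<\<xi> []. 1 / (1 + lower_ratio \<theta> (subtree [i] \<xi>)))"
    by simp
qed

lemma lower_ratio_rec: "lower_ratio \<theta> \<xi> = \<theta> * (\<Prod>i<\<xi> []. 1 / (1 + upper_ratio \<theta> (subtree [i] \<xi>)))"
proof (rule LIMSEQ_unique[OF lower_ratio_LIMSEQ])
  have "1 + upper_ratio \<theta> \<xi> \<noteq> 0" for \<xi>
    using lower_ratio_nonneg[of \<xi>] lower_le_upper_ratio[of \<xi>] by simp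
  then have "(\<lambda>k. \<theta> * (\<Prod>i<\<xi> []. 1 / (1 + cut_ratio \<theta> (2 * k) (subtree [i] \<xi>)))) \<longlonglongrightarrow>
      \<theta> * (\<Prod>i<\<xi> []. 1 / (1 + upper_ratio \<theta> (subtree [i] \<xi>)))"
    by (intro tendsto_intros upper_ratio_LIMSEQ)
  then show "(\<lambda>k. cut_ratio \<theta> (Suc (2 * k)) \<xi>) \<longlonglongrightarrow> \<theta> * (\<Prod>i<\<xi> []. 1 / (1 + upper_ratio \<theta> (subtree [i] \<xi>)))"
    by simp
qed

text \<open>Each limit at the root is the same strictly decreasing function of the other limits at
  the children. As upper dominates lower at all children, a single strict inequality cannot be
  compensated.\<close>

lemma ratios_agree_iff:
  "upper_ratio \<theta> \<xi> = lower_ratio \<theta> \<xi> \<longleftrightarrow>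
    (\<forall>i<\<xi> []. upper_ratio \<theta> (subtree [i] \<xi>) = lower_ratio \<theta> (subtree [i] \<xi>))"
proof
  show "upper_ratio \<theta> \<xi> = lower_ratio \<theta> \<xi>"
    if "\<forall>i<\<xi> []. upper_ratio \<theta> (subtree [i] \<xi>) = lower_ratio \<theta> (subtree [i] \<xi>)"
    using that by (subst upper_ratio_rec, subst lower_ratio_rec) simp
next
  assume eq: "upper_ratio \<theta> \<xi> = lower_ratio \<theta> \<xi>"
  show "\<forall>i<\<xi> []. upper_ratio \<theta> (subtree [i] \<xi>) = lower_ratio \<theta> (subtree [i] \<xi>)"
  proof (rule ccontr)
    let ?l = "\<lambda>i. lower_ratio \<theta> (subtree [i] \<xi>)" and ?u = "\<lambda>i. upper_ratio \<theta> (subtree [i] \<xi>)"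
    assume "\<not> ?thesis"
    then obtain i where i: "i < \<xi> []" "?u i \<noteq> ?l i" by auto
    have lu: "0 \<le> ?l j" "?l j \<le> ?u j" for j
      by (rule lower_ratio_nonneg lower_le_upper_ratio)+
    have pos: "0 < (\<Prod>j\<in>{..<\<xi> []} - {i}. 1 / (1 + ?u j))"
      using lu by (intro prod_pos) (auto intro!: add_pos_nonneg order_trans[OF lu(1) lu(2)])
    have "(\<Prod>j<\<xi> []. 1 / (1 + ?u j)) = 1 / (1 + ?u i) * (\<Prod>j\<in>{..<\<xi> []} - {i}. 1 / (1 + ?u j))"
      using i by (intro prod.remove) auto
    also have "\<dots> < 1 / (1 + ?l i) * (\<Prod>j\<in>{..<\<xi> []} - {i}. 1 / (1 + ?u j))"
      using i lu[of i] pos by (intro mult_strict_right_mono) (auto simp: frac_less2)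
    also have "\<dots> \<le> 1 / (1 + ?l i) * (\<Prod>j\<in>{..<\<xi> []} - {i}. 1 / (1 + ?l j))"
      using lu by (intro mult_left_mono prod_inverse_one_plus_antimono) auto
    also have "\<dots> = (\<Prod>j<\<xi> []. 1 / (1 + ?l j))"
      using i by (intro prod.remove[symmetric]) auto
    finally have "lower_ratio \<theta> \<xi> < upper_ratio \<theta> \<xi>"
      using \<theta> by (simp add: upper_ratio_rec[of \<xi>] lower_ratio_rec[of \<xi>])
    with eq show False by simp
  qed
qed

lemma measurable_cut_ratio [measurable]: "cut_ratio \<theta> n \<in> borel_measurable (offspring d)"
proof (induction n)
  case (Suc n)
  note [measurable] = this
  have [measurable]: "(\<lambda>\<xi>. \<Prod>i<\<xi> []. 1 / (1 + cut_ratio \<theta> n (subtree [i] \<xi>))) \<in> borel_measurable (offspring d)"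
    by (rule measurable_branching) measurable
  show ?case
    unfolding cut_ratio.simps[abs_def] by measurable
qed simp

lemma measurable_upper_ratio [measurable]: "upper_ratio \<theta> \<in> borel_measurable (offspring d)"
  by (rule borel_measurable_LIMSEQ_real[OF upper_ratio_LIMSEQ]) measurable

lemma measurable_lower_ratio [measurable]: "lower_ratio \<theta> \<in> borel_measurable (offspring d)"
  by (rule borel_measurable_LIMSEQ_real[OF lower_ratio_LIMSEQ]) measurable

text \<open>The generating functional at g = 1 / (1 + F) gives the next expectation as \<theta> exp
  (- d E (1 - g)), and 1 - g = F / (1 + F) lies between F / (1 + \<theta>) and F.\<close>

lemma expectation_cut_ratio_Suc:
  assumes d: "0 < d"
  defines "E \<equiv> \<lambda>n. (\<integral>\<xi>. cut_ratio \<theta> n \<xi> \<partial>offspring d)"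
  shows "\<theta> * exp (- (d * E n)) \<le> E (Suc n)" "E (Suc n) \<le> \<theta> * exp (- (d * E n / (1 + \<theta>)))"
proof -
  interpret prob_space "offspring d" by (rule prob_space_offspring)
  let ?F = "cut_ratio \<theta> n"
  define g where "g \<xi> = 1 / (1 + ?F \<xi>)" for \<xi>
  have F: "0 \<le> ?F \<xi>" "?F \<xi> \<le> \<theta>" for \<xi>
    by (rule cut_ratio_nonneg cut_ratio_le)+
  have g: "0 \<le> g \<xi>" "g \<xi> \<le> 1" for \<xi>
    using F[of \<xi>] by (auto simp: g_def divide_le_eq_1)
  have g_bounds: "1 - ?F \<xi> \<le> g \<xi>" "g \<xi> \<le> 1 - ?F \<xi> / (1 + \<theta>)" for \<xi>
  proof -
    have "1 - g \<xi> = ?F \<xi> / (1 + ?F \<xi>)"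
      using F(1)[of \<xi>] by (simp add: g_def field_simps)
    moreover have "?F \<xi> / (1 + ?F \<xi>) \<le> ?F \<xi>"
      using F(1)[of \<xi>] by (simp add: pos_divide_le_eq algebra_simps)
    moreover have "?F \<xi> / (1 + \<theta>) \<le> ?F \<xi> / (1 + ?F \<xi>)"
      using F[of \<xi>] \<theta> by (auto intro!: divide_left_mono mult_pos_pos)
    ultimately show "1 - ?F \<xi> \<le> g \<xi>" "g \<xi> \<le> 1 - ?F \<xi> / (1 + \<theta>)"
      by auto
  qed
  have [measurable]: "g \<in> borel_measurable (offspring d)"
    unfolding g_def[abs_def] by measurable
  have intF: "integrable (offspring d) ?F"
    using F by (intro integrable_const_bound[of _ \<theta>]) auto
  have intg: "integrable (offspring d) g"
    using g by (intro integrable_const_bound[of _ 1]) auto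
  define G where "G = (\<integral>\<xi>. g \<xi> \<partial>offspring d)"
  have G0: "0 \<le> G"
    unfolding G_def using g by (intro Bochner_Integration.integral_nonneg) auto
  have "(\<integral>\<^sup>+\<xi>. ennreal (g \<xi>) \<partial>offspring d) = ennreal G"
    unfolding G_def using intg g by (intro nn_integral_eq_integral) auto
  then have *: "(\<integral>\<^sup>+\<xi>. (\<Prod>j<\<xi> []. ennreal (g (subtree [j] \<xi>))) \<partial>offspring d) = ennreal (exp (d * (G - 1)))"
    using d G0 by (intro nn_integral_prod_subtrees) auto
  have "E (Suc n) = enn2real (\<integral>\<^sup>+\<xi>. ennreal (cut_ratio \<theta> (Suc n) \<xi>) \<partial>offspring d)"
    unfolding E_def by (intro integral_eq_nn_integral) (auto simp: cut_ratio_nonneg simp del: cut_ratio.simps)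
  also have "(\<integral>\<^sup>+\<xi>. ennreal (cut_ratio \<theta> (Suc n) \<xi>) \<partial>offspring d) =
      (\<integral>\<^sup>+\<xi>. ennreal \<theta> * (\<Prod>j<\<xi> []. ennreal (g (subtree [j] \<xi>))) \<partial>offspring d)"
    using \<theta> g by (simp add: ennreal_mult' prod_ennreal g_def)
  also have "\<dots> = ennreal \<theta> * ennreal (exp (d * (G - 1)))"
  proof -
    have [measurable]: "(\<lambda>\<xi>. \<Prod>j<\<xi> []. ennreal (g (subtree [j] \<xi>))) \<in> borel_measurable (offspring d)"
      by (rule measurable_branching) measurable
    show ?thesis
      by (subst nn_integral_cmult) (auto simp: *)
  qed
  finally have E_Suc: "E (Suc n) = \<theta> * exp (d * (G - 1))"
    using \<theta> by (simp add: ennreal_mult[symmetric])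
  have "1 - E n = (\<integral>\<xi>. 1 - ?F \<xi> \<partial>offspring d)"
    unfolding E_def using intF by (simp add: prob_space[simplified])
  also have "\<dots> \<le> G"
    unfolding G_def using intF intg g_bounds by (intro Bochner_Integration.integral_mono) auto
  finally have "- (d * E n) \<le> d * (G - 1)"
    using d mult_left_mono[of "1 - E n" G d] by (simp add: algebra_simps)
  then show "\<theta> * exp (- (d * E n)) \<le> E (Suc n)"
    unfolding E_Suc using \<theta> by simp
  have "G \<le> (\<integral>\<xi>. 1 - ?F \<xi> / (1 + \<theta>) \<partial>offspring d)"
    unfolding G_def using intF intg g_bounds by (intro Bochner_Integration.integral_mono) auto
  also have "\<dots> = 1 - E n / (1 + \<theta>)"
    unfolding E_def using intF by (simp add: prob_space[simplified])
  finally have "d * (G - 1) \<le> - (d * E n / (1 + \<theta>))"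
    using d mult_left_mono[of G "1 - E n / (1 + \<theta>)" d] by (simp add: algebra_simps)
  then show "E (Suc n) \<le> \<theta> * exp (- (d * E n / (1 + \<theta>)))"
    unfolding E_Suc using \<theta> by simp
qed

text \<open>A two-cycle of the expectations keeps the expected limits apart.\<close>

lemma not_AE_ratios_agree:
  assumes d: "0 < d" and ab: "0 < a" "a < b" "b \<le> d * \<theta>"
    and up: "b \<le> d * \<theta> * exp (- a)" and down: "d * \<theta> * exp (- (b / (1 + \<theta>))) \<le> a"
  shows "\<not> (AE \<xi> in offspring d. upper_ratio \<theta> \<xi> = lower_ratio \<theta> \<xi>)"
proof
  assume AE: "AE \<xi> in offspring d. upper_ratio \<theta> \<xi> = lower_ratio \<theta> \<xi>"
  interpret prob_space "offspring d" by (rule prob_space_offspring)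
  define E where "E n = (\<integral>\<xi>. cut_ratio \<theta> n \<xi> \<partial>offspring d)" for n
  have down_step: "d * E (Suc n) \<le> a" if "b \<le> d * E n" for n
  proof -
    have "d * E (Suc n) \<le> d * (\<theta> * exp (- (d * E n / (1 + \<theta>))))"
      unfolding E_def using d by (intro mult_left_mono expectation_cut_ratio_Suc) auto
    also have "\<dots> \<le> d * (\<theta> * exp (- (b / (1 + \<theta>))))"
      using d \<theta> that by (intro mult_left_mono) (auto intro: divide_right_mono)
    finally show ?thesis using down by simp
  qed
  have up_step: "b \<le> d * E (Suc n)" if "d * E n \<le> a" for n
  proof -
    have "d * (\<theta> * exp (- a)) \<le> d * (\<theta> * exp (- (d * E n)))"
      using d \<theta> that by (intro mult_left_mono) auto
    also have "\<dots> \<le> d * E (Suc n)"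
      unfolding E_def using d by (intro mult_left_mono expectation_cut_ratio_Suc) auto
    finally show ?thesis using up by simp
  qed
  \<comment> \<open>The iteration starts from \<open>d * E 0 = d * \<theta>\<close>, which is at
    least \<open>b\<close>, and then alternates between the two sides.\<close>
  have even: "b \<le> d * E (2 * k)" for k
  proof (induction k)
    case 0
    show ?case using ab by (simp add: E_def prob_space[simplified])
  next
    case (Suc k)
    show ?case using up_step[OF down_step[OF Suc]] by simp
  qed
  have odd: "d * E (Suc (2 * k)) \<le> a" for k
    by (rule down_step[OF even])
  have lim: "(\<lambda>k. E (2 * k)) \<longlonglongrightarrow> (\<integral>\<xi>. upper_ratio \<theta> \<xi> \<partial>offspring d)"
    unfolding E_def using cut_ratio_nonneg cut_ratio_le upper_ratio_LIMSEQ
    by (intro integral_dominated_convergence[where w = "\<lambda>_. \<theta>"]) auto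
  have lim': "(\<lambda>k. E (Suc (2 * k))) \<longlonglongrightarrow> (\<integral>\<xi>. lower_ratio \<theta> \<xi> \<partial>offspring d)"
    unfolding E_def using cut_ratio_nonneg cut_ratio_le lower_ratio_LIMSEQ
    by (intro integral_dominated_convergence[where w = "\<lambda>_. \<theta>"]) (auto simp del: cut_ratio.simps)
  \<comment> \<open>Equal limits would have equal expectations, but these are separated by
    \<open>a / d < b / d\<close>.\<close>
  have "b / d \<le> (\<integral>\<xi>. upper_ratio \<theta> \<xi> \<partial>offspring d)"
    using even d by (intro LIMSEQ_le_const[OF lim]) (auto simp: field_simps)
  also have "\<dots> = (\<integral>\<xi>. lower_ratio \<theta> \<xi> \<partial>offspring d)"
    using AE by (intro integral_cong_AE) auto
  also have "\<dots> \<le> a / d"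
    using odd d by (intro LIMSEQ_le_const2[OF lim']) (auto simp: field_simps)
  finally show False
    using ab d by (simp add: divide_le_cancel)
qed

end

text \<open>Solutions are intersections of ln x with the line d (x - 1), one of which is x = 1. For
  two solutions x < y < 1, the tangent of ln at y, compared with both x and 1, forces the slope to
  be 1 / y. Equality in ln z \<le> z - 1 at z = 1 / y then gives y = 1.\<close>

lemma poisson_extinction_unique:
  fixes x y d :: real
  assumes "x = exp (d * (x - 1))" "y = exp (d * (y - 1))" "x < 1" "y < 1"
  shows "x = y"
proof -
  have False if "x = exp (d * (x - 1))" "y = exp (d * (y - 1))" "x < y" "y < 1" for x y
  proof -
    have xy: "0 < x" "0 < y"
      using that by (metis exp_gt_zero)+
    have ln: "ln x = d * (x - 1)" "ln y = d * (y - 1)"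
      using that(1,2) by (metis ln_exp)+
    have "ln (x / y) \<le> x / y - 1"
      using xy by (intro ln_le_minus_one) simp
    then have "(x - y) * d \<le> (x - y) * (1 / y)"
      using xy ln by (simp add: ln_div algebra_simps diff_divide_distrib)
    then have "1 / y \<le> d"
      using that(3) by (subst (asm) mult_le_cancel_left_neg) auto
    have "ln (1 / y) \<le> 1 / y - 1"
      using xy by (intro ln_le_minus_one) simp
    then have "(1 - y) * d \<le> (1 - y) * (1 / y)"
      using xy ln by (simp add: ln_div algebra_simps diff_divide_distrib)
    then have "d \<le> 1 / y"
      using that(4) by (subst (asm) mult_le_cancel_left_pos) auto
    with \<open>1 / y \<le> d\<close> have "d = 1 / y" by simp
    then have "d * (1 - y) = 1 / y - 1"
      using xy by (simp add: field_simps)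
    moreover have "ln (1 / y) = d * (1 - y)"
      using xy ln by (simp add: ln_div algebra_simps)
    ultimately have "1 / y = 1"
      using xy by (intro ln_eq_minus_one) auto
    with that show False by simp
  qed
  note less = this
  show ?thesis
  proof (rule linorder_cases)
    assume "x < y" with less[OF assms(1,2)] assms(4) show ?thesis by blast
  next
    assume "y < x" with less[OF assms(2,1)] assms(3) show ?thesis by blast
  qed
qed

text \<open>The indicator of \<open>A\<close> is the product of its indicators on the subtrees of
  the children, so its probability is a fixed point of the Poisson generating function.\<close>

lemma prob_inherited:
  assumes d: "0 < d" and [measurable]: "A \<in> sets (offspring d)"
    and inh: "\<And>\<xi>. \<xi> \<in> A \<longleftrightarrow> (\<forall>i<\<xi> []. subtree [i] \<xi> \<in> A)"
  shows "measure (offspring d) A = exp (d * (measure (offspring d) A - 1))"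
proof -
  interpret prob_space "offspring d" by (rule prob_space_offspring)
  have "(\<Prod>j<\<xi> []. indicator A (subtree [j] \<xi>)) = (indicator A \<xi> :: ennreal)" for \<xi>
  proof (cases "\<xi> \<in> A")
    case True
    then have "\<forall>i<\<xi> []. subtree [i] \<xi> \<in> A"
      using inh[of \<xi>] by blast
    then have "(\<Prod>j<\<xi> []. indicator A (subtree [j] \<xi>)) = (1 :: ennreal)"
      by (intro prod.neutral) auto
    with True show ?thesis by simp
  next
    case False
    then obtain i where "i < \<xi> []" "subtree [i] \<xi> \<notin> A"
      using inh[of \<xi>] by blast
    then have "(\<Prod>j<\<xi> []. indicator A (subtree [j] \<xi>)) = (0 :: ennreal)"
      by (intro prod_zero bexI[of _ i]) auto
    with False show ?thesis by simp
  qed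
  moreover have "(\<integral>\<^sup>+\<xi>. (\<Prod>j<\<xi> []. indicator A (subtree [j] \<xi>)) \<partial>offspring d) =
      ennreal (exp (d * (measure (offspring d) A - 1)))"
    using d by (intro nn_integral_prod_subtrees) (auto simp: emeasure_eq_measure)
  ultimately have "emeasure (offspring d) A = ennreal (exp (d * (measure (offspring d) A - 1)))"
    by simp
  then show ?thesis
    by (simp add: emeasure_eq_measure)
qed

lemma Cons_gw_verts_iff: "i # v \<in> gw_verts \<xi> \<longleftrightarrow> i < \<xi> [] \<and> v \<in> gw_verts (subtree [i] \<xi>)"
proof (induction v rule: rev_induct)
  case Nil
  show ?case
    using gw_verts_snoc[of "[]" i \<xi>] by (simp add: gw_verts.root)
next
  case (snoc j v)
  have "i # (v @ [j]) \<in> gw_verts \<xi> \<longleftrightarrow> i # v \<in> gw_verts \<xi> \<and> j < \<xi> (i # v)"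
    using gw_verts_snoc[of "i # v" j \<xi>] by simp
  also have "\<dots> \<longleftrightarrow> i < \<xi> [] \<and> v @ [j] \<in> gw_verts (subtree [i] \<xi>)"
    by (auto simp: snoc gw_verts_snoc subtree_def)
  finally show ?case .
qed

lemma finite_tree_iff: "\<xi> \<notin> tree_infinite \<longleftrightarrow> (\<forall>i<\<xi> []. subtree [i] \<xi> \<notin> tree_infinite)"
proof -
  have eq: "gw_verts \<xi> = insert [] (\<Union>i<\<xi> []. (#) i ` gw_verts (subtree [i] \<xi>))"
  proof (intro set_eqI)
    fix v show "v \<in> gw_verts \<xi> \<longleftrightarrow> v \<in> insert [] (\<Union>i<\<xi> []. (#) i ` gw_verts (subtree [i] \<xi>))"
      by (cases v) (auto simp: Cons_gw_verts_iff gw_verts.root)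
  qed
  have "finite (gw_verts \<xi>) \<longleftrightarrow> (\<forall>i<\<xi> []. finite (gw_verts (subtree [i] \<xi>)))"
    by (subst eq) (auto simp: finite_image_iff)
  then show ?thesis
    by (simp add: tree_infinite_def gw_tree_def)
qed

text \<open>Agreement of the limits, and agreement on a finite tree, are both inherited in both
  directions. Both probabilities are below 1, so they coincide, and agreement has no mass on
  infinite trees.\<close>

theorem AE_ratios_differ:
  assumes d: "0 < d" and \<theta>: "0 < \<theta>"
    and not_AE: "\<not> (AE \<xi> in offspring d. upper_ratio \<theta> \<xi> = lower_ratio \<theta> \<xi>)"
  shows "AE \<xi> in offspring d. \<xi> \<in> tree_infinite \<longrightarrow> upper_ratio \<theta> \<xi> \<noteq> lower_ratio \<theta> \<xi>"
proof -
  interpret prob_space "offspring d" by (rule prob_space_offspring)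
  define A where "A = {\<xi>. upper_ratio \<theta> \<xi> = lower_ratio \<theta> \<xi>}"
  have A: "A \<in> sets (offspring d)"
  proof -
    have "{\<xi> \<in> space (offspring d). upper_ratio \<theta> \<xi> = lower_ratio \<theta> \<xi>} \<in> sets (offspring d)"
      using measurable_upper_ratio[OF \<theta>, of d] measurable_lower_ratio[OF \<theta>, of d] by measurable
    then show ?thesis by (simp add: A_def)
  qed
  have B: "A - tree_infinite \<in> sets (offspring d)"
    using A tree_infinite_measurable by blast
  have "prob A \<noteq> 1"
    using not_AE prob_eq_1[OF A] by (auto simp: A_def)
  then have lt: "prob A < 1"
    using prob_le_1[of A] by linarith
  have le: "prob (A - tree_infinite) \<le> prob A"
    using A by (intro finite_measure_mono) auto
  have pA: "prob A = exp (d * (prob A - 1))"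
  proof (rule prob_inherited[OF d A])
    show "\<xi> \<in> A \<longleftrightarrow> (\<forall>i<\<xi> []. subtree [i] \<xi> \<in> A)" for \<xi>
      unfolding A_def mem_Collect_eq by (rule ratios_agree_iff[OF \<theta>])
  qed
  have pB: "prob (A - tree_infinite) = exp (d * (prob (A - tree_infinite) - 1))"
  proof (rule prob_inherited[OF d B])
    show "\<xi> \<in> A - tree_infinite \<longleftrightarrow> (\<forall>i<\<xi> []. subtree [i] \<xi> \<in> A - tree_infinite)" for \<xi>
      unfolding A_def Diff_iff mem_Collect_eq ratios_agree_iff[OF \<theta>, of \<xi>] finite_tree_iff[of \<xi>] by blast
  qed
  have "prob A = prob (A - tree_infinite)"
    by (rule poisson_extinction_unique[OF pA pB lt le_less_trans[OF le lt]])
  then have "prob (A \<inter> tree_infinite) = 0"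
    using finite_measure_Diff'[OF A tree_infinite_measurable] by simp
  then have "A \<inter> tree_infinite \<in> null_sets (offspring d)"
    using A tree_infinite_measurable by (auto simp: null_sets_def emeasure_eq_measure)
  then show ?thesis
    by (rule AE_I') (auto simp: A_def)
qed

section \<open>Extremal boundary conditions\<close>

text \<open>The block is the root alone, whose only two traces have weights 1 and
  \<open>R\<close>.\<close>

lemma (in forest) prob_root_occupied:
  assumes bl: "interior_block \<Psi> {[]}" and bc: "boundary_condition H \<Psi> \<sigma>" and \<theta>: "0 < \<theta>"
    and root: "[] \<in> free_region \<Psi> \<sigma>"
  defines "R \<equiv> occ_ratio \<theta> H (free_region \<Psi> \<sigma>) []"
  shows "measure_pmf.prob (hardcore \<theta> H \<Psi> \<sigma>) {S. S \<inter> {[]} \<in> {{[]}}} = R / (1 + R)"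
proof -
  let ?W = "free_region \<Psi> \<sigma>"
  have fin: "finite ?W" "?W \<subseteq> verts H"
    using bl by (auto simp: interior_block_def free_region_def)
  have "\<not> adjacent H [] []"
    using adjacent_verts(3)[of "[]" "[]"] by blast
  then have I: "indep_sets H {[]} = {{}, {[]}}"
    using root fin by (auto simp: indep_sets_def independent_in_def)
  have "outer_children {[]} {[]} = child_set H []"
    by (auto simp: outer_children_def dest: length_child)
  then have "marginal_weight \<theta> ?W {[]} {[]} = R"
    using root fin by (simp add: marginal_weight_def R_def occ_ratio.simps[of \<theta> H ?W "[]"] prod_dividef)
  moreover have "marginal_weight \<theta> ?W {[]} {} = 1"
    by (simp add: marginal_weight_def outer_children_def)
  moreover have "indep_sets H {[]} \<inter> {{[]}} = {{[]}}"
    by (auto simp: I)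
  ultimately show ?thesis
    unfolding prob_hardcore_block[OF bl bc \<theta>] by (simp add: I)
qed

section \<open>Balls around the root\<close>

lemma verts_gw_tree [simp]: "verts (gw_tree \<xi>) = gw_verts \<xi>"
  by (simp add: gw_tree_def)

definition tree_ball :: "(nat list \<Rightarrow> nat) \<Rightarrow> nat \<Rightarrow> nat list set" where
  "tree_ball \<xi> h = {v \<in> gw_verts \<xi>. length v \<le> h}"

lemma finite_tree_ball: "finite (tree_ball \<xi> h)"
proof (induction h)
  case 0
  have "tree_ball \<xi> 0 \<subseteq> {[]}"
    by (auto simp: tree_ball_def)
  then show ?case
    by (rule finite_subset) simp
next
  case (Suc h)
  have "tree_ball \<xi> (Suc h) \<subseteq> insert [] (\<Union>v\<in>tree_ball \<xi> h. (\<lambda>i. v @ [i]) ` {..<\<xi> v})"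
  proof
    fix v assume "v \<in> tree_ball \<xi> (Suc h)"
    then show "v \<in> insert [] (\<Union>v\<in>tree_ball \<xi> h. (\<lambda>i. v @ [i]) ` {..<\<xi> v})"
      by (cases v rule: rev_cases) (auto simp: tree_ball_def gw_verts_snoc)
  qed
  then show ?case
    by (rule finite_subset) (use Suc in auto)
qed

text \<open>A childless vertex at depth \<open>h\<close> has no neighbour outside the ball and is
  therefore not on the boundary.\<close>

lemma inner_boundary_tree_ball:
  "inner_boundary (gw_tree \<xi>) (tree_ball \<xi> h) = {v \<in> gw_verts \<xi>. length v = h \<and> 0 < \<xi> v}"
proof (intro set_eqI iffI)
  fix v assume "v \<in> inner_boundary (gw_tree \<xi>) (tree_ball \<xi> h)"
  then obtain u where "v \<in> tree_ball \<xi> h" "u \<in> gw_verts \<xi>" "u \<notin> tree_ball \<xi> h" "adjacent (gw_tree \<xi>) v u"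
    by (auto simp: inner_boundary_def)
  then show "v \<in> {v \<in> gw_verts \<xi>. length v = h \<and> 0 < \<xi> v}"
    by (auto simp: tree_ball_def adjacent_gw_tree gw_verts_snoc)
next
  fix v assume v: "v \<in> {v \<in> gw_verts \<xi>. length v = h \<and> 0 < \<xi> v}"
  then have "v @ [0] \<in> verts (gw_tree \<xi>) - tree_ball \<xi> h" "adjacent (gw_tree \<xi>) v (v @ [0])"
    by (auto simp: tree_ball_def adjacent_gw_tree gw_verts_snoc)
  with v show "v \<in> inner_boundary (gw_tree \<xi>) (tree_ball \<xi> h)"
    by (auto simp: inner_boundary_def tree_ball_def)
qed

lemma length_le_vertex_dist: "enat (length u) \<le> vertex_dist (gw_tree \<xi>) [] u"
proof -
  have "length u \<le> k" if "([], u) \<in> {(x, y). adjacent (gw_tree \<xi>) x y} ^^ k" for k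
    using that
  proof (induction k arbitrary: u)
    case (Suc k)
    then obtain w where "([], w) \<in> {(x, y). adjacent (gw_tree \<xi>) x y} ^^ k" "adjacent (gw_tree \<xi>) w u"
      by auto
    with Suc.IH[of w] show ?case
      by (auto simp: adjacent_gw_tree)
  qed simp
  then show ?thesis
    unfolding vertex_dist_def by (intro INF_greatest) auto
qed

text \<open>All boundary vertices have the same depth, so no two of them are adjacent and full
  occupation is admissible.\<close>

lemma boundary_conditions_tree_ball:
  "boundary_condition (gw_tree \<xi>) (tree_ball \<xi> h) (inner_boundary (gw_tree \<xi>) (tree_ball \<xi> h))"
  "boundary_condition (gw_tree \<xi>) (tree_ball \<xi> h) {}"
proof -
  have "\<not> adjacent (gw_tree \<xi>) u v" if "length u = length v" for u v
    using that by (auto simp: adjacent_gw_tree)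
  then show "boundary_condition (gw_tree \<xi>) (tree_ball \<xi> h) (inner_boundary (gw_tree \<xi>) (tree_ball \<xi> h))"
    unfolding inner_boundary_tree_ball boundary_condition_def independent_in_def by simp
qed (simp add: boundary_condition_def independent_in_def)

text \<open>Occupying or emptying the whole boundary are the two extremal boundary conditions; the
  resulting ratios alternate around the interval between the two limits.\<close>

lemma extremal_ratios:
  fixes \<xi> h
  assumes \<theta>: "0 < \<theta>"
  defines "T \<equiv> gw_tree \<xi>"
  defines "\<Psi> \<equiv> tree_ball \<xi> h"
  defines "s \<equiv> occ_ratio \<theta> T (forest.free_region T \<Psi> (inner_boundary T \<Psi>))"
    and "t \<equiv> occ_ratio \<theta> T (forest.free_region T \<Psi> {})"
  shows "v \<in> gw_verts \<xi> \<Longrightarrow> length v + j + 1 = h \<Longrightarrow>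
    (if even j then s v \<le> lower_ratio \<theta> (subtree v \<xi>) \<and> upper_ratio \<theta> (subtree v \<xi>) \<le> t v
     else t v \<le> lower_ratio \<theta> (subtree v \<xi>) \<and> upper_ratio \<theta> (subtree v \<xi>) \<le> s v)"
proof (induction j arbitrary: v)
  interpret forest T
    unfolding T_def by (rule forest_subgraph_gw_tree[OF subgraph_gw_tree_refl])
  have fin: "finite (free_region \<Psi> \<sigma>)" for \<sigma>
    by (simp add: free_region_def \<Psi>_def finite_tree_ball)
  have nonneg: "0 \<le> s v" "0 \<le> t v" for v
    using \<theta> by (simp_all add: s_def t_def occ_ratio_nonneg)
  have rec: "occ_ratio \<theta> T (free_region \<Psi> \<sigma>) v =
      \<theta> * (\<Prod>i<\<xi> v. 1 / (1 + occ_ratio \<theta> T (free_region \<Psi> \<sigma>) (v @ [i])))"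
    if "v \<in> gw_verts \<xi>" "v \<in> free_region \<Psi> \<sigma>" for v \<sigma>
  proof -
    have "child_set T v = (\<lambda>i. v @ [i]) ` {..<\<xi> v}"
      using that by (simp add: T_def child_set_gw_tree)
    then show ?thesis
      using fin that by (simp add: occ_ratio.simps[of \<theta> T _ v] prod.reindex inj_on_def)
  qed
  have bdry: "inner_boundary T \<Psi> = {v \<in> gw_verts \<xi>. length v = h \<and> 0 < \<xi> v}"
    unfolding T_def \<Psi>_def by (rule inner_boundary_tree_ball)
  have region: "v \<in> free_region \<Psi> \<sigma>"
    if "v \<in> gw_verts \<xi>" "length v \<le> h" "length v = h \<Longrightarrow> \<xi> v = 0" "\<And>x. x \<in> \<sigma> \<Longrightarrow> \<not> adjacent T v x" for v \<sigma>
  proof -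
    have "v \<in> \<Psi>" "v \<notin> inner_boundary T \<Psi>"
      using that unfolding bdry by (auto simp: \<Psi>_def tree_ball_def)
    with that show ?thesis by (auto simp: free_region_def)
  qed
  have low: "v \<in> free_region \<Psi> \<sigma>"
    if "v \<in> gw_verts \<xi>" "length v + 1 < h" "\<sigma> \<subseteq> inner_boundary T \<Psi>" for v \<sigma>
  proof (rule region)
    fix x assume "x \<in> \<sigma>"
    with that(3) have "length x = h" unfolding bdry by auto
    with that(2) show "\<not> adjacent T v x"
      by (auto simp: T_def adjacent_gw_tree)
  qed (use that in auto)
  have upper_rec: "upper_ratio \<theta> (subtree v \<xi>) = \<theta> * (\<Prod>i<\<xi> v. 1 / (1 + lower_ratio \<theta> (subtree (v @ [i]) \<xi>)))" for v
    using upper_ratio_rec[OF \<theta>, of "subtree v \<xi>"] by simp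
  have lower_rec: "lower_ratio \<theta> (subtree v \<xi>) = \<theta> * (\<Prod>i<\<xi> v. 1 / (1 + upper_ratio \<theta> (subtree (v @ [i]) \<xi>)))" for v
    using lower_ratio_rec[OF \<theta>, of "subtree v \<xi>"] by simp
  {
    case 0
    have v: "v \<in> gw_verts \<xi>" "length v + 1 = h" using 0 by auto
    have "v \<in> free_region \<Psi> {}"
      using v by (intro region) auto
    then have t_rec: "t v = \<theta> * (\<Prod>i<\<xi> v. 1 / (1 + t (v @ [i])))"
      unfolding t_def using v by (intro rec)
    \<comment> \<open>With an empty boundary, a child on the boundary has odds 0, the least
      possible. A childless child has odds \<theta>, and so do both limits there.\<close>
    have t_le: "t (v @ [i]) \<le> lower_ratio \<theta> (subtree (v @ [i]) \<xi>)" if "i < \<xi> v" for i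
    proof (cases "\<xi> (v @ [i]) = 0")
      case True
      then have "lower_ratio \<theta> (subtree (v @ [i]) \<xi>) = \<theta>"
        by (simp add: lower_rec)
      then show ?thesis
        using \<theta> by (simp add: t_def occ_ratio_le)
    next
      case False
      then have "v @ [i] \<notin> free_region \<Psi> {}"
        using v that unfolding free_region_def bdry by (auto simp: gw_verts_snoc)
      then show ?thesis
        using lower_ratio_nonneg[OF \<theta>] by (simp add: t_def)
    qed
    have "upper_ratio \<theta> (subtree v \<xi>) \<le> t v"
      unfolding t_rec upper_rec[of v] using \<theta> t_le nonneg
      by (intro mult_left_mono prod_inverse_one_plus_antimono) auto
    \<comment> \<open>With a full boundary, \<open>v\<close> is forced to be empty as soon as one of
      its children has children. Otherwise all children have odds exactly \<theta> and
      \<open>s v\<close> equals the limit.\<close>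
    moreover have "s v \<le> lower_ratio \<theta> (subtree v \<xi>)"
    proof (cases "v \<in> free_region \<Psi> (inner_boundary T \<Psi>)")
      case True
      have leaf: "\<xi> (v @ [i]) = 0" if "i < \<xi> v" for i
      proof (rule ccontr)
        assume "\<xi> (v @ [i]) \<noteq> 0"
        then have "v @ [i] \<in> inner_boundary T \<Psi>" "adjacent T v (v @ [i])"
          unfolding bdry using v that by (auto simp: gw_verts_snoc T_def adjacent_gw_tree)
        with True show False by (auto simp: free_region_def)
      qed
      have "s (v @ [i]) = \<theta>" if "i < \<xi> v" for i
      proof -
        have c: "v @ [i] \<in> gw_verts \<xi>"
          using v that by (simp add: gw_verts_snoc)
        have "v @ [i] \<in> free_region \<Psi> (inner_boundary T \<Psi>)"
        proof (rule region)
          fix x assume "x \<in> inner_boundary T \<Psi>"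
          then have "length x = h" unfolding bdry by auto
          with v show "\<not> adjacent T (v @ [i]) x"
            by (auto simp: T_def adjacent_gw_tree)
        qed (use c v leaf[OF that] in auto)
        then show ?thesis
          unfolding s_def using leaf[OF that] by (subst rec[OF c]) auto
      qed
      moreover have "upper_ratio \<theta> (subtree (v @ [i]) \<xi>) = \<theta>" if "i < \<xi> v" for i
        using leaf[OF that] by (simp add: upper_rec)
      moreover have "s v = \<theta> * (\<Prod>i<\<xi> v. 1 / (1 + s (v @ [i])))"
        unfolding s_def by (rule rec[OF v(1) True])
      ultimately show ?thesis
        unfolding lower_rec[of v] by simp
    next
      case False
      then show ?thesis
        using lower_ratio_nonneg[OF \<theta>] by (simp add: s_def)
    qed
    ultimately show ?case by simp
  next
    case (Suc j)
    have v: "v \<in> gw_verts \<xi>" "length v + 1 < h" using Suc.prems by auto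
    have t_rec: "t v = \<theta> * (\<Prod>i<\<xi> v. 1 / (1 + t (v @ [i])))"
      unfolding t_def using v by (intro rec low) auto
    have s_rec: "s v = \<theta> * (\<Prod>i<\<xi> v. 1 / (1 + s (v @ [i])))"
      unfolding s_def using v by (intro rec low) auto
    have IH: "if even j then s (v @ [i]) \<le> lower_ratio \<theta> (subtree (v @ [i]) \<xi>) \<and> upper_ratio \<theta> (subtree (v @ [i]) \<xi>) \<le> t (v @ [i])
     else t (v @ [i]) \<le> lower_ratio \<theta> (subtree (v @ [i]) \<xi>) \<and> upper_ratio \<theta> (subtree (v @ [i]) \<xi>) \<le> s (v @ [i])"
      if "i < \<xi> v" for i
      using v that Suc.prems by (intro Suc.IH) (auto simp: gw_verts_snoc)
    have up0: "0 \<le> upper_ratio \<theta> \<zeta>" for \<zeta>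
      using lower_ratio_nonneg[OF \<theta>] lower_le_upper_ratio[OF \<theta>] by (rule order_trans)
    show ?case
    \<comment> \<open>One generation up the inequalities are reversed, so \<open>s\<close> and
      \<open>t\<close> exchange their roles.\<close>
    proof (cases "even j")
      case True
      then show ?thesis
        unfolding t_rec s_rec upper_rec[of v] lower_rec[of v] using IH \<theta> nonneg up0 lower_ratio_nonneg[OF \<theta>]
        by (auto intro!: mult_left_mono prod_inverse_one_plus_antimono)
    next
      case False
      then show ?thesis
        unfolding t_rec s_rec upper_rec[of v] lower_rec[of v] using IH \<theta> nonneg up0 lower_ratio_nonneg[OF \<theta>]
        by (auto intro!: mult_left_mono prod_inverse_one_plus_antimono)
    qed
  }
qed

text \<open>On every ball the full and the empty boundary yield root odds on opposite sides of the
  interval between the two limits, so the occupation probabilities of the root stay apart.\<close>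

theorem not_WSM_of_ratios_differ:
  assumes \<theta>: "0 < \<theta>" and differ: "upper_ratio \<theta> \<xi> \<noteq> lower_ratio \<theta> \<xi>"
  shows "\<not> WSM \<theta> (gw_tree \<xi>)"
proof
  let ?T = "gw_tree \<xi>"
  interpret forest ?T
    by (rule forest_subgraph_gw_tree[OF subgraph_gw_tree_refl])
  \<comment> \<open>Radius at least 2 keeps the root from being adjacent to the boundary.\<close>
  define \<Psi> where "\<Psi> n = tree_ball \<xi> (n + 2)" for n
  define \<sigma> where "\<sigma> n = inner_boundary ?T (\<Psi> n)" for n
  \<comment> \<open>The map R / (1 + R) shrinks differences of odds in [0, \<theta>] at most by the
    factor \<open>(1 + \<theta>)\<^sup>2\<close>.\<close>
  define gap where "gap = (upper_ratio \<theta> \<xi> - lower_ratio \<theta> \<xi>) / (1 + \<theta>)\<^sup>2"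
  have gap: "0 < gap"
    using differ lower_le_upper_ratio[OF \<theta>, of \<xi>] \<theta> by (auto simp: gap_def intro!: divide_pos_pos)
  have bdry: "inner_boundary ?T (\<Psi> n) = {v \<in> gw_verts \<xi>. length v = n + 2 \<and> 0 < \<xi> v}" for n
    unfolding \<Psi>_def by (rule inner_boundary_tree_ball)
  have bc: "boundary_condition ?T (\<Psi> n) (\<sigma> n)" "boundary_condition ?T (\<Psi> n) {}" for n
    unfolding \<sigma>_def \<Psi>_def by (rule boundary_conditions_tree_ball)+
  have bl: "interior_block (\<Psi> n) {[]}" for n
    unfolding interior_block_def bdry
    by (auto simp: \<Psi>_def finite_tree_ball adjacent_gw_tree dest: length_child)
      (auto simp: tree_ball_def gw_verts.root)
  have root: "[] \<in> free_region (\<Psi> n) (\<sigma> n)" "[] \<in> free_region (\<Psi> n) {}" for n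
    unfolding free_region_def bdry \<sigma>_def
    by (auto simp: adjacent_gw_tree) (auto simp: \<Psi>_def tree_ball_def gw_verts.root)
  have dist: "(\<lambda>n. set_dist ?T {[]} (inner_boundary ?T (\<Psi> n))) \<longlonglongrightarrow> \<infinity>"
  proof (rule order_tendstoI)
    fix a :: enat assume "a < \<infinity>"
    then obtain N where N: "a = enat N" by auto
    have "a < set_dist ?T {[]} (inner_boundary ?T (\<Psi> n))" if "N \<le> n" for n
    proof -
      have "a < enat (n + 2)" using that N by simp
      also have "enat (n + 2) \<le> set_dist ?T {[]} (inner_boundary ?T (\<Psi> n))"
        unfolding set_dist_def bdry
      proof (simp, intro INF_greatest)
        fix v assume "v \<in> {v \<in> gw_verts \<xi>. length v = Suc (Suc n) \<and> 0 < \<xi> v}"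
        with length_le_vertex_dist[of v \<xi>] show "enat (Suc (Suc n)) \<le> vertex_dist ?T [] v" by simp
      qed
      finally show ?thesis .
    qed
    then show "\<forall>\<^sub>F n in sequentially. a < set_dist ?T {[]} (inner_boundary ?T (\<Psi> n))"
      by (auto simp: eventually_sequentially)
  qed simp
  have tv: "gap \<le> tv_dist_on {[]} (hardcore \<theta> ?T (\<Psi> n) (\<sigma> n)) (hardcore \<theta> ?T (\<Psi> n) {})" for n
  proof -
    define R where "R = occ_ratio \<theta> ?T (free_region (\<Psi> n) (\<sigma> n)) []"
    define R' where "R' = occ_ratio \<theta> ?T (free_region (\<Psi> n) {}) []"
    have R: "0 \<le> R" "R \<le> \<theta>" "0 \<le> R'" "R' \<le> \<theta>"
      using \<theta> by (auto simp: R_def R'_def occ_ratio_nonneg occ_ratio_le)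
    have "upper_ratio \<theta> \<xi> - lower_ratio \<theta> \<xi> \<le> \<bar>R - R'\<bar>"
      using extremal_ratios[OF \<theta>, of "[]" \<xi> "Suc n" "n + 2"] lower_le_upper_ratio[OF \<theta>, of \<xi>]
      by (auto simp: R_def R'_def \<sigma>_def \<Psi>_def gw_verts.root split: if_splits)
    then have "gap \<le> \<bar>R - R'\<bar> / (1 + \<theta>)\<^sup>2"
      unfolding gap_def by (rule divide_right_mono) simp
    also have "\<dots> \<le> \<bar>R - R'\<bar> / ((1 + R) * (1 + R'))"
      using R \<theta> by (intro divide_left_mono) (auto simp: power2_eq_square intro!: mult_mono mult_pos_pos)
    also have "\<dots> = \<bar>R / (1 + R) - R' / (1 + R')\<bar>"
    proof -
      have "R / (1 + R) - R' / (1 + R') = (R - R') / ((1 + R) * (1 + R'))"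
        using R by (simp add: field_simps)
      then show ?thesis
        using R by (simp add: abs_divide abs_mult)
    qed
    also have "\<dots> \<le> tv_dist_on {[]} (hardcore \<theta> ?T (\<Psi> n) (\<sigma> n)) (hardcore \<theta> ?T (\<Psi> n) {})"
      using tv_dist_on_ge[of "hardcore \<theta> ?T (\<Psi> n) (\<sigma> n)" "{[]}" "{{[]}}" "hardcore \<theta> ?T (\<Psi> n) {}"]
      unfolding prob_root_occupied[OF bl bc(1) \<theta> root(1)] prob_root_occupied[OF bl bc(2) \<theta> root(2)] R_def R'_def .
    finally show ?thesis .
  qed
  assume "WSM \<theta> ?T"
  moreover have "finite (\<Psi> n) \<and> {[]} \<subseteq> \<Psi> n \<and> \<Psi> n \<subseteq> verts ?T \<and>
      boundary_condition ?T (\<Psi> n) (\<sigma> n) \<and> boundary_condition ?T (\<Psi> n) {}" for n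
    using bl bc by (simp add: interior_block_def)
  ultimately have "(\<lambda>n. tv_dist_on {[]} (hardcore \<theta> ?T (\<Psi> n) (\<sigma> n)) (hardcore \<theta> ?T (\<Psi> n) {})) \<longlonglongrightarrow> 0"
    using dist unfolding WSM_def by (elim allE[of _ "{[]}"] allE[of _ \<Psi>] allE[of _ \<sigma>] allE[of _ "\<lambda>_. {}"]) auto
  from LIMSEQ_le_const[OF this, of gap] tv gap show False
    by auto
qed

text \<open>With c = e + \<epsilon>, the map c exp (- x) has a fixed point x > 1, where its slope is
  - x; so it is repelling. A small symmetric interval around it is therefore mapped beyond its own
  ends. The last inequality is strict to leave room for a perturbation.\<close>

lemma two_cycle_exists:
  assumes \<epsilon>: "0 < \<epsilon>"
  obtains a b :: real where "0 < a" "a < b" "b \<le> exp 1 + \<epsilon>"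
    "b \<le> (exp 1 + \<epsilon>) * exp (- a)" "(exp 1 + \<epsilon>) * exp (- b) < a"
proof -
  let ?c = "exp 1 + \<epsilon>"
  have "\<exists>x\<ge>1. x \<le> 1 + \<epsilon> \<and> x * exp x = ?c"
  proof (rule IVT')
    have "exp 1 + \<epsilon> \<le> (1 + \<epsilon>) * exp (1::real)"
    proof -
      have "1 \<le> exp (1::real)" by simp
      then have "\<epsilon> * 1 \<le> \<epsilon> * exp 1"
        using \<epsilon> by (intro mult_left_mono) auto
      then show ?thesis by (simp add: algebra_simps)
    qed
    also have "\<dots> \<le> (1 + \<epsilon>) * exp (1 + \<epsilon>)"
      using \<epsilon> by (intro mult_left_mono) auto
    finally show "?c \<le> (1 + \<epsilon>) * exp (1 + \<epsilon>)" .
  qed (use \<epsilon> in \<open>auto intro!: continuous_intros\<close>)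
  then obtain x where x: "1 \<le> x" "x * exp x = ?c" by blast
  have "x \<noteq> 1" using x(2) \<epsilon> by auto
  with x(1) have x1: "1 < x" by simp
  \<comment> \<open>Small enough for the quadratic Taylor bound: the step
    \<open>1 < x * (1 - \<delta> / 2)\<close> becomes 1 < (x + 1) / 2.\<close>
  define \<delta> where "\<delta> = (x - 1) / x"
  have \<delta>: "0 < \<delta>" "\<delta> < 1" "x * \<delta> = x - 1"
    using x1 by (auto simp: \<delta>_def field_simps)
  show thesis
  proof (rule that[of "x - \<delta>" "x + \<delta>"])
    show "0 < x - \<delta>" "x - \<delta> < x + \<delta>" using x1 \<delta> by auto
    have exp_shift: "?c * exp (- (x + y)) = x * exp (- y)" for y
      unfolding x(2)[symmetric] by (simp add: exp_add[symmetric] mult.assoc)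
    have "x + \<delta> \<le> x * (1 + \<delta>)"
      using x1 \<delta> by (simp add: algebra_simps)
    also have "\<dots> \<le> x * exp \<delta>"
      using x1 exp_ge_add_one_self[of \<delta>] by (intro mult_left_mono) auto
    also have "\<dots> = ?c * exp (- (x - \<delta>))"
      using exp_shift[of "- \<delta>"] by simp
    finally show *: "x + \<delta> \<le> ?c * exp (- (x - \<delta>))" .
    have "exp (- (x - \<delta>)) \<le> 1" using x1 \<delta> by simp
    then have "?c * exp (- (x - \<delta>)) \<le> ?c * 1"
      using \<epsilon> by (intro mult_left_mono) (auto intro: add_nonneg_nonneg)
    with * show "x + \<delta> \<le> ?c" by simp
    have "exp (- \<delta>) \<le> 1 - \<delta> + \<delta>\<^sup>2 / 2"
      using exp_neg_le_Taylor[of \<delta> 3] \<delta> by (simp add: lessThan_nat_numeral fact_numeral)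
    then have "x * exp (- \<delta>) \<le> x * (1 - \<delta> + \<delta>\<^sup>2 / 2)"
      using x1 by (intro mult_left_mono) auto
    also have "\<dots> = x - \<delta> * (x * (1 - \<delta> / 2))"
      by (simp add: power2_eq_square algebra_simps)
    also have "\<dots> < x - \<delta> * 1"
    proof -
      have "1 < x * (1 - \<delta> / 2)"
        using \<delta>(3) x1 by (simp add: algebra_simps)
      then show ?thesis
        using \<delta> by (intro diff_strict_left_mono mult_strict_left_mono) auto
    qed
    finally show "?c * exp (- (x + \<delta>)) < x - \<delta>"
      unfolding exp_shift by simp
  qed
qed

text \<open>The numbers \<open>a\<close> and \<open>b\<close> depend on \<epsilon> only. With
  \<theta> = (e + \<epsilon>) / d, the correction 1 / (1 + \<theta>) tends to 1 as d grows, and the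
  strict inequality of the two-cycle survives.\<close>

lemma eventually_not_WSM_above_e:
  assumes \<epsilon>: "0 < \<epsilon>"
  shows "\<forall>\<^sub>F d in at_top. almost_surely_given_infinite d (\<lambda>T. \<not> WSM ((exp 1 + \<epsilon>) / d) T)"
proof -
  let ?c = "exp 1 + \<epsilon>"
  obtain a b :: real where ab: "0 < a" "a < b" "b \<le> ?c" "b \<le> ?c * exp (- a)" "?c * exp (- b) < a"
    using two_cycle_exists[OF \<epsilon>] by blast
  have "((\<lambda>d::real. ?c / d) \<longlongrightarrow> 0) at_top"
    by (intro tendsto_divide_0[OF tendsto_const] filterlim_at_top_imp_at_infinity filterlim_ident)
  then have "((\<lambda>d::real. ?c * exp (- (b / (1 + ?c / d)))) \<longlongrightarrow> ?c * exp (- (b / (1 + 0)))) at_top"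
    by (intro tendsto_intros) auto
  then have "\<forall>\<^sub>F d in at_top. ?c * exp (- (b / (1 + ?c / d))) < a"
    using ab(5) by (intro order_tendstoD) auto
  then show ?thesis
    using eventually_gt_at_top[of "0::real"]
  proof eventually_elim
    case (elim d)
    have c: "0 < ?c" using \<epsilon> by (simp add: add_pos_pos)
    have \<theta>: "0 < ?c / d" using c elim by simp
    have eq: "d * (?c / d) = ?c" using elim by simp
    have "\<not> (AE \<xi> in offspring d. upper_ratio (?c / d) \<xi> = lower_ratio (?c / d) \<xi>)"
      by (rule not_AE_ratios_agree[OF \<theta> elim(2) ab(1,2)], unfold eq) (use ab elim in auto)
    then have "AE \<xi> in offspring d. \<xi> \<in> tree_infinite \<longrightarrow> upper_ratio (?c / d) \<xi> \<noteq> lower_ratio (?c / d) \<xi>"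
      by (rule AE_ratios_differ[OF elim(2) \<theta>])
    then have "AE \<xi> in offspring d. \<xi> \<in> tree_infinite \<longrightarrow> \<not> WSM (?c / d) (gw_tree \<xi>)"
      by eventually_elim (use not_WSM_of_ratios_differ[OF \<theta>] in blast)
    then show ?case
      by (rule almost_surely_given_infiniteI)
  qed
qed

text \<open>A diagonal choice: at \<open>d\<close> the error is 1 / (n + 1) for the largest
  \<open>n\<close> whose threshold \<open>D n\<close> has been reached.\<close>

lemma eventually_diagonal:
  fixes P :: "real \<Rightarrow> real \<Rightarrow> bool"
  assumes "\<And>\<epsilon>. 0 < \<epsilon> \<Longrightarrow> \<forall>\<^sub>F d in at_top. P d \<epsilon>"
  shows "\<exists>\<eta>. (\<eta> \<longlongrightarrow> 0) at_top \<and> (\<forall>\<^sub>F d in at_top. P d (\<eta> d))"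
proof -
  have "\<forall>n. \<exists>D. \<forall>d\<ge>D. P d (1 / real (Suc n))"
    using assms[of "1 / real (Suc n)" for n] by (simp add: eventually_at_top_linorder)
  then obtain D where D: "\<And>n d. D n \<le> d \<Longrightarrow> P d (1 / real (Suc n))"
    by metis
  \<comment> \<open>The condition \<open>real n \<le> d\<close> bounds the admissible
    \<open>n\<close>, so that a greatest one exists.\<close>
  define good where "good d n \<longleftrightarrow> D n \<le> d \<and> real n \<le> d" for d n
  define N where "N d = (GREATEST n. good d n)" for d
  define \<eta> where "\<eta> d = 1 / real (Suc (N d))" for d
  have bound: "\<forall>n. good d n \<longrightarrow> n \<le> nat \<lfloor>d\<rfloor>" for d
    by (auto simp: good_def le_nat_floor)
  have N_good: "good d (N d)" and N_ge: "n \<le> N d" if "good d n" for d n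
    unfolding N_def using that bound[of d] by (auto intro: GreatestI_nat Greatest_le_nat)
  have ev: "\<forall>\<^sub>F d in at_top. good d n" for n
    unfolding good_def using eventually_ge_at_top[of "D n"] eventually_ge_at_top[of "real n"]
    by eventually_elim simp
  have "\<forall>\<^sub>F d in at_top. P d (\<eta> d)"
    using ev[of 0]
  proof eventually_elim
    case (elim d)
    from N_good[OF this] show ?case
      unfolding \<eta>_def good_def by (intro D) simp
  qed
  moreover have "(\<eta> \<longlongrightarrow> 0) at_top"
  proof (rule tendstoI)
    fix e :: real assume "0 < e"
    then obtain n where n: "1 / real (Suc n) < e"
      using nat_approx_posE by blast
    show "\<forall>\<^sub>F d in at_top. dist (\<eta> d) 0 < e"
      using ev[of n]
    proof eventually_elim
      case (elim d)
      have "\<eta> d \<le> 1 / real (Suc n)"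
        using N_ge[OF elim] by (simp add: \<eta>_def frac_le)
      with n show ?case
        by (simp add: \<eta>_def)
    qed
  qed
  ultimately show ?thesis by blast
qed

theorem theorem1p2:
  shows
    "(1.179 \<le> d0 \<and> d0 < 1.18 \<and>
      (\<forall>d \<theta>::real. 1 < d \<longrightarrow> d < d0 \<longrightarrow> 0 < \<theta> \<longrightarrow>
         almost_surely_given_infinite d (\<lambda>T. WSM \<theta> T))) \<and>
     (\<forall>d \<theta>::real. 1 < d \<longrightarrow> 0 < \<theta> \<longrightarrow>
         \<theta> < (if d < sqrt (2 + sqrt 5) then 4 * d\<^sup>2 / (d\<^sup>2 - 1)\<^sup>2
              else (3 + sqrt (1 + 4 * d\<^sup>2)) / (2 * d\<^sup>2 - 4)) \<longrightarrow>
         almost_surely_given_infinite d (\<lambda>T. SSM \<theta> T)) \<and>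
     (\<exists>\<eta>\<^sub>1 :: real \<Rightarrow> real. (\<eta>\<^sub>1 \<longlongrightarrow> 0) at_top \<and>
        (\<forall>d \<theta>::real. 1 < d \<longrightarrow> 0 < \<theta> \<longrightarrow> \<theta> < (exp 1 - \<eta>\<^sub>1 d) / d \<longrightarrow>
           almost_surely_given_infinite d (\<lambda>T. WSM \<theta> T))) \<and>
     (\<exists>\<eta>\<^sub>2 :: real \<Rightarrow> real. (\<eta>\<^sub>2 \<longlongrightarrow> 0) at_top \<and>
        (\<forall>\<^sub>F d in at_top.
           almost_surely_given_infinite d (\<lambda>T. \<not> WSM ((exp 1 + \<eta>\<^sub>2 d) / d) T)))"
proof (intro conjI)
  show "1.179 \<le> d0" "d0 < 1.18"
    by (rule d0_bounds)+
  show "\<forall>d \<theta>::real. 1 < d \<longrightarrow> d < d0 \<longrightarrow> 0 < \<theta> \<longrightarrow> almost_surely_given_infinite d (\<lambda>T. WSM \<theta> T)"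
    using WSM_below_d0 by blast
  show "\<forall>d \<theta>::real. 1 < d \<longrightarrow> 0 < \<theta> \<longrightarrow>
         \<theta> < (if d < sqrt (2 + sqrt 5) then 4 * d\<^sup>2 / (d\<^sup>2 - 1)\<^sup>2
              else (3 + sqrt (1 + 4 * d\<^sup>2)) / (2 * d\<^sup>2 - 4)) \<longrightarrow>
         almost_surely_given_infinite d (\<lambda>T. SSM \<theta> T)"
  proof (intro allI impI)
    fix d \<theta> :: real
    assume d: "1 < d" and \<theta>: "0 < \<theta>" and le: "\<theta> < (if d < sqrt (2 + sqrt 5) then 4 * d\<^sup>2 / (d\<^sup>2 - 1)\<^sup>2
              else (3 + sqrt (1 + 4 * d\<^sup>2)) / (2 * d\<^sup>2 - 4))"
    obtain K where "0 < K" "K * d\<^sup>2 < 1"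
      "\<And>x. 0 \<le> x \<Longrightarrow> x \<le> \<theta> \<Longrightarrow> \<theta> / (1 + x + \<theta>) * (x / (1 + x)) \<le> K"
      using two_step_contraction[OF d \<theta> le] by blast
    with d \<theta> show "almost_surely_given_infinite d (\<lambda>T. SSM \<theta> T)"
      by (rule SSM_of_two_step_contraction)
  qed
  show "\<exists>\<eta>\<^sub>1 :: real \<Rightarrow> real. (\<eta>\<^sub>1 \<longlongrightarrow> 0) at_top \<and>
        (\<forall>d \<theta>::real. 1 < d \<longrightarrow> 0 < \<theta> \<longrightarrow> \<theta> < (exp 1 - \<eta>\<^sub>1 d) / d \<longrightarrow>
           almost_surely_given_infinite d (\<lambda>T. WSM \<theta> T))"
    by (rule exI[of _ "\<lambda>_. 0"]) (simp add: WSM_below_e)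
  show "\<exists>\<eta>\<^sub>2 :: real \<Rightarrow> real. (\<eta>\<^sub>2 \<longlongrightarrow> 0) at_top \<and>
        (\<forall>\<^sub>F d in at_top.
           almost_surely_given_infinite d (\<lambda>T. \<not> WSM ((exp 1 + \<eta>\<^sub>2 d) / d) T))"
    by (rule eventually_diagonal) (rule eventually_not_WSM_above_e)
qed

end
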